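(* Let $M$ be a smooth connected Riemannian manifold without boundary. a) The map $$\Psi:\mathscr{M}(M)\longrightarrow(\Omega^1_{\mathsf{C}_\infty}(M))^*,\qquad \Psi[(\mu,\sigma)](\alpha):=\int_M(\sigma,\alpha)\,\mathrm{d}\mu,$$ is a well-defined bijection, and $\|\Psi[(\mu,\sigma)]\|_{\infty,*}=\mu(M)$ for all $[(\mu,\sigma)]\in\mathscr{M}(M)$. b) A function $f\in\mathsf{L}^1_{\mathrm{loc}}(M)$ has bounded variation (i.e. $\mathrm{Var}(f)<\infty$) if and only if $\|\mathrm{d}f\|_{\infty,*}<\infty$, and then one has $\mathrm{Var}(f)=\|\mathrm{d}f\|_{\infty,*}$.
   Context: Notation: $\mathrm{vol}$ is the Riemannian volume measure. All functions and forms are complex-valued; $\mathrm{T}^*M$ denotes the complexified cotangent bundle with the Hermitian structure $(\cdot,\cdot)_x$ induced by the metric (linear in the second argument, conjugate-linear in the first) and norm $|\cdot|_x$. $\Omega^1_{\mathsf{C}^\infty_0}(M)$ is the space of smooth compactly supported $1$-forms, $\Omega^1_{\mathsf{C}_\infty}(M)$ the complex Banach space of continuous $1$-forms vanishing at infinity, with norm $\|\alpha\|_\infty=\sup_x|\alpha(x)|_x$. Its Banach dual $(\Omega^1_{\mathsf{C}_\infty}(M))^*$ is called the space of generalized vector measures on $M$; its canonical norm is $\|\cdot\|_{\infty,*}$. For a linear functional $T$ on $\Omega^1_{\mathsf{C}^\infty_0}(M)$ one sets $\|T\|_{\infty,*}=\sup\{|T(\alpha)|:\alpha\in\Omega^1_{\mathsf{C}^\infty_0}(M),\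 \|\alpha\|_\infty\le1\}\in[0,\infty]$; if this is finite, $T$ extends uniquely to an element of $(\Omega^1_{\mathsf{C}_\infty}(M))^*$ with the same norm. $\mathscr{M}(M)$ is the set of equivalence classes $[(\mu,\sigma)]$ of pairs with $\mu$ a finite positive Borel measure on $M$ and $\sigma$ a Borel section of $\mathrm{T}^*M$ with $|\sigma|=1$ $\mu$-a.e., where $(\mu,\sigma)\sim(\mu',\sigma')$ iff $\mu=\mu'$ and $\sigma=\sigma'$ $\mu$-a.e. $\mathrm{d}$ is the exterior derivative on functions and $\mathrm{d}^\dagger$ its formal adjoint with respect to the $\mathsf{L}^2$-inner products. For $f\in\mathsf{L}^1_{\mathrm{loc}}(M)$ the distributional differential is the linear functional $\mathrm{d}f(\alpha)=\int_M\overline{f(x)}\,\mathrm{d}^\dagger\alpha(x)\,\mathrm{vol}(\mathrm{d}x)$ on $\Omega^1_{\mathsf{C}^\infty_0}(M)$, and the variation of $f$ is $$\mathrm{Var}(f)=\sup\left\{\left|\int_M\overline{f(x)}\,\mathrm{d}^\dagger\alpha(x)\,\mathrm{vol}(\mathrm{d}x)\right| : \alpha\in\Omega^1_{\mathsf{C}^\infty_0}(M),\ \|\alpha\|_\infty\le 1\right\}\in[0,\infty].$$ *)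

theory Defs
  imports "HOL-Analysis.Analysis"
begin

section \<open>Smooth maps between Euclidean spaces\<close>

primrec Ck_on :: "nat \<Rightarrow> 'a::euclidean_space set \<Rightarrow> ('a \<Rightarrow> 'b::real_normed_vector) \<Rightarrow> bool" where
  "Ck_on 0 S f \<longleftrightarrow> continuous_on S f"
| "Ck_on (Suc k) S f \<longleftrightarrow> (\<forall>x\<in>S. f differentiable (at x)) \<and>
     (\<forall>v. Ck_on k S (\<lambda>x. frechet_derivative f (at x) v))"

text \<open>Only used for open \<open>S\<close>.\<close>

definition smooth_on :: "'a::euclidean_space set \<Rightarrow> ('a \<Rightarrow> 'b::real_normed_vector) \<Rightarrow> bool" where
  "smooth_on S f \<longleftrightarrow> (\<forall>k. Ck_on k S f)"


section \<open>Riemannian manifolds\<close>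

text \<open>
  The manifold is the whole type \<open>'m\<close>; the Hausdorff property and second countability are type
  class constraints, and the dimension is \<open>CARD('n)\<close>. A chart is a pair of its domain and its
  coordinate map, whose values outside the domain are irrelevant. A smooth structure is given by
  an atlas, which need not be maximal.
\<close>

type_synonym ('m, 'n) chart = "'m set \<times> ('m \<Rightarrow> real ^ 'n)"

abbreviation chart_dom :: "('m, 'n) chart \<Rightarrow> 'm set" where
  "chart_dom c \<equiv> fst c"

abbreviation chart_map :: "('m, 'n) chart \<Rightarrow> 'm \<Rightarrow> real ^ 'n" where
  "chart_map c \<equiv> snd c"

abbreviation chart_img :: "('m, 'n) chart \<Rightarrow> (real ^ 'n) set" where
  "chart_img c \<equiv> chart_map c ` chart_dom c"

definition chart_inv :: "('m, 'n) chart \<Rightarrow> real ^ 'n \<Rightarrow> 'm" where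
  "chart_inv c = inv_into (chart_dom c) (chart_map c)"

definition is_chart :: "('m::topological_space, 'n::finite) chart \<Rightarrow> bool" where
  "is_chart c \<longleftrightarrow> open (chart_dom c) \<and> open (chart_img c) \<and>
     homeomorphism (chart_dom c) (chart_img c) (chart_map c) (chart_inv c)"

definition smooth_atlas :: "('m::topological_space, 'n::finite) chart set \<Rightarrow> bool" where
  "smooth_atlas A \<longleftrightarrow> (\<forall>c\<in>A. is_chart c) \<and> (\<Union>c\<in>A. chart_dom c) = UNIV \<and>
     (\<forall>c\<in>A. \<forall>d\<in>A. smooth_on (chart_map c ` (chart_dom c \<inter> chart_dom d))
                            (chart_map d \<circ> chart_inv c))"

text \<open>\<open>jac c d x $ j $ i\<close> is the partial derivative at \<open>x\<close> of the \<open>j\<close>-th coordinate of \<open>d\<close> with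
  respect to the \<open>i\<close>-th coordinate of \<open>c\<close>.\<close>

definition jac :: "('m, 'n::finite) chart \<Rightarrow> ('m, 'n) chart \<Rightarrow> 'm \<Rightarrow> real ^ 'n ^ 'n" where
  "jac c d x = matrix (frechet_derivative (chart_map d \<circ> chart_inv c) (at (chart_map c x)))"

text \<open>\<open>g x c\<close> is the matrix \<open>(g\<^sub>i\<^sub>j(x))\<close> of the metric at \<open>x\<close> in the chart \<open>c\<close>; it is relevant only
  for \<open>c \<in> A\<close> and \<open>x \<in> chart_dom c\<close>.\<close>

type_synonym ('m, 'n) metric_field = "'m \<Rightarrow> ('m, 'n) chart \<Rightarrow> real ^ 'n ^ 'n"

definition riemannian_metric ::
  "('m::topological_space, 'n::finite) chart set \<Rightarrow> ('m, 'n) metric_field \<Rightarrow> bool" where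
  "riemannian_metric A g \<longleftrightarrow>
     (\<forall>c\<in>A. \<forall>x\<in>chart_dom c. transpose (g x c) = g x c \<and> (\<forall>v. v \<noteq> 0 \<longrightarrow> v \<bullet> (g x c *v v) > 0)) \<and>
     (\<forall>c\<in>A. \<forall>d\<in>A. \<forall>x\<in>chart_dom c \<inter> chart_dom d.
        g x c = transpose (jac c d x) ** g x d ** jac c d x) \<and>
     (\<forall>c\<in>A. smooth_on (chart_img c) (\<lambda>y. g (chart_inv c y) c))"

definition riemannian_manifold ::
  "('m::{t2_space, second_countable_topology}, 'n::finite) chart set \<Rightarrow> ('m, 'n) metric_field \<Rightarrow> bool"
where
  "riemannian_manifold A g \<longleftrightarrow> smooth_atlas A \<and> riemannian_metric A g"

text \<open>The Riemannian volume measure is the Borel measure which in every chart has the density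
  \<open>sqrt (det (g\<^sub>i\<^sub>j))\<close> with respect to Lebesgue measure.\<close>

definition riemannian_volume ::
  "('m::topological_space, 'n::finite) chart set \<Rightarrow> ('m, 'n) metric_field \<Rightarrow> 'm measure" where
  "riemannian_volume A g = (THE \<nu>. sets \<nu> = sets borel \<and>
     (\<forall>c\<in>A. \<forall>B\<in>sets borel. B \<subseteq> chart_dom c \<longrightarrow>
        emeasure \<nu> B =
          (\<integral>\<^sup>+ y \<in> chart_map c ` B. ennreal (sqrt (det (g (chart_inv c y) c))) \<partial>lborel)))"


section \<open>The complexified cotangent bundle\<close>

text \<open>
  A complex covector at \<open>x\<close> is the family of its component vectors in all charts around \<open>x\<close>,
  related by the transformation law of covectors. Components in irrelevant charts are
  normalised to \<open>0\<close>, so that covectors are equal iff the functions are.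
\<close>

type_synonym ('m, 'n) covector = "('m, 'n) chart \<Rightarrow> complex ^ 'n"
type_synonym ('m, 'n) form = "'m \<Rightarrow> ('m, 'n) covector"

definition cotangent_space :: "('m, 'n::finite) chart set \<Rightarrow> 'm \<Rightarrow> ('m, 'n) covector set" where
  "cotangent_space A x = {\<omega>.
     (\<forall>c. \<not> (c \<in> A \<and> x \<in> chart_dom c) \<longrightarrow> \<omega> c = 0) \<and>
     (\<forall>c\<in>A. \<forall>d\<in>A. x \<in> chart_dom c \<inter> chart_dom d \<longrightarrow>
        (\<forall>i. \<omega> c $ i = (\<Sum>j\<in>UNIV. of_real (jac c d x $ j $ i) * \<omega> d $ j)))}"

text \<open>The value of the following inner product does not depend on the chart chosen at \<open>x\<close>.\<close>

definition chart_at :: "('m, 'n) chart set \<Rightarrow> 'm \<Rightarrow> ('m, 'n) chart" where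
  "chart_at A x = (SOME c. c \<in> A \<and> x \<in> chart_dom c)"

definition cov_inner :: "('m, 'n::finite) chart set \<Rightarrow> ('m, 'n) metric_field \<Rightarrow> 'm \<Rightarrow>
    ('m, 'n) covector \<Rightarrow> ('m, 'n) covector \<Rightarrow> complex" where
  "cov_inner A g x \<omega> \<eta> = (let c = chart_at A x in
     \<Sum>i\<in>UNIV. \<Sum>j\<in>UNIV. of_real (matrix_inv (g x c) $ i $ j) * cnj (\<omega> c $ i) * \<eta> c $ j)"

definition cov_norm :: "('m, 'n::finite) chart set \<Rightarrow> ('m, 'n) metric_field \<Rightarrow> 'm \<Rightarrow>
    ('m, 'n) covector \<Rightarrow> real" where
  "cov_norm A g x \<omega> = sqrt (Re (cov_inner A g x \<omega> \<omega>))"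

definition one_forms :: "('m, 'n::finite) chart set \<Rightarrow> ('m, 'n) form set" where
  "one_forms A = {\<alpha>. \<forall>x. \<alpha> x \<in> cotangent_space A x}"

definition borel_forms :: "('m::topological_space, 'n::finite) chart set \<Rightarrow> ('m, 'n) form set" where
  "borel_forms A = {\<alpha> \<in> one_forms A.
     \<forall>c\<in>A. (\<lambda>x. \<alpha> x c) \<in> borel_measurable (restrict_space borel (chart_dom c))}"

definition sup_norm ::
  "('m, 'n::finite) chart set \<Rightarrow> ('m, 'n) metric_field \<Rightarrow> ('m, 'n) form \<Rightarrow> real" where
  "sup_norm A g \<alpha> = (SUP x. cov_norm A g x (\<alpha> x))"

definition C0_forms :: "('m::topological_space, 'n::finite) chart set \<Rightarrow> ('m, 'n) metric_field \<Rightarrow>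
    ('m, 'n) form set" where
  "C0_forms A g = {\<alpha> \<in> one_forms A.
     (\<forall>c\<in>A. continuous_on (chart_dom c) (\<lambda>x. \<alpha> x c)) \<and>
     (\<forall>\<epsilon>>0. \<exists>K. compact K \<and> (\<forall>x. x \<notin> K \<longrightarrow> cov_norm A g x (\<alpha> x) < \<epsilon>))}"

definition test_forms :: "('m::topological_space, 'n::finite) chart set \<Rightarrow> ('m, 'n) form set" where
  "test_forms A = {\<alpha> \<in> one_forms A.
     (\<forall>c\<in>A. smooth_on (chart_img c) (\<lambda>y. \<alpha> (chart_inv c y) c)) \<and>
     compact (closure {x. \<alpha> x \<noteq> (\<lambda>c. 0)})}"


section \<open>Generalized vector measures\<close>

text \<open>Elements of the dual space are functionals on \<open>C0_forms\<close>, extended by \<open>undefined\<close>.\<close>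

definition vector_measures :: "('m::topological_space, 'n::finite) chart set \<Rightarrow>
    ('m, 'n) metric_field \<Rightarrow> (('m, 'n) form \<Rightarrow> complex) set" where
  "vector_measures A g = {T \<in> extensional (C0_forms A g).
     (\<forall>\<alpha>\<in>C0_forms A g. \<forall>\<beta>\<in>C0_forms A g. T (\<lambda>x c. \<alpha> x c + \<beta> x c) = T \<alpha> + T \<beta>) \<and>
     (\<forall>\<alpha>\<in>C0_forms A g. \<forall>a. T (\<lambda>x c. a *s \<alpha> x c) = a * T \<alpha>) \<and>
     (\<exists>C. \<forall>\<alpha>\<in>C0_forms A g. cmod (T \<alpha>) \<le> C * sup_norm A g \<alpha>)}"

text \<open>The dual norm of a functional with domain \<open>D\<close>: for \<open>D = C0_forms A g\<close> this is the norm of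
  the Banach dual, for \<open>D = test_forms A\<close> the norm of a functional on test forms.\<close>

definition dual_norm :: "('m, 'n::finite) chart set \<Rightarrow> ('m, 'n) metric_field \<Rightarrow>
    ('m, 'n) form set \<Rightarrow> (('m, 'n) form \<Rightarrow> complex) \<Rightarrow> ennreal" where
  "dual_norm A g D T = (SUP \<alpha> \<in> {\<alpha> \<in> D. sup_norm A g \<alpha> \<le> 1}. ennreal (cmod (T \<alpha>)))"

definition polar_pairs :: "('m::topological_space, 'n::finite) chart set \<Rightarrow>
    ('m, 'n) metric_field \<Rightarrow> ('m measure \<times> ('m, 'n) form) set" where
  "polar_pairs A g = {(\<mu>, \<sigma>). sets \<mu> = sets borel \<and> finite_measure \<mu> \<and>
     \<sigma> \<in> borel_forms A \<and> (AE x in \<mu>. cov_norm A g x (\<sigma> x) = 1)}"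

definition polar_rel :: "('m::topological_space, 'n::finite) chart set \<Rightarrow>
    ('m, 'n) metric_field \<Rightarrow> ('m measure \<times> ('m, 'n) form) rel" where
  "polar_rel A g = {((\<mu>, \<sigma>), (\<mu>', \<sigma>')). (\<mu>, \<sigma>) \<in> polar_pairs A g \<and> (\<mu>', \<sigma>') \<in> polar_pairs A g \<and>
     \<mu> = \<mu>' \<and> (AE x in \<mu>. \<sigma> x = \<sigma>' x)}"

lemma equiv_polar_rel: "equiv (polar_pairs A g) (polar_rel A g)"
proof (rule equivI)
  show "polar_rel A g \<subseteq> polar_pairs A g \<times> polar_pairs A g"
    by (auto simp: polar_rel_def)
  show "refl_on (polar_pairs A g) (polar_rel A g)"
    by (auto simp: refl_on_def polar_rel_def)
  show "sym (polar_rel A g)"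
    by (auto simp: sym_def polar_rel_def elim: eventually_mono)
  show "trans (polar_rel A g)"
    by (auto simp: trans_def polar_rel_def elim: eventually_elim2)
qed

definition polar_classes :: "('m::topological_space, 'n::finite) chart set \<Rightarrow>
    ('m, 'n) metric_field \<Rightarrow> ('m measure \<times> ('m, 'n) form) set set" where
  "polar_classes A g = polar_pairs A g // polar_rel A g"

definition psi :: "('m::topological_space, 'n::finite) chart set \<Rightarrow> ('m, 'n) metric_field \<Rightarrow>
    'm measure \<times> ('m, 'n) form \<Rightarrow> ('m, 'n) form \<Rightarrow> complex" where
  "psi A g = (\<lambda>(\<mu>, \<sigma>). \<lambda>\<alpha>\<in>C0_forms A g. LINT x|\<mu>. cov_inner A g x (\<sigma> x) (\<alpha> x))"

text \<open>The map induced by \<open>psi\<close> on equivalence classes; meaningful once \<open>psi\<close> is known to respect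
  the equivalence relation.\<close>

definition Psi :: "('m::topological_space, 'n::finite) chart set \<Rightarrow> ('m, 'n) metric_field \<Rightarrow>
    ('m measure \<times> ('m, 'n) form) set \<Rightarrow> ('m, 'n) form \<Rightarrow> complex" where
  "Psi A g C = the_elem (psi A g ` C)"


section \<open>Functions of bounded variation\<close>

definition smooth_fun ::
  "('m::topological_space, 'n::finite) chart set \<Rightarrow> ('m \<Rightarrow> complex) \<Rightarrow> bool" where
  "smooth_fun A f \<longleftrightarrow> (\<forall>c\<in>A. smooth_on (chart_img c) (f \<circ> chart_inv c))"

definition test_funs :: "('m::topological_space, 'n::finite) chart set \<Rightarrow> ('m \<Rightarrow> complex) set" where
  "test_funs A = {f. smooth_fun A f \<and> compact (closure {x. f x \<noteq> 0})}"

text \<open>Components of the exterior derivative of \<open>f\<close>: the partial derivatives of \<open>f\<close> in charts.\<close>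

definition ext_deriv :: "('m, 'n::finite) chart set \<Rightarrow> ('m \<Rightarrow> complex) \<Rightarrow> ('m, 'n) form" where
  "ext_deriv A f = (\<lambda>x c. if c \<in> A \<and> x \<in> chart_dom c
     then \<chi> i. frechet_derivative (f \<circ> chart_inv c) (at (chart_map c x)) (axis i 1)
     else 0)"

text \<open>The formal adjoint of \<open>ext_deriv\<close>: the smooth function \<open>h\<close> with \<open>(d\<phi>, \<alpha>) = (\<phi>, h)\<close> in \<open>L\<^sup>2\<close>
  for all test functions \<open>\<phi>\<close>.\<close>

definition codiff :: "('m::topological_space, 'n::finite) chart set \<Rightarrow> ('m, 'n) metric_field \<Rightarrow>
    ('m, 'n) form \<Rightarrow> 'm \<Rightarrow> complex" where
  "codiff A g \<alpha> = (THE h. smooth_fun A h \<and>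
     (\<forall>\<phi>\<in>test_funs A.
        (LINT x|riemannian_volume A g. cov_inner A g x (ext_deriv A \<phi> x) (\<alpha> x)) =
        (LINT x|riemannian_volume A g. cnj (\<phi> x) * h x)))"

definition L1_loc :: "('m::topological_space, 'n::finite) chart set \<Rightarrow> ('m, 'n) metric_field \<Rightarrow>
    ('m \<Rightarrow> complex) set" where
  "L1_loc A g = {f \<in> borel_measurable borel.
     \<forall>K. compact K \<longrightarrow> set_integrable (riemannian_volume A g) K f}"

definition dist_diff :: "('m::topological_space, 'n::finite) chart set \<Rightarrow> ('m, 'n) metric_field \<Rightarrow>
    ('m \<Rightarrow> complex) \<Rightarrow> ('m, 'n) form \<Rightarrow> complex" where
  "dist_diff A g f =
     (\<lambda>\<alpha>\<in>test_forms A. LINT x|riemannian_volume A g. cnj (f x) * codiff A g \<alpha> x)"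

definition Var :: "('m::topological_space, 'n::finite) chart set \<Rightarrow> ('m, 'n) metric_field \<Rightarrow>
    ('m \<Rightarrow> complex) \<Rightarrow> ennreal" where
  "Var A g f = (SUP \<alpha> \<in> {\<alpha> \<in> test_forms A. sup_norm A g \<alpha> \<le> 1}.
     ennreal (cmod (LINT x|riemannian_volume A g. cnj (f x) * codiff A g \<alpha> x)))"

end

theory Submission
  imports Defs
begin

text \<open>
  Part b) is immediate, since \<open>Var f\<close> is the supremum that defines the norm of \<open>df\<close>. For part a),
  choose countably many nonnegative functions \<open>\<phi>\<^sub>k\<close>, each compactly supported in a chart domain, whose
  positivity sets cover the manifold, and let \<open>e\<^sub>k\<^sub>,\<^sub>i\<close> be \<open>\<phi>\<^sub>k\<close> times the \<open>i\<close>-th coordinate form. For a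
  bounded functional \<open>T\<close>, each scalar functional \<open>f \<mapsto> T (f e\<^sub>k\<^sub>,\<^sub>i)\<close> is a complex measure by the scalar
  Riesz theorem. All of them have densities with respect to one finite measure \<open>\<mu>\<close>, so that
  \<open>T (\<phi>\<^sub>k\<^sup>2 \<alpha>) = \<integral> (\<sigma>\<^sub>k, \<alpha>) d\<mu>\<close> for Borel forms \<open>\<sigma>\<^sub>k\<close>. Since \<open>C\<^sub>0\<close> forms of norm at most 1 are dense in the
  Borel forms of norm at most 1 in the \<open>L\<^sup>1\<close> distance of any finite measure, \<open>\<integral> |\<omega>| d\<mu>\<close> is the norm of
  the functional \<open>\<alpha> \<mapsto> \<integral> (\<omega>, \<alpha>) d\<mu>\<close>. Hence \<open>\<phi>\<^sub>j\<^sup>2 \<sigma>\<^sub>k = \<phi>\<^sub>k\<^sup>2 \<sigma>\<^sub>j\<close> almost everywhere, the forms \<open>\<phi>\<^sub>k\<^sup>-\<^sup>2 \<sigma>\<^sub>k\<close>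
  glue to an integrable form \<open>\<tau>\<close> representing \<open>T\<close>, and \<open>(|\<tau>| \<mu>, \<tau> / |\<tau>|)\<close> is the preimage of \<open>T\<close>. The
  same identity gives injectivity and the formula for the norm.
\<close>

section \<open>The Riesz representation theorem\<close>

text \<open>Two obstacles shape the argument. Covectors at different points lie in different spaces,
  so a scalar theorem reaches a form only through its components. Frames and coframes supported in
  charts convert a form into scalars and back, each contributing one factor
  \<open>\<phi>\<^sub>k\<close>; this is the origin of the squares. Moreover, after division by
  \<open>\<phi>\<^sub>k\<^sup>2\<close> only the products
  \<open>\<phi>\<^sub>k\<^sup>2 |\<tau>|\<close> are known to be integrable, and there may be
  infinitely many charts. In place of a partition of unity, the sum of the first \<open>N\<close>
  squares is multiplied by \<open>N + 1\<close> and capped at 1. These cutoffs increase to 1, equal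
  1 on a given compact set from some \<open>N\<close> on, and are the sum of squares times a bounded
  continuous weight, so \<open>T\<close> is already represented on truncated forms. The norm
  identity bounds the integral of \<open>|\<tau>|\<close> times the cutoff by the norm of
  \<open>T\<close>, uniformly in \<open>N\<close>, and monotone convergence gives integrability. The
  scalar theorem is proved on a topological space in which every open set is the nonzero set of a
  continuous function; this property does the work of a metric.\<close>

locale compact_functional =
  fixes K :: "'a::topological_space set" and I :: "('a \<Rightarrow> real) \<Rightarrow> real" and C :: real
  assumes compact_K: "compact K"
    and add: "\<And>f g. continuous_on UNIV f \<Longrightarrow> continuous_on UNIV g \<Longrightarrow> (\<And>x. 0 \<le> f x) \<Longrightarrow>
      (\<And>x. 0 \<le> g x) \<Longrightarrow> I (\<lambda>x. f x + g x) = I f + I g"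
    and nonneg: "\<And>f. continuous_on UNIV f \<Longrightarrow> (\<And>x. 0 \<le> f x) \<Longrightarrow> 0 \<le> I f"
    and scale: "\<And>f c. continuous_on UNIV f \<Longrightarrow> (\<And>x. 0 \<le> f x) \<Longrightarrow> 0 \<le> c \<Longrightarrow> I (\<lambda>x. c * f x) = c * I f"
    and bound: "\<And>f b. continuous_on UNIV f \<Longrightarrow> (\<And>x. 0 \<le> f x) \<Longrightarrow> 0 \<le> b \<Longrightarrow> (\<And>x. x \<in> K \<Longrightarrow> f x \<le> b) \<Longrightarrow>
      I f \<le> C * b"
    and cozero: "\<And>U :: 'a set. open U \<Longrightarrow> \<exists>h :: 'a \<Rightarrow> real. continuous_on UNIV h \<and> U = {x. h x \<noteq> 0}"
begin

lemma zero: "I (\<lambda>x. 0) = 0"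
  using scale[of "\<lambda>x. 0" 0] by simp

lemma mono:
  assumes f: "continuous_on UNIV f" "\<And>x. 0 \<le> f x" and g: "continuous_on UNIV g" "\<And>x. f x \<le> g x"
  shows "I f \<le> I g"
proof -
  have c: "continuous_on UNIV (\<lambda>x. g x - f x)" and p: "\<And>x. 0 \<le> g x - f x"
    using f g by (auto intro!: continuous_intros)
  have "I g = I (\<lambda>x. f x + (g x - f x))" by simp
  also have "\<dots> = I f + I (\<lambda>x. g x - f x)" by (rule add[OF f(1) c f(2) p])
  finally show ?thesis using nonneg[OF c p] by simp
qed

lemma sum:
  assumes f: "\<And>i. i \<in> J \<Longrightarrow> continuous_on UNIV (f i)" "\<And>i x. i \<in> J \<Longrightarrow> 0 \<le> f i x"
  shows "I (\<lambda>x. \<Sum>i\<in>J. f i x) = (\<Sum>i\<in>J. I (f i))"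
  using f
proof (induction J rule: infinite_finite_induct)
  case (insert a J)
  have "I (\<lambda>x. f a x + (\<Sum>i\<in>J. f i x)) = I (f a) + I (\<lambda>x. \<Sum>i\<in>J. f i x)"
    by (intro add continuous_on_sum sum_nonneg) (use insert in auto)
  then show ?case using insert by simp
qed (auto simp: zero)

text \<open>Dini's theorem: by compactness the pointwise decrease to 0 is uniform on
  \<open>K\<close>, and \<open>bound\<close> sees only the values on \<open>K\<close>.\<close>

lemma sigma_continuous:
  assumes f: "\<And>n. continuous_on UNIV (f n)" "\<And>n x. 0 \<le> f n x" "\<And>n x. f (Suc n) x \<le> f n x"
    and lim: "\<And>x. (\<lambda>n. f n x) \<longlonglongrightarrow> 0"
  shows "(\<lambda>n. I (f n)) \<longlonglongrightarrow> 0"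
proof (rule LIMSEQ_I)
  fix e :: real assume e: "e > 0"
  \<comment> \<open>The denominator uses \<open>\<bar>C\<bar> + 1\<close> because \<open>C\<close>
    may be zero or negative; the factor 2 makes the final inequality strict.\<close>
  define d where "d = e / (2 * (\<bar>C\<bar> + 1))"
  have d: "d > 0" unfolding d_def using e by (intro divide_pos_pos) auto
  have dec: "decseq (\<lambda>n. f n x)" for x using f(3) by (simp add: decseq_Suc_iff)
  have "\<exists>N. \<forall>x\<in>K. f N x < d"
  proof -
    have op: "open {x. f n x < d}" for n
      using open_Collect_less[OF f(1) continuous_on_const] .
    have cov: "K \<subseteq> (\<Union>n\<in>UNIV. {x. f n x < d})"
    proof
      fix x
      have "\<forall>\<^sub>F n in sequentially. f n x < d" using lim[of x] d by (rule order_tendstoD)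
      then show "x \<in> (\<Union>n\<in>UNIV. {x. f n x < d})" by (auto simp: eventually_sequentially)
    qed
    obtain J where J: "finite J" "K \<subseteq> (\<Union>n\<in>J. {x. f n x < d})"
      using compactE_image[OF compact_K op cov] by metis
    obtain N where N: "\<And>j. j \<in> J \<Longrightarrow> j \<le> N" using J(1) by (meson finite_nat_set_iff_bounded_le)
    have "f N x < d" if "x \<in> K" for x
    proof -
      obtain j where "j \<in> J" "f j x < d" using J(2) \<open>x \<in> K\<close> by auto
      moreover have "f N x \<le> f j x" using decseqD[OF dec N[OF \<open>j \<in> J\<close>]] .
      ultimately show ?thesis by simp
    qed
    then show ?thesis by blast
  qed
  then obtain N where N: "\<And>x. x \<in> K \<Longrightarrow> f N x < d" by blast
  have "I (f n) < e" if "n \<ge> N" for n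
  proof -
    have "I (f n) \<le> C * d"
    proof (rule bound[OF f(1,2)])
      fix x assume "x \<in> K"
      have "f n x \<le> f N x" using decseqD[OF dec that] .
      then show "f n x \<le> d" using N[OF \<open>x \<in> K\<close>] by simp
    qed (use d in simp)
    also have "\<dots> \<le> (\<bar>C\<bar> + 1) * d" using d by (intro mult_right_mono) auto
    also have "\<dots> = e / 2"
    proof -
      have "\<bar>C\<bar> + 1 > 0" by linarith
      then show ?thesis unfolding d_def by (simp add: divide_simps)
    qed
    also have "\<dots> < e" using e by simp
    finally show ?thesis .
  qed
  then show "\<exists>no. \<forall>n\<ge>no. norm (I (f n) - 0) < e"
    using nonneg[OF f(1,2)] by auto
qed

text \<open>
  The region between the graphs of \<open>f \<le> g\<close> is given the measure \<open>I (g - f)\<close>. Its countable additivity is that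
  of Lebesgue measure in the fibres together with Dini's theorem, and the representing measure of \<open>I\<close>
  is the projection of the part over \<open>0 \<le> t < 1\<close>.
\<close>

definition slab :: "('a \<Rightarrow> real) \<Rightarrow> ('a \<Rightarrow> real) \<Rightarrow> ('a \<times> real) set" where
  "slab f g = {(x, t). f x \<le> t \<and> t < g x}"

definition slabs :: "('a \<times> real) set set" where
  "slabs = {slab f g | f g. continuous_on UNIV f \<and> continuous_on UNIV g \<and> (\<forall>x. f x \<le> g x)}"

definition slab_measure :: "('a \<times> real) set \<Rightarrow> ennreal" where
  "slab_measure S = ennreal (I (\<lambda>x. measure lborel {t. (x, t) \<in> S}))"

lemma slabsI: "continuous_on UNIV f \<Longrightarrow> continuous_on UNIV g \<Longrightarrow> (\<And>x. f x \<le> g x) \<Longrightarrow> slab f g \<in> slabs"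
  unfolding slabs_def by blast

lemma slice_slab: "{t. (x, t) \<in> slab f g} = {f x..<g x}"
  by (auto simp: slab_def)

lemma slab_measure_slab:
  assumes "\<And>x. f x \<le> g x"
  shows "slab_measure (slab f g) = ennreal (I (\<lambda>x. g x - f x))"
  unfolding slab_measure_def slice_slab using assms by simp

text \<open>Fibrewise these are half-open intervals, and minima and maxima of continuous functions
  stay continuous. A difference leaves one piece below the removed slab and one above it.\<close>

lemma semiring_slabs: "semiring_of_sets UNIV slabs"
proof
  show "slabs \<subseteq> Pow UNIV" by simp
  have "slab (\<lambda>x. 0) (\<lambda>x. 0) \<in> slabs" by (intro slabsI) auto
  moreover have "slab (\<lambda>x. 0) (\<lambda>x. 0) = {}" by (auto simp: slab_def)
  ultimately show "{} \<in> slabs" by simp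
next
  fix a b assume "a \<in> slabs" "b \<in> slabs"
  then obtain f g f' g' where a: "a = slab f g" "continuous_on UNIV f" "continuous_on UNIV g" "\<And>x. f x \<le> g x"
    and b: "b = slab f' g'" "continuous_on UNIV f'" "continuous_on UNIV g'" "\<And>x. f' x \<le> g' x"
    unfolding slabs_def by blast
  \<comment> \<open>The outer maximum keeps the upper function above the lower one over points where
    the two intervals are disjoint, so the fibre there is empty.\<close>
  have "a \<inter> b = slab (\<lambda>x. max (f x) (f' x)) (\<lambda>x. max (max (f x) (f' x)) (min (g x) (g' x)))"
    unfolding a b slab_def by auto
  then show "a \<inter> b \<in> slabs"
    using a b by (auto intro!: slabsI continuous_intros)
  \<comment> \<open>\<open>p\<close> is the part of \<open>a\<close> below \<open>f'\<close> and
    \<open>q\<close> the part above \<open>g'\<close>; they are disjoint because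
    \<open>f' \<le> g'\<close>.\<close>
  define p where "p = slab f (\<lambda>x. min (g x) (max (f x) (f' x)))"
  define q where "q = slab (\<lambda>x. max (f x) (min (g x) (g' x))) g"
  have "p \<in> slabs" "q \<in> slabs"
    unfolding p_def q_def using a b by (auto intro!: slabsI continuous_intros)
  moreover have "a - b = p \<union> q"
    unfolding a b slab_def p_def q_def by auto
  moreover have "p \<inter> q = {}"
    unfolding slab_def p_def q_def using b(4) a(4)
    by (auto simp: min_le_iff_disj less_max_iff_disj) (meson order.strict_trans1 not_le)+
  ultimately show "\<exists>D\<subseteq>slabs. finite D \<and> disjoint D \<and> a - b = \<Union> D"
    by (intro exI[of _ "{p, q}"]) (auto simp: disjoint_def)
qed

lemma countably_additive_slabs: "countably_additive slabs slab_measure"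
  unfolding countably_additive_def
proof (intro allI impI)
  fix A :: "nat \<Rightarrow> ('a \<times> real) set"
  assume A: "range A \<subseteq> slabs" and dis: "disjoint_family A" and un: "(\<Union>i. A i) \<in> slabs"
  have ex: "\<exists>f g. S = slab f g \<and> continuous_on UNIV f \<and> continuous_on UNIV g \<and> (\<forall>x. f x \<le> g x)"
    if "S \<in> slabs" for S using that unfolding slabs_def by blast
  \<comment> \<open>The fibre length depends on the set alone, not on the pair of functions
    presenting it as a slab.\<close>
  define u where "u S x = measure lborel {t. (x, t) \<in> S}" for S :: "('a \<times> real) set" and x
  have u: "continuous_on UNIV (u S)" "\<And>x. 0 \<le> u S x" "slab_measure S = ennreal (I (u S))"
    "\<And>x. {t. (x, t) \<in> S} \<in> fmeasurable lborel"
    if "S \<in> slabs" for S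
  proof -
    obtain f g where S: "S = slab f g" "continuous_on UNIV f" "continuous_on UNIV g" "\<And>x. f x \<le> g x"
      using ex[OF \<open>S \<in> slabs\<close>] by blast
    have eq: "u S = (\<lambda>x. g x - f x)" unfolding u_def S(1) slice_slab using S(4) by auto
    show "continuous_on UNIV (u S)" unfolding eq using S by (auto intro!: continuous_intros)
    show "\<And>x. 0 \<le> u S x" by (simp add: u_def)
    show "slab_measure S = ennreal (I (u S))" by (simp add: slab_measure_def u_def[abs_def])
    show "\<And>x. {t. (x, t) \<in> S} \<in> fmeasurable lborel" unfolding S(1) slice_slab
      using S(4) by (auto simp: fmeasurable_def)
  qed
  have A': "A i \<in> slabs" for i using A by blast
  let ?U = "\<Union>i. A i"
  have sums: "(\<lambda>i. u (A i) x) sums u ?U x" for x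
  proof -
    have "(\<lambda>i. measure lborel {t. (x, t) \<in> A i}) sums measure lborel (\<Union>i. {t. (x, t) \<in> A i})"
    proof (rule measure_UNION)
      show "disjoint_family (\<lambda>i. {t. (x, t) \<in> A i})"
        using dis unfolding disjoint_family_on_def by blast
      have "{t. (x, t) \<in> ?U} = (\<Union>i. {t. (x, t) \<in> A i})" by auto
      then show "emeasure lborel (\<Union>i. {t. (x, t) \<in> A i}) \<noteq> \<infinity>"
        using u(4)[OF un, of x] by (auto simp: fmeasurable_def)
    qed (use u(4)[OF A'] in \<open>auto simp: fmeasurable_def\<close>)
    moreover have "(\<Union>i. {t. (x, t) \<in> A i}) = {t. (x, t) \<in> ?U}" by auto
    ultimately show ?thesis by (simp add: u_def)
  qed
  \<comment> \<open>The remainders of the fibrewise series are continuous, since the total and all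
    finite partial sums are, and they decrease to 0; this is the situation of Dini's
    theorem.\<close>
  define r where "r n x = u ?U x - (\<Sum>i<n. u (A i) x)" for n x
  have r: "continuous_on UNIV (r n)" "0 \<le> r n x" "r (Suc n) x \<le> r n x" for n x
  proof -
    show "continuous_on UNIV (r n)" unfolding r_def using u(1)[OF un] u(1)[OF A']
      by (auto intro!: continuous_intros)
    show "0 \<le> r n x" unfolding r_def using sum_le_suminf[OF sums_summable[OF sums], of "{..<n}"] u(2)[OF A'] sums_unique[OF sums[of x]]
      by auto
    show "r (Suc n) x \<le> r n x" unfolding r_def using u(2)[OF A'] by simp
  qed
  have "(\<lambda>n. r n x) \<longlonglongrightarrow> u ?U x - u ?U x" for x
    unfolding r_def using sums[of x] unfolding sums_def by (intro tendsto_intros)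
  then have "(\<lambda>n. I (r n)) \<longlonglongrightarrow> 0" using r by (intro sigma_continuous) auto
  moreover have "I (u ?U) = (\<Sum>i<n. I (u (A i))) + I (r n)" for n
  proof -
    have "I (u ?U) = I (\<lambda>x. (\<Sum>i<n. u (A i) x) + r n x)" by (simp add: r_def)
    also have "\<dots> = I (\<lambda>x. \<Sum>i<n. u (A i) x) + I (r n)"
      using u(1,2)[OF A'] r by (intro add continuous_on_sum sum_nonneg) auto
    also have "I (\<lambda>x. \<Sum>i<n. u (A i) x) = (\<Sum>i<n. I (u (A i)))"
      using u(1,2)[OF A'] by (intro sum) auto
    finally show ?thesis .
  qed
  then have "I (r n) = I (u ?U) - (\<Sum>i<n. I (u (A i)))" for n by (simp add: algebra_simps)
  ultimately have "(\<lambda>n. I (u ?U) - (\<Sum>i<n. I (u (A i)))) \<longlonglongrightarrow> 0" by simp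
  then have "(\<lambda>n. I (u ?U) - (I (u ?U) - (\<Sum>i<n. I (u (A i))))) \<longlonglongrightarrow> I (u ?U) - 0"
    by (intro tendsto_intros)
  then have "(\<lambda>i. I (u (A i))) sums I (u ?U)" by (simp add: sums_def)
  then have "(\<Sum>i. ennreal (I (u (A i)))) = ennreal (I (u ?U))"
    using nonneg[OF u(1,2)[OF A']] by (intro suminf_ennreal_eq) auto
  then show "(\<Sum>i. slab_measure (A i)) = slab_measure ?U"
    using u(3)[OF un] u(3)[OF A'] by simp
qed

theorem Riesz_positive:
  "\<exists>\<mu>. sets \<mu> = sets borel \<and> finite_measure \<mu> \<and>
     (\<forall>f. continuous_on UNIV f \<longrightarrow> (\<forall>x. 0 \<le> f x \<and> f x \<le> 1) \<longrightarrow> (LINT x|\<mu>. f x) = I f)"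
proof -
  interpret semiring_of_sets UNIV slabs by (rule semiring_slabs)
  have "positive slabs slab_measure"
    by (auto simp: positive_def slab_measure_def zero)
  from caratheodory[OF this countably_additive_slabs]
  obtain m' where m': "\<And>S. S \<in> slabs \<Longrightarrow> m' S = slab_measure S"
    "measure_space UNIV (sigma_sets UNIV slabs) m'" by blast
  define N where "N = measure_of UNIV slabs m'"
  have space_N: "space N = UNIV" by (simp add: N_def)
  have sets_N: "sets N = sigma_sets UNIV slabs" by (simp add: N_def)
  have em_N: "emeasure N S = slab_measure S" if "S \<in> slabs" for S
    using emeasure_measure_of[OF N_def, of S] m' that unfolding sets_N measure_space_def
    by (auto simp: sets_N)
  have slab_N: "slab f g \<in> sets N" if "continuous_on UNIV f" "continuous_on UNIV g" "\<And>x. f x \<le> g x" for f g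
    using slabsI[OF that] by (auto simp: sets_N)
  \<comment> \<open>The strip over the whole space between heights 0 and 1, whose fibres all have
    length 1.\<close>
  define S where "S = slab (\<lambda>x. 0) (\<lambda>x. 1)"
  have S: "S \<in> sets N" unfolding S_def by (intro slab_N) auto
  have fst_N: "fst \<in> measurable N borel"
  proof (rule borel_measurableI)
    fix U :: "'a set" assume "open U"
    \<comment> \<open>The preimage of \<open>U\<close> is the cylinder over it. Slabs of height
      proportional to \<open>n * \<bar>h x\<bar>\<close> have empty fibres where \<open>h\<close>
      vanishes and exhaust the line elsewhere, so the cylinder is a countable union of
      slabs.\<close>
    then obtain h :: "'a \<Rightarrow> real" where h: "continuous_on UNIV h" "U = {x. h x \<noteq> 0}" using cozero by blast
    have "fst -` U \<inter> space N = (\<Union>n. slab (\<lambda>x. - real n * \<bar>h x\<bar>) (\<lambda>x. real n * \<bar>h x\<bar>))"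
    proof (rule set_eqI)
      fix z :: "'a \<times> real"
      obtain x t where z: "z = (x, t)" by (cases z)
      have "(\<exists>n. - real n * \<bar>h x\<bar> \<le> t \<and> t < real n * \<bar>h x\<bar>)" if "h x \<noteq> 0"
      proof -
        obtain n where "real n > \<bar>t\<bar> / \<bar>h x\<bar>" using reals_Archimedean2 by blast
        then have "\<bar>t\<bar> < real n * \<bar>h x\<bar>" using that by (simp add: field_simps)
        then show ?thesis by (intro exI[of _ n]) auto
      qed
      moreover have "h x \<noteq> 0" if "- real n * \<bar>h x\<bar> \<le> t" "t < real n * \<bar>h x\<bar>" for n
        using that by auto
      ultimately show "z \<in> fst -` U \<inter> space N \<longleftrightarrow> z \<in> (\<Union>n. slab (\<lambda>x. - real n * \<bar>h x\<bar>) (\<lambda>x. real n * \<bar>h x\<bar>))"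
        unfolding z h(2) by (auto simp: space_N slab_def)
    qed
    also have "\<dots> \<in> sets N"
    proof (rule sets.countable_UN, safe)
      fix n :: nat
      have "0 \<le> real n * \<bar>h x\<bar>" for x by simp
      then have "- real n * \<bar>h x\<bar> \<le> real n * \<bar>h x\<bar>" for x
        unfolding mult_minus_left by (meson neg_le_0_iff_le order_trans)
      then show "slab (\<lambda>x. - real n * \<bar>h x\<bar>) (\<lambda>x. real n * \<bar>h x\<bar>) \<in> sets N"
        using h(1) by (intro slab_N continuous_intros) auto
    qed
    finally show "fst -` U \<inter> space N \<in> sets N" .
  qed
  define \<mu> where "\<mu> = distr (density N (indicator S)) borel fst"
  have sets_\<mu>: "sets \<mu> = sets borel" by (simp add: \<mu>_def)
  have em: "emeasure \<mu> B = emeasure N ((fst -` B) \<inter> S)" if "B \<in> sets borel" for B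
  proof -
    have "fst -` B \<in> sets N" using measurable_sets[OF fst_N that] by (simp add: space_N)
    moreover have "fst \<in> measurable (density N (indicator S)) borel" using fst_N by simp
    ultimately show ?thesis
      unfolding \<mu>_def using S that
      by (simp add: emeasure_distr space_N emeasure_density Int_commute flip: indicator_inter_arith)
  qed
  have fin: "finite_measure \<mu>"
  proof
    have "emeasure \<mu> (space \<mu>) \<le> emeasure N S"
      using em[of UNIV] by (simp add: \<mu>_def)
    also have "\<dots> < \<infinity>" unfolding S_def by (subst em_N) (auto intro!: slabsI simp: slab_measure_slab)
    finally show "emeasure \<mu> (space \<mu>) \<noteq> \<infinity>" by simp
  qed
  interpret \<mu>: finite_measure \<mu> by (rule fin)
  have meas: "f \<in> borel_measurable \<mu>" if "continuous_on UNIV f" for f :: "'a \<Rightarrow> real"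
    using borel_measurable_continuous_onI[OF that] sets_\<mu> by (simp cong: measurable_cong_sets)
  have setm[simp]: "{x. P (p x)} \<in> sets \<mu>" if "continuous_on UNIV p" "open {t. P t} \<or> closed {t. P t}" for p :: "'a \<Rightarrow> real" and P
  proof -
    have "p -` {t. P t} \<inter> space \<mu> \<in> sets \<mu>" using that by (intro measurable_sets[OF meas]) auto
    then show ?thesis by (simp add: vimage_def \<mu>_def)
  qed
  have spaceU: "space \<mu> = UNIV" by (simp add: \<mu>_def)
  \<comment> \<open>The region under the graph of \<open>p\<close> contains the strip over
    \<open>{x. 1 \<le> p x}\<close> and is contained in the strip over \<open>{x. 0 < p x}\<close>.
    Hence \<open>I p\<close> and the integral of \<open>p\<close> are squeezed between the same two
    numbers.\<close>
  have I_bounds: "measure \<mu> {x. 1 \<le> p x} \<le> I p" "I p \<le> measure \<mu> {x. 0 < p x}"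
    "measure \<mu> {x. 1 \<le> p x} \<le> (LINT x|\<mu>. p x)" "(LINT x|\<mu>. p x) \<le> measure \<mu> {x. 0 < p x}"
    if p: "continuous_on UNIV p" "\<And>x. 0 \<le> p x" "\<And>x. p x \<le> 1" for p
  proof -
    have m1: "{x. 1 \<le> p x} \<in> sets \<mu>" "{x. 0 < p x} \<in> sets \<mu>"
      using setm[OF p(1), of "\<lambda>t. 1 \<le> t"] setm[OF p(1), of "\<lambda>t. 0 < t"]
      by (auto simp flip: atLeast_def greaterThan_def)
    have slabp: "slab (\<lambda>x. 0) p \<in> sets N" "emeasure N (slab (\<lambda>x. 0) p) = ennreal (I p)"
      using p by (auto intro!: slab_N simp: em_N slabsI slab_measure_slab)
    have "emeasure \<mu> {x. 1 \<le> p x} \<le> emeasure N (slab (\<lambda>x. 0) p)"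
    proof -
      have "fst -` {x. 1 \<le> p x} \<inter> S \<subseteq> slab (\<lambda>x. 0) p" by (auto simp: S_def slab_def)
      then show ?thesis using em[of "{x. 1 \<le> p x}"] m1 slabp(1) sets_\<mu> emeasure_mono[of _ _ N] by simp
    qed
    then show "measure \<mu> {x. 1 \<le> p x} \<le> I p"
      unfolding slabp(2) \<mu>.emeasure_eq_measure using nonneg[OF p(1,2)] by (simp add: ennreal_le_iff)
    have "emeasure N (slab (\<lambda>x. 0) p) \<le> emeasure \<mu> {x. 0 < p x}"
    proof -
      have sub: "slab (\<lambda>x. 0) p \<subseteq> fst -` {x. 0 < p x} \<inter> S"
        using p(3) by (auto simp: S_def slab_def intro: less_le_trans)
      have "fst -` {x. 0 < p x} \<inter> S \<in> sets N"
        using measurable_sets[OF fst_N, of "{x. 0 < p x}"] m1 sets_\<mu> S by (auto simp: space_N)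
      then show ?thesis using em[of "{x. 0 < p x}"] m1(2) sets_\<mu> emeasure_mono[OF sub] by simp
    qed
    then show "I p \<le> measure \<mu> {x. 0 < p x}"
      unfolding slabp(2) \<mu>.emeasure_eq_measure using nonneg[OF p(1,2)] by (simp add: ennreal_le_iff)
    have ip: "integrable \<mu> p"
      by (rule \<mu>.integrable_const_bound[of _ 1]) (use p meas in auto)
    have ind: "integrable \<mu> (indicator E :: 'a \<Rightarrow> real)" if "E \<in> sets \<mu>" for E
      using that by (simp add: \<mu>.emeasure_finite less_top[symmetric])
    have "(LINT x|\<mu>. indicator {x. 1 \<le> p x} x) \<le> (LINT x|\<mu>. p x)"
    proof (rule integral_mono[OF ind[OF m1(1)] ip])
      show "indicator {x. 1 \<le> p x} x \<le> p x" for x using p(2)[of x] by (auto simp: indicator_def)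
    qed
    then show "measure \<mu> {x. 1 \<le> p x} \<le> (LINT x|\<mu>. p x)"
      unfolding Bochner_Integration.integral_indicator by (simp add: spaceU)
    have "(LINT x|\<mu>. p x) \<le> (LINT x|\<mu>. indicator {x. 0 < p x} x)"
    proof (rule integral_mono[OF ip ind[OF m1(2)]])
      show "p x \<le> indicator {x. 0 < p x} x" for x using p(2,3)[of x] by (auto simp: indicator_def)
    qed
    then show "(LINT x|\<mu>. p x) \<le> measure \<mu> {x. 0 < p x}"
      unfolding Bochner_Integration.integral_indicator by (simp add: spaceU)
  qed
  have "(LINT x|\<mu>. f x) = I f" if f: "continuous_on UNIV f" "\<And>x. 0 \<le> f x" "\<And>x. f x \<le> 1" for f
  proof -
    have bd: "real n * \<bar>(LINT x|\<mu>. f x) - I f\<bar> \<le> measure \<mu> UNIV" for n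
    proof -
      \<comment> \<open>The function \<open>n * f\<close> is cut into \<open>n\<close> horizontal
        layers of height 1. The sum of the discrepancies of all layers will be bounded independently
        of \<open>n\<close>, so dividing by \<open>n\<close> removes it.\<close>
      define p where "p k x = min 1 (max 0 (real n * f x - real k))" for k x
      have p: "continuous_on UNIV (p k)" "0 \<le> p k x" "p k x \<le> 1" for k x
        unfolding p_def using f by (auto intro!: continuous_intros)
      have ps: "(\<Sum>k<m. p k x) = min (real m) (real n * f x)" for m x
      proof (induction m)
        case 0 then show ?case using f(2)[of x] by simp
      next
        case (Suc m)
        then show ?case by (auto simp: p_def min_def max_def)
      qed
      have nf: "real n * f x = (\<Sum>k<n. p k x)" for x
        unfolding ps using f(3)[of x] mult_left_mono[of "f x" 1 "real n"] by simp
      have "real n * I f = (\<Sum>k<n. I (p k))"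
        using scale[OF f(1,2), of "real n"] sum[of "{..<n}" p] p unfolding nf by simp
      moreover have "real n * (LINT x|\<mu>. f x) = (\<Sum>k<n. (LINT x|\<mu>. p k x))"
      proof -
        have "real n * (LINT x|\<mu>. f x) = (LINT x|\<mu>. (\<Sum>k<n. p k x))" by (simp flip: nf)
        also have "\<dots> = (\<Sum>k<n. (LINT x|\<mu>. p k x))"
          by (intro Bochner_Integration.integral_sum \<mu>.integrable_const_bound[of _ 1])
             (use p meas in auto)
        finally show ?thesis .
      qed
      ultimately have eq: "real n * (LINT x|\<mu>. f x) - real n * I f = (\<Sum>k<n. ((LINT x|\<mu>. p k x) - I (p k)))"
        by (simp only: sum_subtractf)
      have "real n * \<bar>(LINT x|\<mu>. f x) - I f\<bar> = \<bar>real n * (LINT x|\<mu>. f x) - real n * I f\<bar>"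
        by (simp add: abs_mult flip: right_diff_distrib)
      also have "\<dots> = \<bar>\<Sum>k<n. ((LINT x|\<mu>. p k x) - I (p k))\<bar>" by (simp only: eq)
      also have "\<dots> \<le> (\<Sum>k<n. \<bar>(LINT x|\<mu>. p k x) - I (p k)\<bar>)" by (rule sum_abs)
      also have "\<dots> \<le> (\<Sum>k<n. measure \<mu> {x. 0 < p k x} - measure \<mu> {x. 0 < p (Suc k) x})"
      proof (rule sum_mono)
        fix k
        \<comment> \<open>A layer is positive only where the layer beneath it is full, which turns
          the sum of the squeeze widths into a telescoping one.\<close>
        have "measure \<mu> {x. 0 < p (Suc k) x} \<le> measure \<mu> {x. 1 \<le> p k x}"
        proof (rule \<mu>.finite_measure_mono)
          show "{x. 0 < p (Suc k) x} \<subseteq> {x. 1 \<le> p k x}" by (auto simp: p_def min_def max_def split: if_splits)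
          show "{x. 1 \<le> p k x} \<in> sets \<mu>" using setm[OF p(1), of "\<lambda>t. 1 \<le> t"] by (auto simp flip: atLeast_def)
        qed
        then show "\<bar>(LINT x|\<mu>. p k x) - I (p k)\<bar> \<le> measure \<mu> {x. 0 < p k x} - measure \<mu> {x. 0 < p (Suc k) x}"
          using I_bounds[of "p k", OF p] by linarith
      qed
      also have "\<dots> = measure \<mu> {x. 0 < p 0 x} - measure \<mu> {x. 0 < p n x}"
        by (rule sum_lessThan_telescope')
      also have "\<dots> \<le> measure \<mu> UNIV"
        using \<mu>.bounded_measure[of "{x. 0 < p 0 x}"] measure_nonneg[of \<mu> "{x. 0 < p n x}"]
        unfolding spaceU by linarith
      finally show ?thesis .
    qed
    show ?thesis
    proof (rule ccontr)
      assume "\<not> ?thesis"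
      then have pos: "\<bar>(LINT x|\<mu>. f x) - I f\<bar> > 0" by simp
      obtain n where "real n > measure \<mu> UNIV / \<bar>(LINT x|\<mu>. f x) - I f\<bar>" using reals_Archimedean2 by blast
      then have "real n * \<bar>(LINT x|\<mu>. f x) - I f\<bar> > measure \<mu> UNIV" using pos by (simp add: field_simps)
      then show False using bd[of n] by simp
    qed
  qed
  then show ?thesis using sets_\<mu> fin by blast
qed

end

section \<open>Signed functionals and countable families of complex functionals\<close>

lemma integrable_bounded_mult:
  fixes f h :: "'a \<Rightarrow> 'b::{real_normed_algebra, banach, second_countable_topology}"
  assumes "integrable M h" "f \<in> borel_measurable M" "\<And>x. norm (f x) \<le> B"
  shows "integrable M (\<lambda>x. f x * h x)"
proof (rule Bochner_Integration.integrable_bound)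
  show "integrable M (\<lambda>x. B * norm (h x))" using assms(1) by simp
  show "(\<lambda>x. f x * h x) \<in> borel_measurable M" using assms(1,2) by simp
  have "norm (f x * h x) \<le> norm (B * norm (h x))" for x
    using norm_mult_ineq[of "f x" "h x"] mult_right_mono[OF assms(3)[of x] norm_ge_zero[of "h x"]]
    unfolding real_norm_def by linarith
  then show "AE x in M. norm (f x * h x) \<le> norm (B * norm (h x))" by simp
qed

text \<open>Jordan decomposition at the level of functionals: \<open>P f\<close>, the supremum of
  \<open>F\<close> over the continuous functions between 0 and \<open>f\<close>, is the positive
  part. Both \<open>P\<close> and \<open>P - F\<close> are positive, so the positive theorem applies
  to each.\<close>

lemma Riesz_signed:
  fixes F :: "('a::topological_space \<Rightarrow> real) \<Rightarrow> real"
  assumes K: "compact K"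
    and cozero: "\<And>U :: 'a set. open U \<Longrightarrow> \<exists>h :: 'a \<Rightarrow> real. continuous_on UNIV h \<and> U = {x. h x \<noteq> 0}"
    and add: "\<And>f g. continuous_on UNIV f \<Longrightarrow> continuous_on UNIV g \<Longrightarrow> F (\<lambda>x. f x + g x) = F f + F g"
    and scale: "\<And>f c. continuous_on UNIV f \<Longrightarrow> F (\<lambda>x. c * f x) = c * F f"
    and bound: "\<And>f b. continuous_on UNIV f \<Longrightarrow> 0 \<le> b \<Longrightarrow> (\<And>x. x \<in> K \<Longrightarrow> \<bar>f x\<bar> \<le> b) \<Longrightarrow> \<bar>F f\<bar> \<le> C * b"
  shows "\<exists>\<mu> \<nu>. sets \<mu> = sets borel \<and> finite_measure \<mu> \<and> sets \<nu> = sets borel \<and> finite_measure \<nu> \<and>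
    (\<forall>f B. continuous_on UNIV f \<longrightarrow> (\<forall>x. \<bar>f x\<bar> \<le> B) \<longrightarrow> F f = (LINT x|\<mu>. f x) - (LINT x|\<nu>. f x))"
proof -
  define S where "S f = {h. continuous_on UNIV h \<and> (\<forall>x. 0 \<le> h x \<and> h x \<le> f x)}" for f :: "'a \<Rightarrow> real"
  define P where "P f = (SUP h\<in>S f. F h)" for f
  have F0: "F (\<lambda>x. 0) = 0" using scale[of "\<lambda>x. 0" 0] by simp
  have C: "C \<ge> 0" using bound[of "\<lambda>x. 0" 1] F0 by simp
  have F_le: "F h \<le> C * b" if "h \<in> S f" "0 \<le> b" "\<And>x. x \<in> K \<Longrightarrow> f x \<le> b" for h f b
  proof -
    have "\<bar>F h\<bar> \<le> C * b"
    proof (rule bound[OF _ that(2)])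
      fix x assume "x \<in> K"
      then have "f x \<le> b" by (rule that(3))
      moreover have "0 \<le> h x" "h x \<le> f x" using that(1) by (auto simp: S_def)
      ultimately show "\<bar>h x\<bar> \<le> b" by simp
    qed (use that(1) in \<open>simp add: S_def\<close>)
    then show ?thesis by simp
  qed
  have bdd: "bdd_above (F ` S f)" if "continuous_on UNIV f" for f
  proof -
    have "bounded (f ` K)"
      using compact_continuous_image[OF continuous_on_subset[OF that] K] compact_imp_bounded by blast
    then obtain b where b: "\<And>x. x \<in> K \<Longrightarrow> \<bar>f x\<bar> \<le> b" by (auto simp: bounded_iff)
    have "f x \<le> \<bar>b\<bar>" if "x \<in> K" for x using b[OF that] by simp
    then show ?thesis by (intro bdd_aboveI2[of _ _ "C * \<bar>b\<bar>"] F_le) auto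
  qed
  have ne: "(\<lambda>x. 0) \<in> S f" if "\<And>x. 0 \<le> f x" for f using that by (auto simp: S_def)
  have upper: "F h \<le> P f" if "h \<in> S f" "continuous_on UNIV f" for h f
    unfolding P_def by (intro cSUP_upper that bdd)
  have P_least: "P f \<le> c" if "\<And>x. 0 \<le> f x" "\<And>h. h \<in> S f \<Longrightarrow> F h \<le> c" for f c
    unfolding P_def using ne[of f] that by (intro cSUP_least) auto
  have P_add: "P (\<lambda>x. f x + g x) = P f + P g"
    if c: "continuous_on UNIV f" "continuous_on UNIV g" and p: "\<And>x. 0 \<le> f x" "\<And>x. 0 \<le> g x" for f g
  proof (rule antisym)
    have cfg: "continuous_on UNIV (\<lambda>x. f x + g x)" using c by (intro continuous_intros)
    show "P (\<lambda>x. f x + g x) \<le> P f + P g"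
    proof (rule P_least)
      fix h assume h: "h \<in> S (\<lambda>x. f x + g x)"
      then have ch: "continuous_on UNIV h" by (simp add: S_def)
      \<comment> \<open>Riesz decomposition: a function below \<open>f + g\<close> splits into one
        below \<open>f\<close> and one below \<open>g\<close>, which gives the harder half of
        additivity.\<close>
      have h1: "(\<lambda>x. min (h x) (f x)) \<in> S f"
        using h c p by (auto simp: S_def intro!: continuous_intros)
      have h2: "(\<lambda>x. h x - min (h x) (f x)) \<in> S g"
        unfolding S_def
      proof (safe intro!: continuous_on_diff continuous_on_min ch c)
        fix x
        have "h x \<le> f x + g x" "0 \<le> g x" using h p by (auto simp: S_def)
        then show "h x - min (h x) (f x) \<le> g x" by linarith
      qed simp
      have "F h = F (\<lambda>x. min (h x) (f x) + (h x - min (h x) (f x)))" by simp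
      also have "\<dots> = F (\<lambda>x. min (h x) (f x)) + F (\<lambda>x. h x - min (h x) (f x))"
        by (rule add) (use ch c in \<open>auto intro!: continuous_intros\<close>)
      also have "\<dots> \<le> P f + P g" using upper[OF h1 c(1)] upper[OF h2 c(2)] by simp
      finally show "F h \<le> P f + P g" .
    qed (use p in auto)
    have "F h + F k \<le> P (\<lambda>x. f x + g x)" if "h \<in> S f" "k \<in> S g" for h k
    proof -
      have "(\<lambda>x. h x + k x) \<in> S (\<lambda>x. f x + g x)"
        using that by (auto simp: S_def intro!: continuous_intros add_mono)
      from upper[OF this cfg] show ?thesis using add[of h k] that by (simp add: S_def)
    qed
    then have "P f \<le> P (\<lambda>x. f x + g x) - F k" if "k \<in> S g" for k
      using that p by (intro P_least) (auto simp: algebra_simps)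
    then have "P g \<le> P (\<lambda>x. f x + g x) - P f"
      using p by (intro P_least) (auto simp: algebra_simps)
    then show "P f + P g \<le> P (\<lambda>x. f x + g x)" by simp
  qed
  have P_scale: "P (\<lambda>x. c * f x) = c * P f"
    if f: "continuous_on UNIV f" "\<And>x. 0 \<le> f x" and "0 \<le> c" for f c
  proof (cases "c = 0")
    case True
    have "S (\<lambda>x. 0) = {\<lambda>x. 0}" by (auto simp: S_def intro: antisym)
    then show ?thesis using True by (simp add: P_def F0)
  next
    case False
    then have c: "c > 0" using that by simp
    have cf: "continuous_on UNIV (\<lambda>x. c * f x)" using f by (intro continuous_intros)
    show ?thesis
    proof (rule antisym)
      show "P (\<lambda>x. c * f x) \<le> c * P f"
      proof (rule P_least)
        fix h assume h: "h \<in> S (\<lambda>x. c * f x)"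
        then have "(\<lambda>x. inverse c * h x) \<in> S f"
          using c by (auto simp: S_def field_simps intro!: continuous_intros)
        from upper[OF this f(1)] have "inverse c * F h \<le> P f"
          using scale[of h "inverse c"] h by (simp add: S_def)
        then show "F h \<le> c * P f" using c by (simp add: field_simps)
      qed (use c f in auto)
      have "P f \<le> P (\<lambda>x. c * f x) / c"
      proof (rule P_least)
        fix h assume h: "h \<in> S f"
        then have "(\<lambda>x. c * h x) \<in> S (\<lambda>x. c * f x)"
          using c by (auto simp: S_def intro!: continuous_intros)
        from upper[OF this cf] have "c * F h \<le> P (\<lambda>x. c * f x)"
          using scale[of h c] h by (simp add: S_def)
        then show "F h \<le> P (\<lambda>x. c * f x) / c" using c by (simp add: field_simps)
      qed (use f in auto)
      then show "c * P f \<le> P (\<lambda>x. c * f x)" using c by (simp add: field_simps)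
    qed
  qed
  have P_nonneg: "0 \<le> P f" and P_ge: "F f \<le> P f" if "continuous_on UNIV f" "\<And>x. 0 \<le> f x" for f
    using upper[OF ne that(1)] upper[of f f] that F0 by (auto simp: S_def)
  have P_bound: "P f \<le> C * b" if "continuous_on UNIV f" "\<And>x. 0 \<le> f x" "0 \<le> b" "\<And>x. x \<in> K \<Longrightarrow> f x \<le> b" for f b
    using that by (intro P_least F_le[where f = f]) auto
  interpret P: compact_functional K P C
    by standard (use K P_add P_scale P_nonneg P_bound cozero in auto)
  \<comment> \<open>One \<open>C\<close> comes from the bound on \<open>P\<close>, the other from
    the bound on \<open>F\<close>.\<close>
  interpret Q: compact_functional K "\<lambda>f. P f - F f" "2 * C"
  proof
    fix f :: "'a \<Rightarrow> real" and b :: real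
    assume f: "continuous_on UNIV f" "\<And>x. 0 \<le> f x" "0 \<le> b" "\<And>x. x \<in> K \<Longrightarrow> f x \<le> b"
    have "\<bar>F f\<bar> \<le> C * b" using f by (intro bound) auto
    then show "P f - F f \<le> 2 * C * b" using P_bound[OF f] by simp
  qed (use K P_add P_scale add scale P_ge cozero in \<open>auto simp: algebra_simps\<close>)
  obtain \<mu> where \<mu>: "sets \<mu> = sets borel" "finite_measure \<mu>"
    "\<And>f. continuous_on UNIV f \<Longrightarrow> (\<And>x. 0 \<le> f x \<and> f x \<le> 1) \<Longrightarrow> (LINT x|\<mu>. f x) = P f"
    using P.Riesz_positive by blast
  obtain \<nu> where \<nu>: "sets \<nu> = sets borel" "finite_measure \<nu>"
    "\<And>f. continuous_on UNIV f \<Longrightarrow> (\<And>x. 0 \<le> f x \<and> f x \<le> 1) \<Longrightarrow> (LINT x|\<nu>. f x) = P f - F f"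
    using Q.Riesz_positive by blast
  have "F f = (LINT x|\<mu>. f x) - (LINT x|\<nu>. f x)" if f: "continuous_on UNIV f" "\<And>x. \<bar>f x\<bar> \<le> B" for f B
  proof -
    \<comment> \<open>The positive theorem identifies integrals of functions with values in the unit
      interval only; \<open>u\<close> is the affine image of \<open>f\<close> there, and adding 1
      keeps the divisor positive.\<close>
    define b where "b = \<bar>B\<bar> + 1"
    have b: "b > 0" "\<bar>f x\<bar> \<le> b" for x using f(2)[of x] by (auto simp: b_def)
    define u where "u x = (f x + b) / (2 * b)" for x
    have u: "continuous_on UNIV u" "0 \<le> u x \<and> u x \<le> 1" for x
      using b(1) b(2)[of x] unfolding u_def by (auto intro!: continuous_intros f simp: field_simps)
    have fu: "f x = 2 * b * u x + (- b) * 1" for x using b(1) by (simp add: u_def)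
    have "F f = F (\<lambda>x. 2 * b * u x) + F (\<lambda>x. (- b) * 1)"
      unfolding fu by (rule add) (use u in \<open>auto intro!: continuous_intros\<close>)
    also have "\<dots> = 2 * b * F u + (- b) * F (\<lambda>x. 1)"
      using scale[OF u(1), of "2 * b"] scale[of "\<lambda>x. 1" "- b"] by simp
    finally have Ff: "F f = 2 * b * F u + (- b) * F (\<lambda>x. 1)" .
    have lint: "(LINT x|M. f x) = 2 * b * (LINT x|M. u x) + (- b) * (LINT x|M. 1)"
      if M: "sets M = sets borel" "finite_measure M" for M :: "'a measure"
    proof -
      interpret M: finite_measure M by fact
      have "u \<in> borel_measurable M"
        using borel_measurable_continuous_onI[OF u(1)] M(1) by (simp cong: measurable_cong_sets)
      then have iu: "integrable M u" by (intro M.integrable_const_bound[of _ 1]) (use u in auto)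
      show ?thesis unfolding fu using iu by (subst Bochner_Integration.integral_add) auto
    qed
    have Fu: "F u = (LINT x|\<mu>. u x) - (LINT x|\<nu>. u x)" using \<mu>(3)[OF u] \<nu>(3)[OF u] by simp
    have F1: "F (\<lambda>x. 1) = (LINT x|\<mu>. 1) - (LINT x|\<nu>. 1)"
      using \<mu>(3)[of "\<lambda>x. 1"] \<nu>(3)[of "\<lambda>x. 1"] by simp
    show ?thesis unfolding Ff Fu F1 lint[OF \<mu>(1,2)] lint[OF \<nu>(1,2)] by (simp add: algebra_simps)
  qed
  then show ?thesis using \<mu> \<nu> by blast
qed

text \<open>A sum of all the measures with strictly positive weights: if it vanishes on a set, then
  so does every summand.\<close>

lemma dominating_measure:
  fixes m :: "'i::countable \<Rightarrow> 'a measure"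
  assumes m: "\<And>i. sets (m i) = sets M" "\<And>i. finite_measure (m i)"
  shows "\<exists>\<mu>. sets \<mu> = sets M \<and> finite_measure \<mu> \<and> (\<forall>i. absolutely_continuous \<mu> (m i))"
proof -
  define m' where "m' n = m (from_nat n)" for n
  \<comment> \<open>Dividing by one plus the total mass keeps the \<open>n\<close>-th term below
    \<open>(1/2) ^ n\<close>, so the sum is finite; the weight is never zero.\<close>
  define c where "c n = ennreal ((1/2) ^ n / (1 + measure (m' n) (space M)))" for n
  define E where "E B = (\<Sum>n. c n * emeasure (m' n) B)" for B
  define \<mu> where "\<mu> = measure_of (space M) (sets M) E"
  have em: "emeasure \<mu> B = E B" if "B \<in> sets M" for B
  proof (rule emeasure_measure_of[OF \<mu>_def sets.space_closed])
    show "positive (sets \<mu>) E" by (auto simp: positive_def E_def)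
    show "countably_additive (sets \<mu>) E"
    proof (rule countably_additiveI)
      fix A :: "nat \<Rightarrow> 'a set" assume A: "range A \<subseteq> sets \<mu>" "disjoint_family A"
      have "range A \<subseteq> sets (m' n)" for n using A(1) m(1) by (simp add: \<mu>_def m'_def)
      then have "(\<Sum>i. emeasure (m' n) (A i)) = emeasure (m' n) (\<Union>i. A i)" for n
        using A(2) by (rule suminf_emeasure)
      then have eq: "c n * emeasure (m' n) (\<Union>i. A i) = (\<Sum>i. c n * emeasure (m' n) (A i))" for n
        by simp
      \<comment> \<open>One of the two sums is read as an integral over counting measure in order to
        interchange them.\<close>
      have "(\<Sum>i. E (A i)) = (\<integral>\<^sup>+ i. (\<Sum>n. c n * emeasure (m' n) (A i)) \<partial>count_space UNIV)"
        by (simp only: E_def nn_integral_count_space_nat)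
      also have "\<dots> = (\<Sum>n. \<integral>\<^sup>+ i. c n * emeasure (m' n) (A i) \<partial>count_space UNIV)"
        by (rule nn_integral_suminf) simp
      also have "\<dots> = E (\<Union>i. A i)"
        unfolding E_def eq by (simp only: nn_integral_count_space_nat)
      finally show "(\<Sum>i. E (A i)) = E (\<Union>i. A i)" .
    qed
  qed (use that in \<open>simp add: \<mu>_def\<close>)
  have "emeasure \<mu> (space \<mu>) < \<infinity>"
  proof -
    have "c n * emeasure (m' n) (space M) \<le> ennreal ((1/2) ^ n)" for n
    proof -
      interpret m': finite_measure "m' n" using m(2) by (simp add: m'_def)
      have "measure (m' n) (space M) / (1 + measure (m' n) (space M)) \<le> 1"
        by (intro divide_le_eq_1_pos[THEN iffD2] add_pos_nonneg) auto
      then have "(1/2) ^ n * (measure (m' n) (space M) / (1 + measure (m' n) (space M))) \<le> (1/2) ^ n * (1::real)"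
        by (intro mult_left_mono) auto
      then show ?thesis unfolding c_def m'.emeasure_eq_measure
        by (simp add: ennreal_mult'[symmetric] ennreal_leI)
    qed
    then have "E (space M) \<le> (\<Sum>n. ennreal ((1/2) ^ n))" unfolding E_def by (intro suminf_le) auto
    also have "\<dots> = ennreal (\<Sum>n. (1/2) ^ n)" by (intro suminf_ennreal2) (auto intro: summable_geometric)
    also have "\<dots> < \<infinity>" by simp
    finally show ?thesis using em[of "space M"] by (simp add: \<mu>_def)
  qed
  then have "finite_measure \<mu>" by (intro finite_measureI) auto
  moreover have "absolutely_continuous \<mu> (m i)" for i
    unfolding absolutely_continuous_def
  proof
    fix B assume "B \<in> null_sets \<mu>"
    then have B: "B \<in> sets M" "E B = 0" using em[of B] by (auto simp: null_sets_def \<mu>_def)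
    then have "c (to_nat i) * emeasure (m' (to_nat i)) B = 0"
      unfolding E_def by (subst (asm) suminf_eq_zero_iff) auto
    moreover have "c (to_nat i) \<noteq> 0"
      unfolding c_def by (simp add: ennreal_eq_0_iff not_le add_pos_nonneg)
    ultimately show "B \<in> null_sets (m i)" using B m by (auto simp: null_sets_def m'_def)
  qed
  ultimately show ?thesis by (intro exI[of _ \<mu>]) (auto simp: \<mu>_def)
qed

lemma finite_measure_densityI:
  fixes n :: "'a \<Rightarrow> real"
  assumes "integrable M n" "\<And>x. 0 \<le> n x"
  shows "finite_measure (density M (\<lambda>x. ennreal (n x)))"
proof (rule finite_measureI)
  have "emeasure (density M (\<lambda>x. ennreal (n x))) (space M) = (\<integral>\<^sup>+x. ennreal (n x) \<partial>M)"
    using assms(1) by (simp add: emeasure_density cong: nn_integral_cong)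
  also have "\<dots> = ennreal (LINT x|M. n x)" using assms by (intro nn_integral_eq_integral) auto
  finally show "emeasure (density M (\<lambda>x. ennreal (n x))) (space (density M (\<lambda>x. ennreal (n x)))) \<noteq> \<infinity>" by simp
qed

lemma finite_measure_density:
  assumes \<mu>: "finite_measure \<mu>" and m: "finite_measure m" "sets m = sets \<mu>" "absolutely_continuous \<mu> m"
  obtains D where "D \<in> borel_measurable \<mu>" "\<And>x. 0 \<le> D x" "m = density \<mu> (\<lambda>x. ennreal (D x))"
    "integrable \<mu> D"
proof -
  interpret \<mu>: finite_measure \<mu> by fact
  interpret m: finite_measure m by fact
  obtain D where D: "D \<in> borel_measurable \<mu>" "AE x in \<mu>. RN_deriv \<mu> m x = ennreal (D x)" "\<And>x. 0 \<le> D x"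
    using \<mu>.real_RN_deriv[OF m(1,3,2)] by blast
  have eq: "m = density \<mu> (\<lambda>x. ennreal (D x))"
    using \<mu>.density_RN_deriv[OF m(3,2)] density_cong[OF _ _ D(2)] D(1) by simp
  have "(\<integral>\<^sup>+x. ennreal (D x) \<partial>\<mu>) = emeasure m (space m)"
    unfolding eq using D(1) by (simp add: emeasure_density cong: nn_integral_cong)
  then have "(\<integral>\<^sup>+x. ennreal (D x) \<partial>\<mu>) < \<infinity>" by (simp add: m.emeasure_eq_measure)
  then have "integrable \<mu> D" using D by (intro integrableI_nonneg) auto
  then show thesis by (rule that[OF D(1,3) eq])
qed

text \<open>A single reference measure allows the densities of different functionals to be combined
  and compared pointwise, as the coefficients of a form must be. Countability of the index type
  provides the dominating measure.\<close>

theorem Riesz_family: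
  fixes F :: "'i::countable \<Rightarrow> ('a::topological_space \<Rightarrow> real) \<Rightarrow> complex"
  assumes cozero: "\<And>U :: 'a set. open U \<Longrightarrow> \<exists>h :: 'a \<Rightarrow> real. continuous_on UNIV h \<and> U = {x. h x \<noteq> 0}"
    and K: "\<And>i. compact (K i)"
    and add: "\<And>i f g. continuous_on UNIV f \<Longrightarrow> continuous_on UNIV g \<Longrightarrow> F i (\<lambda>x. f x + g x) = F i f + F i g"
    and scale: "\<And>i f c. continuous_on UNIV f \<Longrightarrow> F i (\<lambda>x. c * f x) = of_real c * F i f"
    and bound: "\<And>i f b. continuous_on UNIV f \<Longrightarrow> 0 \<le> b \<Longrightarrow> (\<And>x. x \<in> K i \<Longrightarrow> \<bar>f x\<bar> \<le> b) \<Longrightarrow>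
      cmod (F i f) \<le> C i * b"
  shows "\<exists>\<mu> H. sets \<mu> = sets borel \<and> finite_measure \<mu> \<and> (\<forall>i. integrable \<mu> (H i)) \<and>
    (\<forall>i f B. continuous_on UNIV f \<longrightarrow> (\<forall>x. \<bar>f x\<bar> \<le> B) \<longrightarrow> F i f = (LINT x|\<mu>. of_real (f x) * H i x))"
proof -
  \<comment> \<open>The boolean selects the real part (\<open>True\<close>) or the imaginary part
    (\<open>False\<close>).\<close>
  define G where "G = (\<lambda>(i, b) f. if b then Re (F i f) else Im (F i f))"
  have "\<exists>\<mu> \<nu>. sets \<mu> = sets borel \<and> finite_measure \<mu> \<and> sets \<nu> = sets borel \<and> finite_measure \<nu> \<and>
    (\<forall>f B. continuous_on UNIV f \<longrightarrow> (\<forall>x. \<bar>f x\<bar> \<le> B) \<longrightarrow> G j f = (LINT x|\<mu>. f x) - (LINT x|\<nu>. f x))" for j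
  proof (rule Riesz_signed[OF K[of "fst j"] cozero])
    fix f :: "'a \<Rightarrow> real" and b assume "continuous_on UNIV f" "0 \<le> b" "\<And>x. x \<in> K (fst j) \<Longrightarrow> \<bar>f x\<bar> \<le> b"
    then have "cmod (F (fst j) f) \<le> C (fst j) * b" by (rule bound)
    moreover have "\<bar>G j f\<bar> \<le> cmod (F (fst j) f)"
      by (auto simp: G_def split: prod.splits intro: abs_Re_le_cmod abs_Im_le_cmod)
    ultimately show "\<bar>G j f\<bar> \<le> C (fst j) * b" by simp
  qed (auto simp: G_def add scale split: prod.splits)
  then obtain p q where pq: "\<And>j. sets (p j) = sets borel" "\<And>j. finite_measure (p j)"
    "\<And>j. sets (q j) = sets borel" "\<And>j. finite_measure (q j)"
    "\<And>j f B. continuous_on UNIV f \<Longrightarrow> (\<And>x. \<bar>f x\<bar> \<le> B) \<Longrightarrow> G j f = (LINT x|p j. f x) - (LINT x|q j. f x)"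
    by metis
  \<comment> \<open>A second boolean selects the positive or the negative measure of each real
    functional, so that one application of \<open>dominating_measure\<close> covers all of
    them.\<close>
  define m where "m k = (if snd k then p (fst k) else q (fst k))" for k
  have m: "sets (m k) = sets borel" "finite_measure (m k)" for k
    using pq(1-4) unfolding m_def by simp_all
  obtain \<mu> where \<mu>: "sets \<mu> = sets borel" "finite_measure \<mu>" "\<And>k. absolutely_continuous \<mu> (m k)"
    using dominating_measure[of m borel, OF m] by blast
  have "\<exists>D. D \<in> borel_measurable \<mu> \<and> (\<forall>x. 0 \<le> D x) \<and> m k = density \<mu> (\<lambda>x. ennreal (D x)) \<and> integrable \<mu> D" for k
  proof -
    have "sets (m k) = sets \<mu>" using m(1) \<mu>(1) by simp
    from finite_measure_density[OF \<mu>(2) m(2) this \<mu>(3)] show ?thesis by metis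
  qed
  then obtain D where D: "\<And>k. D k \<in> borel_measurable \<mu>" "\<And>k x. 0 \<le> D k x"
    "\<And>k. m k = density \<mu> (\<lambda>x. ennreal (D k x))" "\<And>k. integrable \<mu> (D k)" by metis
  define R where "R j x = D (j, True) x - D (j, False) x" for j x
  define H where "H i x = of_real (R (i, True) x) + \<i> * of_real (R (i, False) x)" for i x
  have R: "integrable \<mu> (R j)" for j unfolding R_def[abs_def] using D(4) by simp
  then have iH: "integrable \<mu> (H i)" for i unfolding H_def[abs_def] by simp
  have "F i f = (LINT x|\<mu>. of_real (f x) * H i x)"
    if f: "continuous_on UNIV f" "\<And>x. \<bar>f x\<bar> \<le> B" for i f B
  proof -
    have fm: "f \<in> borel_measurable \<mu>"
      using borel_measurable_continuous_onI[OF f(1)] \<mu>(1) by (simp cong: measurable_cong_sets)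
    have int: "integrable \<mu> (\<lambda>x. D k x * f x)" for k
      using integrable_bounded_mult[OF D(4) fm, of B k] f(2) by (simp add: mult.commute)
    have Gj: "G j f = (LINT x|\<mu>. f x * R j x)" for j
    proof -
      have "(LINT x|m k. f x) = (LINT x|\<mu>. D k x * f x)" for k
        unfolding D(3) using D(1,2) fm by (subst integral_density) auto
      from this[of "(j, True)"] this[of "(j, False)"]
      have "G j f = (LINT x|\<mu>. D (j, True) x * f x) - (LINT x|\<mu>. D (j, False) x * f x)"
        using pq(5)[OF f, of j] by (simp add: m_def)
      also have "\<dots> = (LINT x|\<mu>. f x * R j x)"
        using int by (simp flip: Bochner_Integration.integral_diff add: R_def algebra_simps)
      finally show ?thesis .
    qed
    have intR: "integrable \<mu> (\<lambda>x. f x * R j x)" for j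
    proof -
      have "integrable \<mu> (\<lambda>x. D (j, True) x * f x - D (j, False) x * f x)" using int by simp
      then show ?thesis by (simp add: R_def algebra_simps)
    qed
    have "(LINT x|\<mu>. of_real (f x) * H i x) =
      (LINT x|\<mu>. of_real (f x * R (i, True) x) + \<i> * of_real (f x * R (i, False) x))"
      by (simp add: H_def algebra_simps)
    also have "\<dots> = of_real (G (i, True) f) + \<i> * of_real (G (i, False) f)"
      unfolding Gj using intR by (subst Bochner_Integration.integral_add) (auto simp flip: of_real_mult)
    also have "\<dots> = F i f" by (simp add: G_def complex_eq_iff)
    finally show ?thesis by simp
  qed
  then show ?thesis using \<mu> iH by blast
qed

section \<open>Density of continuous functions\<close>

lemma integrable_continuous_bounded:
  fixes h :: "'a::topological_space \<Rightarrow> 'b::{banach, second_countable_topology}"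
  assumes "sets M = sets borel" "finite_measure M" "continuous_on UNIV h" "\<And>x. norm (h x) \<le> B"
  shows "integrable M h"
proof (rule finite_measure.integrable_const_bound[of _ _ B])
  show "h \<in> borel_measurable M"
    using borel_measurable_continuous_onI[OF assms(3)] assms(1) by (simp cong: measurable_cong_sets)
  show "AE x in M. norm (h x) \<le> B" using assms(4) by (intro AE_I2)
qed (rule assms(2))

text \<open>Boundedness of \<open>h\<close> makes it integrable for a finite Borel measure, and
  allows a \<open>C0\<close> form to be multiplied by it without leaving \<open>C0\<close>.\<close>

definition L1_approximable :: "'a::topological_space measure \<Rightarrow> ('a \<Rightarrow> 'b::{banach, second_countable_topology}) \<Rightarrow> bool"
  where "L1_approximable M f \<longleftrightarrow>
    (\<forall>e>0. \<exists>h B. continuous_on UNIV h \<and> (\<forall>x. norm (h x) \<le> B) \<and> (LINT x|M. norm (f x - h x)) < e)"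

lemma L1_approximable_limit:
  assumes M: "sets M = sets borel" "finite_measure M" and f: "integrable M f"
    and g: "\<And>n. integrable M (g n)" "\<And>n. L1_approximable M (g n)"
    and lim: "(\<lambda>n. LINT x|M. norm (f x - g n x)) \<longlonglongrightarrow> 0"
  shows "L1_approximable M f"
  unfolding L1_approximable_def
proof (intro allI impI)
  interpret M: finite_measure M by fact
  fix e :: real assume e: "e > 0"
  then have "\<forall>\<^sub>F n in sequentially. (LINT x|M. norm (f x - g n x)) < e / 2"
    using order_tendstoD(2)[OF lim, of "e / 2"] by simp
  then obtain n where n: "(LINT x|M. norm (f x - g n x)) < e / 2"
    by (auto simp: eventually_sequentially)
  obtain h B where h: "continuous_on UNIV h" "\<And>x. norm (h x) \<le> B" "(LINT x|M. norm (g n x - h x)) < e / 2"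
    using g(2)[of n] e unfolding L1_approximable_def by (meson half_gt_zero)
  have ih: "integrable M h" using integrable_continuous_bounded[OF M h(1,2)] .
  have "(LINT x|M. norm (f x - h x)) \<le> (LINT x|M. norm (f x - g n x) + norm (g n x - h x))"
    using f g(1)[of n] ih by (intro integral_mono) (auto intro: norm_triangle_le_diff order_trans[OF _ norm_triangle_ineq])
  also have "\<dots> = (LINT x|M. norm (f x - g n x)) + (LINT x|M. norm (g n x - h x))"
    using f g(1)[of n] ih by (intro Bochner_Integration.integral_add) auto
  finally have "(LINT x|M. norm (f x - h x)) < e" using n h(3) by simp
  then show "\<exists>h B. continuous_on UNIV h \<and> (\<forall>x. norm (h x) \<le> B) \<and> (LINT x|M. norm (f x - h x)) < e"
    using h by blast
qed

lemma L1_approximable_add: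
  assumes M: "sets M = sets borel" "finite_measure M" and f: "integrable M f" "integrable M g"
    and ap: "L1_approximable M f" "L1_approximable M g"
  shows "L1_approximable M (\<lambda>x. f x + g x)"
  unfolding L1_approximable_def
proof (intro allI impI)
  interpret M: finite_measure M by fact
  fix e :: real assume e: "e > 0"
  obtain h B where h: "continuous_on UNIV h" "\<And>x. norm (h x) \<le> B" "(LINT x|M. norm (f x - h x)) < e / 2"
    using ap(1) e unfolding L1_approximable_def by (meson half_gt_zero)
  obtain k B' where k: "continuous_on UNIV k" "\<And>x. norm (k x) \<le> B'" "(LINT x|M. norm (g x - k x)) < e / 2"
    using ap(2) e unfolding L1_approximable_def by (meson half_gt_zero)
  have i: "integrable M h" "integrable M k"
    using integrable_continuous_bounded[OF M] h(1,2) k(1,2) by blast+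
  have "(LINT x|M. norm (f x + g x - (h x + k x))) \<le> (LINT x|M. norm (f x - h x) + norm (g x - k x))"
    using f i by (intro integral_mono) (auto simp: add_diff_add intro: norm_triangle_ineq)
  also have "\<dots> = (LINT x|M. norm (f x - h x)) + (LINT x|M. norm (g x - k x))"
    using f i by (intro Bochner_Integration.integral_add) auto
  finally have "(LINT x|M. norm (f x + g x - (h x + k x))) < e" using h(3) k(3) by simp
  moreover have "continuous_on UNIV (\<lambda>x. h x + k x)" using h k by (intro continuous_intros)
  moreover have "norm (h x + k x) \<le> B + B'" for x
    using norm_triangle_ineq[of "h x" "k x"] h(2)[of x] k(2)[of x] by simp
  ultimately show "\<exists>h B. continuous_on UNIV h \<and> (\<forall>x. norm (h x) \<le> B) \<and> (LINT x|M. norm (f x + g x - h x)) < e"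
    by (intro exI[of _ "\<lambda>x. h x + k x"] exI[of _ "B + B'"]) auto
qed

text \<open>Induction over the Dynkin system generated by the open sets, which are closed under
  intersection. The functions from \<open>cozero\<close> start the induction in place of Urysohn
  functions.\<close>

lemma L1_approximable_indicator:
  fixes M :: "'a::topological_space measure"
  assumes cozero: "\<And>U :: 'a set. open U \<Longrightarrow> \<exists>h :: 'a \<Rightarrow> real. continuous_on UNIV h \<and> U = {x. h x \<noteq> 0}"
    and M: "sets M = sets borel" "finite_measure M" and B: "B \<in> sets borel"
  shows "L1_approximable M (indicator B :: 'a \<Rightarrow> real)"
proof -
  interpret M: finite_measure M by fact
  have ind: "integrable M (indicator A :: 'a \<Rightarrow> real)" if "A \<in> sets borel" for A
    using that M(1) by (simp add: M.emeasure_finite less_top[symmetric])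
  have lim: "(\<lambda>n. LINT x|M. norm (indicator A x - g n x)) \<longlonglongrightarrow> 0"
    if "A \<in> sets borel" "\<And>n. g n \<in> borel_measurable borel" "\<And>n x. 0 \<le> g n x \<and> g n x \<le> 1"
      "\<And>x. (\<lambda>n. g n x) \<longlonglongrightarrow> indicator A x" for A and g :: "nat \<Rightarrow> 'a \<Rightarrow> real"
  proof -
    have "(\<lambda>n. LINT x|M. norm (indicator A x - g n x)) \<longlonglongrightarrow> (LINT x|M. 0)"
    proof (rule integral_dominated_convergence[where w = "\<lambda>x. 1"])
      fix n
      have "g n \<in> borel_measurable M" using that(2) M(1) by (simp cong: measurable_cong_sets)
      moreover have "(indicator A :: 'a \<Rightarrow> real) \<in> borel_measurable M" using that(1) M(1) by simp
      ultimately show "(\<lambda>x. norm (indicator A x - g n x)) \<in> borel_measurable M" by measurable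
      have "norm (norm (indicator A x - g n x)) \<le> 1" for x
        using that(3)[of n x] by (auto simp: indicator_def)
      then show "AE x in M. norm (norm (indicator A x - g n x)) \<le> 1" by simp
    next
      have "(\<lambda>n. norm (indicator A x - g n x)) \<longlonglongrightarrow> norm (indicator A x - indicator A x :: real)" for x
        by (intro tendsto_intros that(4))
      then show "AE x in M. (\<lambda>n. norm (indicator A x - g n x)) \<longlonglongrightarrow> 0" by simp
    qed auto
    then show ?thesis by simp
  qed
  have B': "B \<in> sigma_sets UNIV {U. open U}" using B by (simp add: borel_def)
  have sb: "sigma_sets UNIV {U. open U} = sets (borel :: 'a measure)" by (simp add: borel_def)
  have "Int_stable {U :: 'a set. open U}" by (auto simp: Int_stable_def)
  moreover have "{U :: 'a set. open U} \<subseteq> Pow UNIV" by simp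
  ultimately show ?thesis using B'
  proof (induction rule: sigma_sets_induct_disjoint)
    case (basic U)
    then have U: "open U" by simp
    then obtain u :: "'a \<Rightarrow> real" where u: "continuous_on UNIV u" "U = {x. u x \<noteq> 0}" using cozero by blast
    \<comment> \<open>These functions increase to the indicator of the nonzero set of
      \<open>u\<close>, which is \<open>U\<close>.\<close>
    define g where "g n x = min 1 (real n * \<bar>u x\<bar>)" for n x
    have g: "continuous_on UNIV (g n)" "0 \<le> g n x \<and> g n x \<le> 1" for n x
      unfolding g_def using u(1) by (auto intro!: continuous_intros)
    have gl: "(\<lambda>n. g n x) \<longlonglongrightarrow> indicator U x" for x
    proof (cases "u x = 0")
      case True then show ?thesis by (simp add: g_def u(2))
    next
      case False
      obtain N where "real N > 1 / \<bar>u x\<bar>" using reals_Archimedean2 by blast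
      then have N: "1 \<le> real N * \<bar>u x\<bar>" using False by (simp add: field_simps)
      have "g n x = 1" if "n \<ge> N" for n
        using order_trans[OF N mult_right_mono[of "real N" "real n" "\<bar>u x\<bar>"]] that by (simp add: g_def)
      then have "\<forall>\<^sub>F n in sequentially. g n x = 1" by (auto simp: eventually_sequentially)
      then show ?thesis using False by (simp add: u(2) tendsto_eventually)
    qed
    have bU: "U \<in> sets borel" using U by simp
    show ?case
    proof (rule L1_approximable_limit[OF M ind[OF bU]])
      show "integrable M (g n)" for n
        by (rule integrable_continuous_bounded[OF M g(1), of _ 1]) (use g(2) in auto)
      show "L1_approximable M (g n)" for n unfolding L1_approximable_def
        by (intro allI impI exI[of _ "g n"] exI[of _ 1]) (use g in auto)
      show "(\<lambda>n. LINT x|M. norm (indicator U x - g n x)) \<longlonglongrightarrow> 0"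
        by (intro lim bU g gl borel_measurable_continuous_onI)
    qed
  next
    case empty
    then show ?case unfolding L1_approximable_def
      by (intro allI impI exI[of _ "\<lambda>x. 0"] exI[of _ 0]) auto
  next
    case (compl A)
    then have A: "A \<in> sets borel" by (simp add: sb)
    show ?case unfolding L1_approximable_def
    proof (intro allI impI)
      fix e :: real assume "e > 0"
      then obtain h :: "'a \<Rightarrow> real" and B where h: "continuous_on UNIV h" "\<And>x. norm (h x) \<le> B" "(LINT x|M. norm (indicator A x - h x)) < e"
        using compl(2) unfolding L1_approximable_def by blast
      have "norm (indicator (UNIV - A) x - (1 - h x)) = norm (indicator A x - h x)" for x
        by (simp add: indicator_def abs_minus_commute)
      moreover have "continuous_on UNIV (\<lambda>x. 1 - h x)" using h(1) by (intro continuous_intros)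
      moreover have "norm (1 - h x) \<le> 1 + B" for x using h(2)[of x] norm_triangle_ineq4[of 1 "h x"] by simp
      ultimately show "\<exists>h B. continuous_on UNIV h \<and> (\<forall>x. norm (h x) \<le> B) \<and>
          (LINT x|M. norm ((indicator (UNIV - A) x :: real) - h x)) < e"
        using h(3) by (intro exI[of _ "\<lambda>x. 1 - h x"] exI[of _ "1 + B"]) auto
    qed
  next
    case (union A)
    then have A: "A i \<in> sets borel" for i using sb by blast
    have AU: "(\<Union>i. A i) \<in> sets borel" using A by blast
    \<comment> \<open>For disjoint sets the indicator of a finite union is the sum of the
      indicators, so closure under addition applies.\<close>
    define g where "g n x = (\<Sum>i<n. indicator (A i) x :: real)" for n x
    have gi: "g n x = indicator (\<Union>i<n. A i) x" for n x
      unfolding g_def using union(1)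
      by (subst indicator_UN_disjoint) (auto intro: disjoint_family_on_mono)
    show ?case
    proof (rule L1_approximable_limit[OF M ind[OF AU]])
      show "integrable M (g n)" for n unfolding g_def using ind[OF A] by simp
      show "L1_approximable M (g n)" for n
      proof (induction n)
        case 0 then show ?case unfolding L1_approximable_def g_def
          by (intro allI impI exI[of _ "\<lambda>x. 0"] exI[of _ 0]) auto
      next
        case (Suc n)
        have "integrable M (g n)" unfolding g_def using ind[OF A] by simp
        from L1_approximable_add[OF M this ind[OF A] Suc union(3)] show ?case by (simp add: g_def)
      qed
      show "(\<lambda>n. LINT x|M. norm (indicator (\<Union>i. A i) x - g n x)) \<longlonglongrightarrow> 0"
      proof (rule lim[OF AU])
        show "g n \<in> borel_measurable borel" for n unfolding g_def using A by measurable
        show "0 \<le> g n x \<and> g n x \<le> 1" for n x unfolding gi by simp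
        show "(\<lambda>n. g n x) \<longlonglongrightarrow> indicator (\<Union>i. A i) x" for x
          unfolding gi by (rule LIMSEQ_indicator_UN)
      qed
    qed
  qed
qed

lemma L1_approximable_integrable:
  fixes f :: "'a::topological_space \<Rightarrow> 'b::{banach, second_countable_topology}"
  assumes cozero: "\<And>U :: 'a set. open U \<Longrightarrow> \<exists>h :: 'a \<Rightarrow> real. continuous_on UNIV h \<and> U = {x. h x \<noteq> 0}"
    and M: "sets M = sets borel" "finite_measure M" and f: "integrable M f"
  shows "L1_approximable M f"
  using f
proof (induction rule: integrable_induct)
  case (base A c)
  show ?case unfolding L1_approximable_def
  proof (intro allI impI)
    fix e :: real assume e: "e > 0"
    have pos: "norm c + 1 > 0" by (simp add: add_nonneg_pos)
    have "L1_approximable M (indicator A :: 'a \<Rightarrow> real)"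
      using L1_approximable_indicator[OF cozero M] base(1) M(1) by simp
    moreover have "e / (norm c + 1) > 0" using e pos by simp
    ultimately obtain h :: "'a \<Rightarrow> real" and B where h: "continuous_on UNIV h" "\<And>x. norm (h x) \<le> B"
      "(LINT x|M. norm (indicator A x - h x)) < e / (norm c + 1)"
      unfolding L1_approximable_def by blast
    have "(LINT x|M. norm (indicator A x *\<^sub>R c - h x *\<^sub>R c)) = (LINT x|M. norm (indicator A x - h x)) * norm c"
      by (simp flip: scaleR_diff_left)
    also have "\<dots> \<le> (LINT x|M. norm (indicator A x - h x)) * (norm c + 1)"
      by (intro mult_left_mono) (auto intro!: Bochner_Integration.integral_nonneg)
    also have "\<dots> < e" using h(3) pos by (simp add: pos_less_divide_eq)
    finally have "(LINT x|M. norm (indicator A x *\<^sub>R c - h x *\<^sub>R c)) < e" .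
    moreover have "continuous_on UNIV (\<lambda>x. h x *\<^sub>R c)" using h(1) by (intro continuous_intros)
    moreover have "norm (h x *\<^sub>R c) \<le> B * norm c" for x using h(2)[of x] by (simp add: mult_right_mono)
    ultimately show "\<exists>h B. continuous_on UNIV h \<and> (\<forall>x. norm (h x) \<le> B) \<and>
        (LINT x|M. norm (indicator A x *\<^sub>R c - h x)) < e" by blast
  qed
next
  case (add f g)
  then show ?case by (intro L1_approximable_add[OF M])
next
  case (lim f s)
  have s: "integrable M (s i)" "L1_approximable M (s i)" for i using lim by blast+
  have f: "integrable M f" using lim by blast
  have s_lim: "(\<lambda>i. s i x) \<longlonglongrightarrow> f x" if "x \<in> space M" for x using lim that by blast
  have s_bd: "norm (s i x) \<le> 2 * norm (f x)" if "x \<in> space M" for i x using lim that by blast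
  have "(\<lambda>n. LINT x|M. norm (f x - s n x)) \<longlonglongrightarrow> (LINT x|M. 0)"
  proof (rule integral_dominated_convergence[where w = "\<lambda>x. 3 * norm (f x)"])
    show "integrable M (\<lambda>x. 3 * norm (f x))" using f by simp
    show "(\<lambda>x. norm (f x - s n x)) \<in> borel_measurable M" for n using s(1)[of n] f by simp
    show "AE x in M. (\<lambda>n. norm (f x - s n x)) \<longlonglongrightarrow> 0"
    proof (rule AE_I2)
      fix x assume "x \<in> space M"
      from s_lim[OF this] have "(\<lambda>n. norm (f x - s n x)) \<longlonglongrightarrow> norm (f x - f x)" by (intro tendsto_intros)
      then show "(\<lambda>n. norm (f x - s n x)) \<longlonglongrightarrow> 0" by simp
    qed
    show "AE x in M. norm (norm (f x - s n x)) \<le> 3 * norm (f x)" for n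
    proof (rule AE_I2)
      fix x assume "x \<in> space M"
      from s_bd[OF this, of n] show "norm (norm (f x - s n x)) \<le> 3 * norm (f x)"
        using norm_triangle_ineq4[of "f x" "s n x"] by simp
    qed
  qed simp
  then show ?case using L1_approximable_limit[OF M f s] by simp
qed

section \<open>Hermitian forms\<close>

definition herm :: "real ^ 'n ^ 'n::finite \<Rightarrow> complex ^ 'n \<Rightarrow> complex ^ 'n \<Rightarrow> complex" where
  "herm G v w = (\<Sum>i\<in>UNIV. \<Sum>j\<in>UNIV. of_real (G $ i $ j) * cnj (v $ i) * w $ j)"

definition posdef :: "real ^ 'n ^ 'n::finite \<Rightarrow> bool" where
  "posdef G \<longleftrightarrow> transpose G = G \<and> (\<forall>v. v \<noteq> 0 \<longrightarrow> v \<bullet> (G *v v) > 0)"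

lemma herm_add_right: "herm G v (w + w') = herm G v w + herm G v w'"
  by (simp add: herm_def algebra_simps sum.distrib)

lemma herm_add_left: "herm G (v + v') w = herm G v w + herm G v' w"
  by (simp add: herm_def algebra_simps sum.distrib)

lemma herm_scale_right: "herm G v (a *s w) = a * herm G v w"
  by (simp add: herm_def sum_distrib_left algebra_simps)

lemma herm_scale_left: "herm G (a *s v) w = cnj a * herm G v w"
  by (simp add: herm_def sum_distrib_left algebra_simps)

lemma herm_cnj:
  assumes "transpose G = G"
  shows "cnj (herm G v w) = herm G w v"
proof -
  have G: "G $ i $ j = G $ j $ i" for i j
    using assms by (metis transpose_def vec_lambda_beta)
  have "cnj (herm G v w) = (\<Sum>i\<in>UNIV. \<Sum>j\<in>UNIV. of_real (G $ j $ i) * cnj (w $ j) * v $ i)"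
    unfolding herm_def cnj_sum by (intro sum.cong refl) (subst G, simp add: algebra_simps)
  also have "\<dots> = herm G w v" unfolding herm_def by (rule sum.swap)
  finally show ?thesis .
qed

text \<open>On the diagonal a real symmetric form on the complexification decouples into the real
  and the imaginary part of the vector. Positivity and definiteness thus pass from the real metric
  to \<open>herm\<close>.\<close>

lemma herm_self:
  assumes "transpose G = G"
  shows "herm G v v = of_real ((\<chi> i. Re (v $ i)) \<bullet> (G *v (\<chi> i. Re (v $ i))) + (\<chi> i. Im (v $ i)) \<bullet> (G *v (\<chi> i. Im (v $ i))))"
proof (rule complex_eqI)
  show "Im (herm G v v) = Im (of_real ((\<chi> i. Re (v $ i)) \<bullet> (G *v (\<chi> i. Re (v $ i))) + (\<chi> i. Im (v $ i)) \<bullet> (G *v (\<chi> i. Im (v $ i)))))"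
    using herm_cnj[OF assms, of v v] by (metis Im_complex_of_real complex_cnj_complex_of_real Reals_cnj_iff complex_is_Real_iff)
  show "Re (herm G v v) = Re (of_real ((\<chi> i. Re (v $ i)) \<bullet> (G *v (\<chi> i. Re (v $ i))) + (\<chi> i. Im (v $ i)) \<bullet> (G *v (\<chi> i. Im (v $ i)))))"
    unfolding herm_def
    by (simp add: inner_vec_def matrix_vector_mult_def sum_distrib_left algebra_simps flip: sum.distrib)
qed

lemma posdef_ge: "posdef G \<Longrightarrow> 0 \<le> v \<bullet> (G *v v)"
  unfolding posdef_def by (cases "v = 0") (auto simp: less_imp_le)

lemma herm_self_real: "posdef G \<Longrightarrow> herm G v v = of_real (Re (herm G v v))"
  using herm_self[of G v] by (simp add: posdef_def)

lemma herm_self_nonneg: "posdef G \<Longrightarrow> 0 \<le> Re (herm G v v)"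
  using herm_self[of G v] posdef_ge[of G] by (simp add: posdef_def)

lemma herm_self_eq_0:
  assumes "posdef G" "Re (herm G v v) = 0"
  shows "v = 0"
proof -
  let ?a = "\<chi> i. Re (v $ i)" and ?b = "\<chi> i. Im (v $ i)"
  have "?a \<bullet> (G *v ?a) + ?b \<bullet> (G *v ?b) = 0"
    using assms herm_self[of G v] by (simp add: posdef_def)
  then have "?a \<bullet> (G *v ?a) = 0" "?b \<bullet> (G *v ?b) = 0"
    using posdef_ge[OF assms(1), of ?a] posdef_ge[OF assms(1), of ?b] by linarith+
  then have "?a = 0" "?b = 0" using assms(1) unfolding posdef_def by (metis less_irrefl)+
  then show ?thesis by (auto simp: vec_eq_iff complex_eq_iff)
qed

definition hnorm :: "real ^ 'n ^ 'n::finite \<Rightarrow> complex ^ 'n \<Rightarrow> real" where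
  "hnorm G v = sqrt (Re (herm G v v))"

lemma hnorm_sq: "posdef G \<Longrightarrow> (hnorm G v)\<^sup>2 = Re (herm G v v)"
  by (simp add: hnorm_def herm_self_nonneg)

lemma hnorm_scale: "posdef G \<Longrightarrow> hnorm G (a *s v) = cmod a * hnorm G v"
proof -
  assume "posdef G"
  have "herm G (a *s v) (a *s v) = of_real ((cmod a)\<^sup>2) * herm G v v"
    unfolding complex_norm_square by (simp add: herm_scale_left herm_scale_right algebra_simps)
  then show ?thesis by (simp add: hnorm_def real_sqrt_mult)
qed

text \<open>Positivity at \<open>v + t *s w\<close> with \<open>t\<close> opposite in phase to the
  inner product leaves a real quadratic in \<open>s\<close>, whose minimum is at
  \<open>s = 1 / q\<close> when \<open>q > 0\<close>.\<close>

lemma herm_cauchy_schwarz: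
  assumes G: "posdef G"
  shows "cmod (herm G v w) \<le> hnorm G v * hnorm G w"
proof -
  define p q z where "p = Re (herm G v v)" and "q = Re (herm G w w)" and "z = herm G v w"
  have pq: "p \<ge> 0" "q \<ge> 0" unfolding p_def q_def using herm_self_nonneg[OF G] by auto
  have sym: "herm G w v = cnj z" using herm_cnj[of G v w] G by (simp add: posdef_def z_def)
  have key: "0 \<le> p - 2 * s * (cmod z)\<^sup>2 + s\<^sup>2 * (cmod z)\<^sup>2 * q" for s :: real
  proof -
    define t where "t = - of_real s * cnj z"
    have "herm G (v + t *s w) (v + t *s w) =
      herm G v v + t * z + cnj t * cnj z + t * cnj t * herm G w w"
      by (simp add: herm_add_left herm_add_right herm_scale_left herm_scale_right sym z_def algebra_simps)
    also have "\<dots> = of_real p - 2 * of_real s * (z * cnj z) + (of_real s)\<^sup>2 * (z * cnj z) * of_real q"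
      using herm_self_real[OF G, of v] herm_self_real[OF G, of w]
      unfolding p_def q_def t_def by (simp add: algebra_simps power2_eq_square)
    also have "\<dots> = of_real (p - 2 * s * (cmod z)\<^sup>2 + s\<^sup>2 * (cmod z)\<^sup>2 * q)"
      unfolding complex_norm_square[symmetric] by simp
    finally show ?thesis using herm_self_nonneg[OF G, of "v + t *s w"] by simp
  qed
  have "(cmod z)\<^sup>2 \<le> p * q"
  proof (cases "q = 0")
    case True
    have "(cmod z)\<^sup>2 = 0"
    proof (rule ccontr)
      assume ne: "(cmod z)\<^sup>2 \<noteq> 0"
      \<comment> \<open>If \<open>q = 0\<close>, the quadratic is affine in \<open>s\<close>, and
        this \<open>s\<close> gives it the value \<open>-1\<close>.\<close>
      then show False using key[of "(p + 1) / (2 * (cmod z)\<^sup>2)"] True by simp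
    qed
    then show ?thesis using True by simp
  next
    case False
    then have "q > 0" using pq by simp
    then show ?thesis using key[of "1 / q"] by (simp add: field_simps power2_eq_square)
  qed
  then have "(cmod z)\<^sup>2 \<le> (hnorm G v * hnorm G w)\<^sup>2"
    by (simp add: power_mult_distrib hnorm_sq[OF G] p_def q_def)
  then show ?thesis unfolding z_def
    by (rule power2_le_imp_le) (simp add: hnorm_def herm_self_nonneg[OF G])
qed

lemma hnorm_triangle:
  assumes G: "posdef G"
  shows "hnorm G (v + w) \<le> hnorm G v + hnorm G w"
proof (rule power2_le_imp_le)
  have "Re (herm G (v + w) (v + w)) = Re (herm G v v) + Re (herm G w w) + Re (herm G v w) + Re (herm G w v)"
    by (simp add: herm_add_left herm_add_right)
  moreover have "Re (herm G v w) \<le> hnorm G v * hnorm G w" "Re (herm G w v) \<le> hnorm G v * hnorm G w"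
    using herm_cauchy_schwarz[OF G, of v w] herm_cauchy_schwarz[OF G, of w v]
      complex_Re_le_cmod[of "herm G v w"] complex_Re_le_cmod[of "herm G w v"] by (auto simp: mult.commute)
  ultimately show "(hnorm G (v + w))\<^sup>2 \<le> (hnorm G v + hnorm G w)\<^sup>2"
    by (simp add: hnorm_sq[OF G] power2_sum)
qed (simp add: hnorm_def herm_self_nonneg[OF G])

section \<open>Inverse metrics and their behaviour under changes of coordinates\<close>

lemma matrix_inv_mult:
  fixes G :: "real ^ 'n ^ 'n::finite"
  assumes "invertible G"
  shows "G ** matrix_inv G = mat 1" "matrix_inv G ** G = mat 1"
proof -
  have "\<exists>B. G ** B = mat 1 \<and> B ** G = mat 1" using assms by (simp add: invertible_def)
  from someI_ex[OF this] show "G ** matrix_inv G = mat 1" "matrix_inv G ** G = mat 1"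
    unfolding matrix_inv_def by auto
qed

lemma matrix_inv_unique:
  fixes G :: "real ^ 'n ^ 'n::finite"
  assumes "G ** B = mat 1"
  shows "invertible G" "matrix_inv G = B"
proof -
  have B: "B ** G = mat 1" using assms by (simp add: matrix_left_right_inverse)
  show inv: "invertible G" using assms B invertible_def by blast
  have "matrix_inv G = matrix_inv G ** (G ** B)" by (simp add: assms)
  also have "\<dots> = B" by (simp add: matrix_mul_assoc matrix_inv_mult[OF inv])
  finally show "matrix_inv G = B" .
qed

lemma posdef_invertible:
  assumes "posdef G"
  shows "invertible G"
proof -
  have "v = 0" if "G *v v = 0" for v
    using assms that unfolding posdef_def by (metis inner_zero_right less_irrefl)
  then obtain B where "B ** G = mat 1" using matrix_left_invertible_ker[of G] by blast
  then show ?thesis using invertible_def matrix_left_right_inverse by blast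
qed

text \<open>The substitution \<open>v = G *v u\<close> carries the quadratic form of the inverse at
  \<open>v\<close> to that of \<open>G\<close> at \<open>u\<close>.\<close>

lemma posdef_inverse:
  assumes "posdef G"
  shows "posdef (matrix_inv G)"
proof -
  note inv = matrix_inv_mult[OF posdef_invertible[OF assms]]
  have "G ** transpose (matrix_inv G) = transpose (matrix_inv G ** G)"
    using assms by (simp add: matrix_transpose_mul posdef_def)
  then have "G ** transpose (matrix_inv G) = mat 1" by (simp add: inv transpose_mat)
  then have "transpose (matrix_inv G) = matrix_inv G" using matrix_inv_unique(2) by metis
  moreover have "v \<bullet> (matrix_inv G *v v) > 0" if "v \<noteq> 0" for v
  proof -
    define u where "u = matrix_inv G *v v"
    have v: "v = G *v u" by (simp add: u_def matrix_vector_mul_assoc inv)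
    then have "u \<noteq> 0" using that by auto
    then have "u \<bullet> (G *v u) > 0" using assms by (simp add: posdef_def)
    then show ?thesis by (simp add: inner_commute flip: u_def v)
  qed
  ultimately show ?thesis by (simp add: posdef_def)
qed

text \<open>Pulling covectors back by \<open>J\<close> conjugates the matrix of the form. The long
  chain only reorders a fourfold sum.\<close>

lemma herm_change:
  "herm H (\<chi> i. \<Sum>j\<in>UNIV. of_real (J $ j $ i) * v $ j) (\<chi> i. \<Sum>j\<in>UNIV. of_real (J $ j $ i) * w $ j) =
   herm (J ** H ** transpose J) v w" (is "?l = ?r")
proof -
  let ?t = "\<lambda>i j a b. of_real (H $ i $ j) * (of_real (J $ a $ i) * cnj (v $ a)) * (of_real (J $ b $ j) * w $ b)"
  have "?r = (\<Sum>a\<in>UNIV. \<Sum>b\<in>UNIV. \<Sum>j\<in>UNIV. \<Sum>i\<in>UNIV. ?t i j a b)"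
    unfolding herm_def matrix_matrix_mult_def transpose_def
    by (simp add: sum_distrib_left sum_distrib_right algebra_simps)
  also have "\<dots> = (\<Sum>a\<in>UNIV. \<Sum>b\<in>UNIV. \<Sum>i\<in>UNIV. \<Sum>j\<in>UNIV. ?t i j a b)"
    by (rule sum.cong[OF refl], rule sum.cong[OF refl], rule sum.swap)
  also have "\<dots> = (\<Sum>a\<in>UNIV. \<Sum>i\<in>UNIV. \<Sum>b\<in>UNIV. \<Sum>j\<in>UNIV. ?t i j a b)"
    by (rule sum.cong[OF refl], rule sum.swap)
  also have "\<dots> = (\<Sum>i\<in>UNIV. \<Sum>a\<in>UNIV. \<Sum>b\<in>UNIV. \<Sum>j\<in>UNIV. ?t i j a b)"
    by (rule sum.swap)
  also have "\<dots> = (\<Sum>i\<in>UNIV. \<Sum>a\<in>UNIV. \<Sum>j\<in>UNIV. \<Sum>b\<in>UNIV. ?t i j a b)"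
    by (rule sum.cong[OF refl], rule sum.cong[OF refl], rule sum.swap)
  also have "\<dots> = (\<Sum>i\<in>UNIV. \<Sum>j\<in>UNIV. \<Sum>a\<in>UNIV. \<Sum>b\<in>UNIV. ?t i j a b)"
    by (rule sum.cong[OF refl], rule sum.swap)
  also have "\<dots> = (\<Sum>i\<in>UNIV. \<Sum>j\<in>UNIV. \<Sum>b\<in>UNIV. \<Sum>a\<in>UNIV. ?t i j a b)"
    by (rule sum.cong[OF refl], rule sum.cong[OF refl], rule sum.swap)
  also have "\<dots> = ?l"
    unfolding herm_def by (simp add: sum_distrib_left sum_distrib_right)
  finally show ?thesis by simp
qed

text \<open>If the metric transforms by \<open>J\<close> as a form on tangent vectors, its inverse
  transforms the opposite way. With \<open>herm_change\<close> this makes the inner product of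
  covectors independent of the chart.\<close>

lemma herm_inverse_change:
  fixes G H J :: "real ^ 'n ^ 'n::finite"
  assumes G: "posdef G" and H: "posdef H" and J: "invertible J" and GH: "G = transpose J ** H ** J"
  shows "J ** matrix_inv G ** transpose J = matrix_inv H"
proof -
  let ?P = "J ** matrix_inv G ** transpose J" and ?K = "transpose (matrix_inv J)"
  have K: "?K ** transpose J = mat 1"
    by (simp add: matrix_inv_mult[OF J] transpose_mat flip: matrix_transpose_mul)
  have "transpose J ** H ** ?P = (transpose J ** H ** J) ** matrix_inv G ** transpose J"
    by (simp add: matrix_mul_assoc)
  also have "\<dots> = transpose J"
    by (simp add: matrix_inv_mult[OF posdef_invertible[OF G]] flip: GH)
  finally have "?K ** (transpose J ** H ** ?P) = mat 1" using K by simp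
  then have "(?K ** transpose J) ** H ** ?P = mat 1" by (simp add: matrix_mul_assoc)
  then have "H ** ?P = mat 1" by (simp add: K)
  then show ?thesis using matrix_inv_unique(2) by metis
qed

text \<open>Column \<open>k\<close> of \<open>G\<close> is the metric dual of the
  \<open>k\<close>-th coordinate vector, so pairing with it reads off a component. The coframes are
  built from these columns.\<close>

lemma herm_dual:
  assumes G: "posdef G"
  shows "herm (matrix_inv G) (\<chi> i. of_real (G $ i $ k)) w = w $ k"
proof -
  have sym: "G $ i $ j = G $ j $ i" for i j
    using G unfolding posdef_def by (metis transpose_def vec_lambda_beta)
  have eq: "(\<Sum>i\<in>UNIV. G $ k $ i * matrix_inv G $ i $ j) = (if j = k then 1 else 0)" for j
    using matrix_inv_mult(1)[OF posdef_invertible[OF G]]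
    by (auto simp: matrix_matrix_mult_def mat_def vec_eq_iff)
  have "herm (matrix_inv G) (\<chi> i. of_real (G $ i $ k)) w =
    (\<Sum>j\<in>UNIV. \<Sum>i\<in>UNIV. of_real (G $ k $ i * matrix_inv G $ i $ j) * w $ j)"
    unfolding herm_def by (subst sum.swap) (simp add: sym[of _ k] algebra_simps)
  also have "\<dots> = (\<Sum>j\<in>UNIV. of_real (\<Sum>i\<in>UNIV. G $ k $ i * matrix_inv G $ i $ j) * w $ j)"
    by (simp add: sum_distrib_right)
  also have "\<dots> = w $ k" unfolding eq by (simp add: if_distrib if_distribR cong: if_cong)
  finally show ?thesis .
qed

lemma continuous_on_det:
  fixes A :: "'a::topological_space \<Rightarrow> real ^ 'n ^ 'n::finite"
  assumes "\<And>i j. continuous_on S (\<lambda>x. A x $ i $ j)"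
  shows "continuous_on S (\<lambda>x. det (A x))"
  unfolding det_def by (intro continuous_intros assms)

text \<open>By Cramer's rule each entry is a quotient of determinants, which are polynomials in the
  entries of \<open>G\<close>.\<close>

lemma continuous_on_matrix_inv:
  fixes G :: "'a::topological_space \<Rightarrow> real ^ 'n ^ 'n::finite"
  assumes G: "continuous_on S G" and inv: "\<And>x. x \<in> S \<Longrightarrow> invertible (G x)"
  shows "continuous_on S (\<lambda>x. matrix_inv (G x) $ k $ l)"
proof -
  have c: "continuous_on S (\<lambda>x. G x $ i $ j)" for i j using G by (intro continuous_intros)
  let ?b = "axis l 1 :: real ^ 'n"
  have d: "det (G x) \<noteq> 0" if "x \<in> S" for x using inv[OF that] invertible_det_nz by blast
  have eq: "matrix_inv (G x) $ k $ l = det (\<chi> i j. if j = k then ?b $ i else G x $ i $ j) / det (G x)"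
    if "x \<in> S" for x
  proof -
    have "G x *v (matrix_inv (G x) *v ?b) = ?b"
      by (simp add: matrix_vector_mul_assoc matrix_inv_mult[OF inv[OF that]])
    then have "matrix_inv (G x) *v ?b = (\<chi> k. det (\<chi> i j. if j = k then ?b $ i else G x $ i $ j) / det (G x))"
      using cramer[OF d[OF that]] by blast
    then have "(matrix_inv (G x) *v ?b) $ k = det (\<chi> i j. if j = k then ?b $ i else G x $ i $ j) / det (G x)"
      by simp
    moreover have "(matrix_inv (G x) *v ?b) $ k = matrix_inv (G x) $ k $ l"
      by (simp add: matrix_vector_mult_basis column_def)
    ultimately show ?thesis by simp
  qed
  have "continuous_on S (\<lambda>x. det (\<chi> i j. if j = k then ?b $ i else G x $ i $ j) / det (G x))"
  proof (intro continuous_on_divide continuous_on_det)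
    fix i j show "continuous_on S (\<lambda>x. (\<chi> i j. if j = k then ?b $ i else G x $ i $ j) $ i $ j)"
      by (cases "j = k") (auto intro: c)
  qed (use c d in auto)
  then show ?thesis by (rule continuous_on_eq) (simp add: eq)
qed

section \<open>Covectors\<close>

locale riemannian =
  fixes A :: "('m::{t2_space, second_countable_topology}, 'n::finite) chart set"
    and g :: "('m, 'n) metric_field"
  assumes riemannian: "riemannian_manifold A g"
begin

abbreviation ip :: "'m \<Rightarrow> ('m, 'n) covector \<Rightarrow> ('m, 'n) covector \<Rightarrow> complex" where
  "ip \<equiv> cov_inner A g"

abbreviation nm :: "'m \<Rightarrow> ('m, 'n) covector \<Rightarrow> real" where
  "nm \<equiv> cov_norm A g"

abbreviation C0 :: "('m, 'n) form set" where
  "C0 \<equiv> C0_forms A g"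

lemma atlas: "smooth_atlas A" and metric: "riemannian_metric A g"
  using riemannian by (auto simp: riemannian_manifold_def)

lemma chart:
  assumes "c \<in> A"
  shows "open (chart_dom c)" "open (chart_img c)" "continuous_on (chart_dom c) (chart_map c)"
    "continuous_on (chart_img c) (chart_inv c)"
    "x \<in> chart_dom c \<Longrightarrow> chart_inv c (chart_map c x) = x"
    "y \<in> chart_img c \<Longrightarrow> chart_map c (chart_inv c y) = y"
    "y \<in> chart_img c \<Longrightarrow> chart_inv c y \<in> chart_dom c"
  using assms atlas by (auto simp: smooth_atlas_def is_chart_def homeomorphism_def)

lemma open_chart_image:
  assumes "c \<in> A" "open U" "U \<subseteq> chart_dom c"
  shows "open (chart_map c ` U)"
proof -
  have "chart_map c ` U = chart_img c \<inter> chart_inv c -` U"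
    using chart[OF assms(1)] assms(3) by (force simp: image_iff)
  moreover have "open (chart_img c \<inter> chart_inv c -` U)"
    using chart(2,4)[OF assms(1)] assms(2) by (metis Int_commute continuous_on_open_vimage)
  ultimately show ?thesis by simp
qed

lemma chart_at: "chart_at A x \<in> A" "x \<in> chart_dom (chart_at A x)"
proof -
  have "\<exists>c. c \<in> A \<and> x \<in> chart_dom c" using atlas unfolding smooth_atlas_def by blast
  from someI_ex[OF this] show "chart_at A x \<in> A" "x \<in> chart_dom (chart_at A x)"
    unfolding chart_at_def by auto
qed

section \<open>Transition maps and their Jacobians\<close>

lemma transition:
  assumes "c \<in> A" "d \<in> A"
  defines "U \<equiv> chart_map c ` (chart_dom c \<inter> chart_dom d)"
  shows "open U" "y \<in> U \<Longrightarrow> (chart_map d \<circ> chart_inv c) differentiable (at y)"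
    "continuous_on U (\<lambda>y. frechet_derivative (chart_map d \<circ> chart_inv c) (at y) v)"
proof -
  show "open U" unfolding U_def
    by (intro open_chart_image open_Int chart(1) assms(1,2)) auto
  have "smooth_on U (chart_map d \<circ> chart_inv c)"
    using atlas assms(1,2) unfolding smooth_atlas_def U_def by blast
  then have "Ck_on (Suc 0) U (chart_map d \<circ> chart_inv c)" unfolding smooth_on_def by blast
  then show "y \<in> U \<Longrightarrow> (chart_map d \<circ> chart_inv c) differentiable (at y)"
    "continuous_on U (\<lambda>y. frechet_derivative (chart_map d \<circ> chart_inv c) (at y) v)"
    by auto
qed

lemma jac_chain:
  assumes A: "c \<in> A" "d \<in> A" "e \<in> A" and x: "x \<in> chart_dom c" "x \<in> chart_dom d" "x \<in> chart_dom e"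
  shows "jac c e x = jac d e x ** jac c d x"
proof -
  define y where "y = chart_map c x"
  define z where "z = chart_map d x"
  let ?f = "chart_map d \<circ> chart_inv c" and ?h = "chart_map e \<circ> chart_inv d" and ?k = "chart_map e \<circ> chart_inv c"
  have fy: "?f y = z" using chart(5)[OF A(1)] x by (simp add: y_def z_def)
  have "y \<in> chart_map c ` (chart_dom c \<inter> chart_dom d)" using x by (auto simp: y_def)
  from transition(2)[OF A(1,2) this] have df: "(?f has_derivative frechet_derivative ?f (at y)) (at y)"
    by (simp add: frechet_derivative_works)
  have "z \<in> chart_map d ` (chart_dom d \<inter> chart_dom e)" using x by (auto simp: z_def)
  from transition(2)[OF A(2,3) this] have dh: "(?h has_derivative frechet_derivative ?h (at z)) (at (?f y))"
    unfolding fy by (simp add: frechet_derivative_works)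
  have "(?h \<circ> ?f has_derivative frechet_derivative ?h (at z) \<circ> frechet_derivative ?f (at y)) (at y)"
    by (rule diff_chain_at[OF df dh])
  \<comment> \<open>The composite equals the direct transition map only where
    \<open>chart_inv d\<close> undoes \<open>chart_map d\<close>, so the derivative is transferred
    on an open neighbourhood of \<open>y\<close>.\<close>
  then have dk: "(?k has_derivative frechet_derivative ?h (at z) \<circ> frechet_derivative ?f (at y)) (at y)"
  proof (rule has_derivative_transform_within_open)
    show "open (chart_map c ` (chart_dom c \<inter> chart_dom d))" by (rule transition(1)[OF A(1,2)])
    show "y \<in> chart_map c ` (chart_dom c \<inter> chart_dom d)" using x by (auto simp: y_def)
    fix u assume "u \<in> chart_map c ` (chart_dom c \<inter> chart_dom d)"
    then show "(?h \<circ> ?f) u = ?k u" using chart(5)[OF A(1)] chart(5)[OF A(2)] by auto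
  qed
  have "matrix (frechet_derivative ?k (at y)) = matrix (frechet_derivative ?h (at z) \<circ> frechet_derivative ?f (at y))"
    using frechet_derivative_at[OF dk] by simp
  also have "\<dots> = matrix (frechet_derivative ?h (at z)) ** matrix (frechet_derivative ?f (at y))"
    by (rule matrix_compose[OF has_derivative_linear[OF df] has_derivative_linear[OF dh]])
  finally show ?thesis unfolding jac_def y_def z_def .
qed

lemma jac_self:
  assumes "c \<in> A" "x \<in> chart_dom c"
  shows "jac c c x = mat 1"
proof -
  let ?y = "chart_map c x"
  have "((\<lambda>y. y) has_derivative (\<lambda>y. y)) (at ?y)" by simp
  then have "(chart_map c \<circ> chart_inv c has_derivative (\<lambda>y. y)) (at ?y)"
    by (rule has_derivative_transform_within_open[of _ _ _ _ "chart_img c"])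
       (use chart[OF assms(1)] assms(2) in auto)
  then have "frechet_derivative (chart_map c \<circ> chart_inv c) (at ?y) = (\<lambda>y. y)"
    using frechet_derivative_at by metis
  then show ?thesis using matrix_id_mat_1 unfolding jac_def id_def by simp
qed

lemma jac_inverse:
  assumes "c \<in> A" "d \<in> A" "x \<in> chart_dom c" "x \<in> chart_dom d"
  shows "jac d c x ** jac c d x = mat 1"
  using jac_chain[OF assms(1,2,1,3,4,3)] jac_self[OF assms(1,3)] by simp

lemma continuous_on_jac:
  assumes "c \<in> A" "d \<in> A"
  shows "continuous_on (chart_dom c \<inter> chart_dom d) (\<lambda>x. jac c d x $ j $ i)"
proof -
  let ?U = "chart_dom c \<inter> chart_dom d"
  have "continuous_on ?U (\<lambda>x. frechet_derivative (chart_map d \<circ> chart_inv c) (at (chart_map c x)) (axis i 1) $ j)"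
    by (intro continuous_on_component
          continuous_on_compose2[OF transition(3)[OF assms] continuous_on_subset[OF chart(3)[OF assms(1)]]]) auto
  then show ?thesis by (simp add: jac_def matrix_def)
qed

lemma posdef_metric: "c \<in> A \<Longrightarrow> x \<in> chart_dom c \<Longrightarrow> posdef (g x c)"
  using metric unfolding riemannian_metric_def posdef_def by blast

lemma posdef_chart_at: "posdef (matrix_inv (g x (chart_at A x)))"
  by (intro posdef_inverse posdef_metric chart_at)

lemma continuous_on_metric:
  assumes "c \<in> A"
  shows "continuous_on (chart_dom c) (\<lambda>x. g x c)"
proof -
  have "smooth_on (chart_img c) (\<lambda>y. g (chart_inv c y) c)"
    using metric assms unfolding riemannian_metric_def by blast
  then have "Ck_on 0 (chart_img c) (\<lambda>y. g (chart_inv c y) c)" unfolding smooth_on_def by blast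
  then have "continuous_on (chart_img c) (\<lambda>y. g (chart_inv c y) c)" by simp
  then have "continuous_on (chart_dom c) (\<lambda>x. g (chart_inv c (chart_map c x)) c)"
    by (rule continuous_on_compose2[OF _ chart(3)[OF assms]]) auto
  then show ?thesis by (rule continuous_on_eq) (simp add: chart(5)[OF assms])
qed

section \<open>Cotangent spaces and their Hermitian structure\<close>

lemma cotangent_space_change:
  assumes "\<omega> \<in> cotangent_space A x" "c \<in> A" "d \<in> A" "x \<in> chart_dom c" "x \<in> chart_dom d"
  shows "\<omega> c = (\<chi> i. \<Sum>j\<in>UNIV. of_real (jac c d x $ j $ i) * \<omega> d $ j)"
proof -
  have "\<forall>i. \<omega> c $ i = (\<Sum>j\<in>UNIV. of_real (jac c d x $ j $ i) * \<omega> d $ j)"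
    using assms unfolding cotangent_space_def by blast
  then show ?thesis unfolding vec_eq_iff vec_lambda_beta .
qed

lemma cotangent_space_zero: "\<omega> \<in> cotangent_space A x \<Longrightarrow> \<not> (c \<in> A \<and> x \<in> chart_dom c) \<Longrightarrow> \<omega> c = 0"
  unfolding cotangent_space_def by blast

lemma cotangent_spaceI:
  assumes "\<And>c. \<not> (c \<in> A \<and> x \<in> chart_dom c) \<Longrightarrow> \<omega> c = 0"
    and "\<And>c d i. c \<in> A \<Longrightarrow> d \<in> A \<Longrightarrow> x \<in> chart_dom c \<Longrightarrow> x \<in> chart_dom d \<Longrightarrow>
      \<omega> c $ i = (\<Sum>j\<in>UNIV. of_real (jac c d x $ j $ i) * \<omega> d $ j)"
  shows "\<omega> \<in> cotangent_space A x"
  unfolding cotangent_space_def by (intro CollectI conjI allI ballI impI assms) auto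

text \<open>One chart suffices: the transformation law fixes the components in the other charts
  around \<open>x\<close>, and the remaining ones are normalised to 0.\<close>

lemma cotangent_space_eqI:
  assumes "\<omega> \<in> cotangent_space A x" "\<eta> \<in> cotangent_space A x" "c \<in> A" "x \<in> chart_dom c" "\<omega> c = \<eta> c"
  shows "\<omega> = \<eta>"
proof
  fix d
  show "\<omega> d = \<eta> d"
  proof (cases "d \<in> A \<and> x \<in> chart_dom d")
    case True
    then show ?thesis
      using cotangent_space_change[OF assms(1) _ assms(3) _ assms(4), of d]
        cotangent_space_change[OF assms(2) _ assms(3) _ assms(4), of d] assms(5) by simp
  next
    case False
    then show ?thesis using assms(1,2)[THEN cotangent_space_zero] by simp
  qed
qed

lemma cov_inner_herm: "ip x \<omega> \<eta> =
    herm (matrix_inv (g x (chart_at A x))) (\<omega> (chart_at A x)) (\<eta> (chart_at A x))"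
  by (simp add: cov_inner_def herm_def Let_def)

text \<open>The Jacobians from the components cancel those from the inverse metric. Continuity and
  measurability can therefore be checked in a fixed chart, although \<open>chart_at\<close> varies
  arbitrarily with the point.\<close>

lemma cov_inner_chart:
  assumes \<omega>: "\<omega> \<in> cotangent_space A x" and \<eta>: "\<eta> \<in> cotangent_space A x" and c: "c \<in> A" "x \<in> chart_dom c"
  shows "ip x \<omega> \<eta> = herm (matrix_inv (g x c)) (\<omega> c) (\<eta> c)"
proof -
  let ?d = "chart_at A x"
  have d: "?d \<in> A" "x \<in> chart_dom ?d" by (rule chart_at)+
  let ?J = "jac c ?d x"
  have "g x c = transpose ?J ** g x ?d ** ?J"
    using metric c d unfolding riemannian_metric_def by blast
  moreover have "invertible ?J"
    using jac_inverse[OF c(1) d(1) c(2) d(2)] jac_inverse[OF d(1) c(1) d(2) c(2)] invertible_def by blast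
  ultimately have "?J ** matrix_inv (g x c) ** transpose ?J = matrix_inv (g x ?d)"
    by (intro herm_inverse_change posdef_metric c d)
  then show ?thesis
    unfolding cov_inner_herm cotangent_space_change[OF \<omega> c(1) d(1) c(2) d(2)]
      cotangent_space_change[OF \<eta> c(1) d(1) c(2) d(2)] herm_change by simp
qed

lemma cov_norm_hnorm: "nm x \<omega> = hnorm (matrix_inv (g x (chart_at A x))) (\<omega> (chart_at A x))"
  by (simp add: cov_norm_def hnorm_def cov_inner_herm)

lemma cov_inner_add_right: "ip x \<omega> (\<lambda>c. \<eta> c + \<eta>' c) = ip x \<omega> \<eta> + ip x \<omega> \<eta>'"
  by (simp add: cov_inner_herm herm_add_right)

lemma cov_inner_add_left: "ip x (\<lambda>c. \<omega> c + \<omega>' c) \<eta> = ip x \<omega> \<eta> + ip x \<omega>' \<eta>"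
  by (simp add: cov_inner_herm herm_add_left)

lemma cov_inner_scale_right: "ip x \<omega> (\<lambda>c. a *s \<eta> c) = a * ip x \<omega> \<eta>"
  by (simp add: cov_inner_herm herm_scale_right)

lemma cov_inner_scale_left: "ip x (\<lambda>c. a *s \<omega> c) \<eta> = cnj a * ip x \<omega> \<eta>"
  by (simp add: cov_inner_herm herm_scale_left)

lemma cov_inner_zero_left [simp]: "ip x (\<lambda>c. 0) \<eta> = 0"
  by (simp add: cov_inner_herm herm_def)

lemma cov_inner_sum_left: "ip x (\<lambda>c. \<Sum>i\<in>I. \<omega> i c) \<eta> = (\<Sum>i\<in>I. ip x (\<omega> i) \<eta>)"
  by (induction I rule: infinite_finite_induct) (simp_all add: cov_inner_add_left)

lemma cov_inner_self: "ip x \<omega> \<omega> = of_real ((nm x \<omega>)\<^sup>2)"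
  unfolding cov_norm_hnorm hnorm_sq[OF posdef_chart_at] cov_inner_herm
  by (rule herm_self_real[OF posdef_chart_at])

lemma cov_cauchy_schwarz: "cmod (ip x \<omega> \<eta>) \<le> nm x \<omega> * nm x \<eta>"
  unfolding cov_norm_hnorm cov_inner_herm by (rule herm_cauchy_schwarz[OF posdef_chart_at])

lemma cov_norm_triangle: "nm x (\<lambda>c. \<omega> c + \<eta> c) \<le> nm x \<omega> + nm x \<eta>"
  unfolding cov_norm_hnorm by (rule hnorm_triangle[OF posdef_chart_at])

lemma cov_norm_scale: "nm x (\<lambda>c. a *s \<omega> c) = cmod a * nm x \<omega>"
  unfolding cov_norm_hnorm by (rule hnorm_scale[OF posdef_chart_at])

lemma cov_norm_nonneg [simp]: "0 \<le> nm x \<omega>"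
  unfolding cov_norm_hnorm hnorm_def by (simp add: herm_self_nonneg[OF posdef_chart_at])

lemma cov_norm_zero [simp]: "nm x (\<lambda>c. 0) = 0"
  by (simp add: cov_norm_def)

lemma cov_norm_sum: "nm x (\<lambda>c. \<Sum>i\<in>I. \<omega> i c) \<le> (\<Sum>i\<in>I. nm x (\<omega> i))"
proof (induction I rule: infinite_finite_induct)
  case (insert i I)
  then show ?case using cov_norm_triangle[of x "\<omega> i" "\<lambda>c. \<Sum>i\<in>I. \<omega> i c"] by simp
qed simp_all

lemma cov_norm_eq_0:
  assumes "\<omega> \<in> cotangent_space A x" "nm x \<omega> = 0"
  shows "\<omega> = (\<lambda>c. 0)"
proof -
  have "Re (herm (matrix_inv (g x (chart_at A x))) (\<omega> (chart_at A x)) (\<omega> (chart_at A x))) = 0"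
    using assms(2) hnorm_sq[OF posdef_chart_at] unfolding cov_norm_hnorm by (metis zero_power2)
  then have "\<omega> (chart_at A x) = 0" by (rule herm_self_eq_0[OF posdef_chart_at])
  moreover have "(\<lambda>c. 0) \<in> cotangent_space A x" by (simp add: cotangent_space_def)
  ultimately show ?thesis by (intro cotangent_space_eqI[OF assms(1) _ chart_at])
qed

lemma zero_cotangent [simp]: "(\<lambda>c. 0) \<in> cotangent_space A x"
  by (simp add: cotangent_space_def)

lemma scale_cotangent:
  assumes "\<omega> \<in> cotangent_space A x"
  shows "(\<lambda>c. a *s \<omega> c) \<in> cotangent_space A x"
proof (rule cotangent_spaceI)
  fix c d i assume "c \<in> A" "d \<in> A" "x \<in> chart_dom c" "x \<in> chart_dom d"
  from cotangent_space_change[OF assms this]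
  show "(a *s \<omega> c) $ i = (\<Sum>j\<in>UNIV. of_real (jac c d x $ j $ i) * (a *s \<omega> d) $ j)"
    by (simp add: sum_distrib_left mult.left_commute)
qed (simp add: cotangent_space_zero[OF assms])

lemma add_cotangent:
  assumes "\<omega> \<in> cotangent_space A x" "\<eta> \<in> cotangent_space A x"
  shows "(\<lambda>c. \<omega> c + \<eta> c) \<in> cotangent_space A x"
proof (rule cotangent_spaceI)
  fix c d i assume *: "c \<in> A" "d \<in> A" "x \<in> chart_dom c" "x \<in> chart_dom d"
  from cotangent_space_change[OF assms(1) *] cotangent_space_change[OF assms(2) *]
  show "(\<omega> c + \<eta> c) $ i = (\<Sum>j\<in>UNIV. of_real (jac c d x $ j $ i) * (\<omega> d + \<eta> d) $ j)"
    by (simp add: sum.distrib distrib_left)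
qed (simp add: cotangent_space_zero[OF assms(1)] cotangent_space_zero[OF assms(2)])

lemma sum_cotangent: "(\<And>i. i \<in> I \<Longrightarrow> \<omega> i \<in> cotangent_space A x) \<Longrightarrow> (\<lambda>c. \<Sum>i\<in>I. \<omega> i c) \<in> cotangent_space A x"
  by (induction I rule: infinite_finite_induct) (auto intro: add_cotangent)

text \<open>Outside the domain of \<open>c\<close> the covector is 0, so coefficients supported
  inside the domain define a global form.\<close>

definition covec :: "('m, 'n) chart \<Rightarrow> complex ^ 'n \<Rightarrow> 'm \<Rightarrow> ('m, 'n) covector" where
  "covec c v x d = (if d \<in> A \<and> x \<in> chart_dom d \<and> x \<in> chart_dom c
     then \<chi> i. \<Sum>j\<in>UNIV. of_real (jac d c x $ j $ i) * v $ j else 0)"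

lemma covec_self:
  assumes "c \<in> A" "x \<in> chart_dom c"
  shows "covec c v x c = v"
proof -
  have "(\<Sum>j\<in>UNIV. of_real ((mat 1 :: real ^ 'n ^ 'n) $ j $ i) * v $ j) = v $ i" for i
    by (simp add: mat_def if_distrib if_distribR cong: if_cong)
  then show ?thesis using assms by (simp add: covec_def jac_self vec_eq_iff)
qed

text \<open>The transformation law between two other charts is the cocycle identity
  \<open>jac_chain\<close> through \<open>c\<close>.\<close>

lemma covec_cotangent:
  assumes c: "c \<in> A"
  shows "covec c v x \<in> cotangent_space A x"
proof (cases "x \<in> chart_dom c")
  case True
  have key: "(\<Sum>j\<in>UNIV. of_real (jac d c x $ j $ i) * v $ j) =
    (\<Sum>k\<in>UNIV. of_real (jac d e x $ k $ i) * (\<Sum>j\<in>UNIV. of_real (jac e c x $ j $ k) * v $ j))"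
    if "d \<in> A" "e \<in> A" "x \<in> chart_dom d" "x \<in> chart_dom e" for d e i
  proof -
    have "(\<Sum>j\<in>UNIV. of_real (jac d c x $ j $ i) * v $ j) =
      (\<Sum>j\<in>UNIV. \<Sum>k\<in>UNIV. of_real (jac e c x $ j $ k) * of_real (jac d e x $ k $ i) * v $ j)"
      unfolding jac_chain[OF that(1,2) c that(3,4) True]
      by (simp add: matrix_matrix_mult_def sum_distrib_right)
    also have "\<dots> = (\<Sum>k\<in>UNIV. \<Sum>j\<in>UNIV. of_real (jac e c x $ j $ k) * of_real (jac d e x $ k $ i) * v $ j)"
      by (rule sum.swap)
    also have "\<dots> = (\<Sum>k\<in>UNIV. of_real (jac d e x $ k $ i) * (\<Sum>j\<in>UNIV. of_real (jac e c x $ j $ k) * v $ j))"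
      by (simp add: sum_distrib_left algebra_simps)
    finally show ?thesis .
  qed
  have eq: "covec c v x d = (\<chi> i. \<Sum>j\<in>UNIV. of_real (jac d c x $ j $ i) * v $ j)"
    if "d \<in> A" "x \<in> chart_dom d" for d
    using that True by (simp add: covec_def)
  show ?thesis
  proof (rule cotangent_spaceI)
    fix d e i assume "d \<in> A" "e \<in> A" "x \<in> chart_dom d" "x \<in> chart_dom e"
    then show "covec c v x d $ i = (\<Sum>j\<in>UNIV. of_real (jac d e x $ j $ i) * covec c v x e $ j)"
      unfolding eq[OF \<open>d \<in> A\<close> \<open>x \<in> chart_dom d\<close>] eq[OF \<open>e \<in> A\<close> \<open>x \<in> chart_dom e\<close>] vec_lambda_beta
      by (rule key)
  qed (auto simp: covec_def)
next
  case False
  then have "covec c v x = (\<lambda>d. 0)" by (auto simp: covec_def)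
  then show ?thesis by simp
qed

end

section \<open>Forms and frames\<close>

lemma continuous_on_vector_scalar_mult [continuous_intros]:
  fixes v :: "'a::topological_space \<Rightarrow> complex ^ 'n::finite"
  assumes "continuous_on S f" "continuous_on S v"
  shows "continuous_on S (\<lambda>x. f x *s v x)"
  unfolding vector_scalar_mult_def using assms by (intro continuous_intros)

lemma borel_measurable_vector_scalar_mult [measurable (raw)]:
  fixes v :: "'a \<Rightarrow> complex ^ 'n::finite"
  assumes "f \<in> borel_measurable M" "v \<in> borel_measurable M"
  shows "(\<lambda>x. f x *s v x) \<in> borel_measurable M"
  using assms by (rule borel_measurable_continuous_Pair) (intro continuous_intros)

lemma borel_measurable_vec_component [measurable (raw)]:
  fixes v :: "'a \<Rightarrow> complex ^ 'n::finite"
  assumes "v \<in> borel_measurable M"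
  shows "(\<lambda>x. v x $ i) \<in> borel_measurable M"
  by (rule borel_measurable_continuous_on[OF _ assms]) (intro continuous_intros)

context riemannian
begin

section \<open>Continuous forms, Borel forms and forms vanishing at infinity\<close>

definition cont_forms :: "('m, 'n) form set" where
  "cont_forms = {\<alpha> \<in> one_forms A. \<forall>c\<in>A. continuous_on (chart_dom c) (\<lambda>x. \<alpha> x c)}"

lemma cont_formsD:
  assumes "\<alpha> \<in> cont_forms"
  shows "\<alpha> x \<in> cotangent_space A x" "c \<in> A \<Longrightarrow> continuous_on (chart_dom c) (\<lambda>x. \<alpha> x c)"
  using assms by (auto simp: cont_forms_def one_forms_def)

lemma borel_formsD:
  assumes "\<alpha> \<in> borel_forms A"
  shows "\<alpha> x \<in> cotangent_space A x"
    "c \<in> A \<Longrightarrow> (\<lambda>x. \<alpha> x c) \<in> borel_measurable (restrict_space borel (chart_dom c))"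
  using assms by (auto simp: borel_forms_def one_forms_def)

lemma borel_formsI:
  assumes "\<And>x. \<alpha> x \<in> cotangent_space A x"
    "\<And>c. c \<in> A \<Longrightarrow> (\<lambda>x. \<alpha> x c) \<in> borel_measurable (restrict_space borel (chart_dom c))"
  shows "\<alpha> \<in> borel_forms A"
  using assms by (auto simp: borel_forms_def one_forms_def)

lemma C0_cont: "\<alpha> \<in> C0 \<Longrightarrow> \<alpha> \<in> cont_forms"
  by (auto simp: C0_forms_def cont_forms_def)

lemma cont_borel: "\<alpha> \<in> cont_forms \<Longrightarrow> \<alpha> \<in> borel_forms A"
  by (auto simp: cont_forms_def borel_forms_def intro: borel_measurable_continuous_on_restrict)

lemma chart_cover: "(\<Union>c\<in>A. chart_dom c) = UNIV"
  using atlas by (simp add: smooth_atlas_def)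

lemma continuous_on_matrix_inv_metric:
  assumes "c \<in> A"
  shows "continuous_on (chart_dom c) (\<lambda>x. matrix_inv (g x c) $ i $ j)"
  by (intro continuous_on_matrix_inv continuous_on_metric posdef_invertible posdef_metric assms)

lemma continuous_cov_inner:
  assumes "\<alpha> \<in> cont_forms" "\<beta> \<in> cont_forms"
  shows "continuous_on UNIV (\<lambda>x. ip x (\<alpha> x) (\<beta> x))"
proof -
  have "continuous_on (\<Union>c\<in>A. chart_dom c) (\<lambda>x. ip x (\<alpha> x) (\<beta> x))"
  proof (rule continuous_on_open_UN)
    fix c assume c: "c \<in> A"
    then show "open (chart_dom c)" by (rule chart(1))
    have "continuous_on (chart_dom c) (\<lambda>x. herm (matrix_inv (g x c)) (\<alpha> x c) (\<beta> x c))"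
      unfolding herm_def using assms[THEN cont_formsD(2)] c
      by (intro continuous_intros continuous_on_matrix_inv_metric) auto
    then show "continuous_on (chart_dom c) (\<lambda>x. ip x (\<alpha> x) (\<beta> x))"
      by (rule continuous_on_eq) (simp add: cov_inner_chart[OF assms[THEN cont_formsD(1)] c])
  qed
  then show ?thesis by (simp only: chart_cover)
qed

lemma continuous_cov_norm:
  assumes "\<alpha> \<in> cont_forms"
  shows "continuous_on UNIV (\<lambda>x. nm x (\<alpha> x))"
  unfolding cov_norm_def by (intro continuous_intros continuous_cov_inner assms)

lemma borel_cov_inner:
  assumes "\<alpha> \<in> borel_forms A" "\<beta> \<in> borel_forms A"
  shows "(\<lambda>x. ip x (\<alpha> x) (\<beta> x)) \<in> borel_measurable borel"
proof -
  \<comment> \<open>The atlas may be uncountable, while measurability is glued over countable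
    covers; second countability supplies a countable subcover by chart domains.\<close>
  have "open V" if "V \<in> chart_dom ` A" for V using that chart(1) by auto
  then obtain F where F: "F \<subseteq> chart_dom ` A" "countable F" "\<Union>F = \<Union>(chart_dom ` A)"
    by (rule Lindelof)
  show ?thesis
  proof (rule measurable_piecewise_restrict[OF F(2)])
    show "space borel \<subseteq> \<Union>F" using F(3) chart_cover by simp
    fix U assume "U \<in> F"
    then obtain c where c: "c \<in> A" "U = chart_dom c" using F(1) by auto
    then show "U \<inter> space borel \<in> sets borel" using chart(1) by simp
    let ?M = "restrict_space borel (chart_dom c)"
    have [measurable]: "(\<lambda>x. matrix_inv (g x c) $ i $ j) \<in> borel_measurable ?M" for i j
      by (intro borel_measurable_continuous_on_restrict continuous_on_matrix_inv_metric c)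
    have [measurable]: "(\<lambda>x. cnj (\<alpha> x c $ i)) \<in> borel_measurable ?M" for i
      by (rule borel_measurable_continuous_on[OF _ borel_formsD(2)[OF assms(1) c(1)], of "\<lambda>v. cnj (v $ i)"])
         (intro continuous_intros)
    have [measurable]: "(\<lambda>x. \<beta> x c $ i) \<in> borel_measurable ?M" for i
      by (rule borel_measurable_vec_component[OF borel_formsD(2)[OF assms(2) c(1)]])
    have "(\<lambda>x. herm (matrix_inv (g x c)) (\<alpha> x c) (\<beta> x c)) \<in> borel_measurable ?M"
      unfolding herm_def by measurable
    then show "(\<lambda>x. ip x (\<alpha> x) (\<beta> x)) \<in> borel_measurable (restrict_space borel U)"
      unfolding c(2)
      by (subst measurable_cong) (auto simp: space_restrict_space cov_inner_chart[OF assms[THEN borel_formsD(1)] c(1)])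
  qed
qed

lemma borel_cov_norm:
  assumes "\<alpha> \<in> borel_forms A"
  shows "(\<lambda>x. nm x (\<alpha> x)) \<in> borel_measurable borel"
  unfolding cov_norm_def using borel_cov_inner[OF assms assms] by measurable

lemma borel_scale:
  assumes "f \<in> borel_measurable borel" "\<alpha> \<in> borel_forms A"
  shows "(\<lambda>x c. f x *s \<alpha> x c) \<in> borel_forms A"
proof (rule borel_formsI)
  fix c assume "c \<in> A"
  then have [measurable]: "(\<lambda>x. \<alpha> x c) \<in> borel_measurable (restrict_space borel (chart_dom c))"
    using borel_formsD(2)[OF assms(2)] by simp
  have [measurable]: "f \<in> borel_measurable (restrict_space borel (chart_dom c))"
    using assms(1) by (rule measurable_restrict_space1)
  show "(\<lambda>x. f x *s \<alpha> x c) \<in> borel_measurable (restrict_space borel (chart_dom c))" by measurable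
qed (intro scale_cotangent borel_formsD(1)[OF assms(2)])

lemma borel_add:
  assumes "\<alpha> \<in> borel_forms A" "\<beta> \<in> borel_forms A"
  shows "(\<lambda>x c. \<alpha> x c + \<beta> x c) \<in> borel_forms A"
  by (rule borel_formsI) (auto intro!: add_cotangent assms[THEN borel_formsD(1)] borel_measurable_add assms[THEN borel_formsD(2)])

lemma borel_sum:
  assumes "\<And>i. i \<in> I \<Longrightarrow> \<alpha> i \<in> borel_forms A"
  shows "(\<lambda>x c. \<Sum>i\<in>I. \<alpha> i x c) \<in> borel_forms A"
  by (rule borel_formsI) (auto intro!: sum_cotangent borel_measurable_sum intro: borel_formsD[OF assms])

lemma C0_bounded:
  assumes "\<alpha> \<in> C0"
  obtains B where "\<And>x. nm x (\<alpha> x) \<le> B"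
proof -
  obtain K where K: "compact K" "\<And>x. x \<notin> K \<Longrightarrow> nm x (\<alpha> x) < 1"
    using assms unfolding C0_forms_def by (auto dest!: spec[of _ "1 :: real"])
  have "bounded ((\<lambda>x. nm x (\<alpha> x)) ` K)"
    by (intro compact_imp_bounded compact_continuous_image K(1)
        continuous_on_subset[OF continuous_cov_norm[OF C0_cont[OF assms]]]) simp
  then obtain b where b: "\<And>x. x \<in> K \<Longrightarrow> nm x (\<alpha> x) \<le> b" by (auto simp: bounded_iff)
  have "nm x (\<alpha> x) \<le> max 1 b" for x
    using K(2)[of x] b[of x] by (cases "x \<in> K") auto
  then show thesis by (rule that)
qed

text \<open>The real supremum dominates its values only on a bounded set, hence the appeal to
  \<open>C0_bounded\<close>.\<close>

lemma cov_norm_le_sup_norm: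
  assumes "\<alpha> \<in> C0"
  shows "nm x (\<alpha> x) \<le> sup_norm A g \<alpha>"
proof -
  obtain B where "\<And>x. nm x (\<alpha> x) \<le> B" using C0_bounded[OF assms] by blast
  then show ?thesis unfolding sup_norm_def by (intro cSUP_upper bdd_aboveI2[of _ _ B]) auto
qed

lemma sup_norm_le:
  assumes "\<And>x. nm x (\<alpha> x) \<le> b"
  shows "sup_norm A g \<alpha> \<le> b"
  unfolding sup_norm_def by (rule cSUP_least) (use assms in auto)

lemma C0_formsI:
  assumes "\<alpha> \<in> cont_forms" "\<And>e. e > 0 \<Longrightarrow> \<exists>K. compact K \<and> (\<forall>x. x \<notin> K \<longrightarrow> nm x (\<alpha> x) < e)"
  shows "\<alpha> \<in> C0"
  using assms by (auto simp: C0_forms_def cont_forms_def)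

lemma C0_formsD:
  assumes "\<alpha> \<in> C0" "e > 0"
  obtains K where "compact K" "\<And>x. x \<notin> K \<Longrightarrow> nm x (\<alpha> x) < e"
  using assms by (auto simp: C0_forms_def)

lemma C0_add:
  assumes "\<alpha> \<in> C0" "\<beta> \<in> C0"
  shows "(\<lambda>x c. \<alpha> x c + \<beta> x c) \<in> C0"
proof (rule C0_formsI)
  show "(\<lambda>x c. \<alpha> x c + \<beta> x c) \<in> cont_forms"
    using assms[THEN C0_cont] unfolding cont_forms_def one_forms_def
    by (auto intro!: add_cotangent continuous_intros)
  fix e :: real assume "e > 0"
  then have e: "e / 2 > 0" by simp
  obtain K where K: "compact K" "\<And>x. x \<notin> K \<Longrightarrow> nm x (\<alpha> x) < e / 2"
    using C0_formsD[OF assms(1) e] by blast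
  obtain L where L: "compact L" "\<And>x. x \<notin> L \<Longrightarrow> nm x (\<beta> x) < e / 2"
    using C0_formsD[OF assms(2) e] by blast
  have "nm x (\<lambda>c. \<alpha> x c + \<beta> x c) < e" if "x \<notin> K \<union> L" for x
    using K(2)[of x] L(2)[of x] that cov_norm_triangle[of x "\<alpha> x" "\<beta> x"] by simp
  then show "\<exists>K. compact K \<and> (\<forall>x. x \<notin> K \<longrightarrow> nm x (\<lambda>c. \<alpha> x c + \<beta> x c) < e)"
    using compact_Un[OF K(1) L(1)] by blast
qed

lemma C0_scale:
  assumes \<alpha>: "\<alpha> \<in> C0" and f: "continuous_on UNIV f" "\<And>x. cmod (f x) \<le> B"
  shows "(\<lambda>x c. f x *s \<alpha> x c) \<in> C0"
proof (rule C0_formsI)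
  show "(\<lambda>x c. f x *s \<alpha> x c) \<in> cont_forms"
    using C0_cont[OF \<alpha>] f(1) unfolding cont_forms_def one_forms_def
    by (auto intro!: scale_cotangent continuous_intros continuous_on_subset[OF f(1)])
  fix e :: real assume e: "e > 0"
  have B: "B \<ge> 0" using order_trans[OF norm_ge_zero f(2)] .
  then obtain K where K: "compact K" "\<And>x. x \<notin> K \<Longrightarrow> nm x (\<alpha> x) < e / (B + 1)"
    using C0_formsD[OF \<alpha>, of "e / (B + 1)"] e by (metis add_nonneg_pos divide_pos_pos zero_less_one)
  have "nm x (\<lambda>c. f x *s \<alpha> x c) < e" if "x \<notin> K" for x
  proof -
    have "nm x (\<lambda>c. f x *s \<alpha> x c) \<le> (B + 1) * nm x (\<alpha> x)"
      unfolding cov_norm_scale using f(2)[of x] by (intro mult_right_mono) auto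
    also have "\<dots> < e" using K(2)[OF that] B by (simp add: field_simps)
    finally show ?thesis .
  qed
  then show "\<exists>K. compact K \<and> (\<forall>x. x \<notin> K \<longrightarrow> nm x (\<lambda>c. f x *s \<alpha> x c) < e)"
    using K(1) by blast
qed

lemma zero_C0: "(\<lambda>x c. 0) \<in> C0"
  by (rule C0_formsI) (auto simp: cont_forms_def one_forms_def)

lemma C0_sum:
  assumes "\<And>i. i \<in> I \<Longrightarrow> \<alpha> i \<in> C0"
  shows "(\<lambda>x c. \<Sum>i\<in>I. \<alpha> i x c) \<in> C0"
  using assms by (induction I rule: infinite_finite_induct) (auto intro: C0_add zero_C0)

text \<open>Extension by zero: in a chart \<open>d\<close> the form is continuous on the overlap
  with \<open>c\<close> and vanishes off \<open>K\<close>. Both sets are open, since a compact set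
  is closed in a Hausdorff space, and together they cover the domain of \<open>d\<close>.\<close>

lemma covec_C0:
  assumes c: "c \<in> A" and v: "continuous_on (chart_dom c) v"
    and K: "compact K" "K \<subseteq> chart_dom c" "\<And>x. x \<in> chart_dom c \<Longrightarrow> x \<notin> K \<Longrightarrow> v x = 0"
  shows "(\<lambda>x. covec c (v x) x) \<in> C0" "x \<notin> K \<Longrightarrow> covec c (v x) x = (\<lambda>d. 0)"
proof -
  have zero: "covec c (v x) x = (\<lambda>d. 0)" if "x \<notin> K" for x
    using K(3)[of x] that by (auto simp: covec_def fun_eq_iff vec_eq_iff)
  then show "x \<notin> K \<Longrightarrow> covec c (v x) x = (\<lambda>d. 0)" .
  show "(\<lambda>x. covec c (v x) x) \<in> C0"
  proof (rule C0_formsI)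
    have "continuous_on (chart_dom d) (\<lambda>x. covec c (v x) x d)" if d: "d \<in> A" for d
    proof -
      let ?U = "chart_dom d \<inter> chart_dom c" and ?V = "chart_dom d - K"
      have "continuous_on (?U \<union> ?V) (\<lambda>x. covec c (v x) x d)"
      proof (rule continuous_on_open_Un)
        show "open ?U" by (intro open_Int chart(1) c d)
        show "open ?V" by (intro open_Diff chart(1) d compact_imp_closed K(1))
        have "continuous_on ?U (\<lambda>x. \<chi> i. \<Sum>j\<in>UNIV. complex_of_real (jac d c x $ j $ i) * v x $ j)"
          by (intro continuous_on_vec_lambda continuous_intros continuous_on_jac c d
              continuous_on_subset[OF v]) auto
        then show "continuous_on ?U (\<lambda>x. covec c (v x) x d)"
          by (rule continuous_on_eq) (use d in \<open>simp add: covec_def\<close>)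
        have "continuous_on ?V (\<lambda>x. 0 :: complex ^ 'n)" by simp
        then show "continuous_on ?V (\<lambda>x. covec c (v x) x d)"
          by (rule continuous_on_eq) (simp add: zero)
      qed
      moreover have "?U \<union> ?V = chart_dom d" using K(2) by auto
      ultimately show ?thesis by simp
    qed
    then show "(\<lambda>x. covec c (v x) x) \<in> cont_forms"
      by (auto simp: cont_forms_def one_forms_def intro: covec_cotangent[OF c])
    show "\<exists>K. compact K \<and> (\<forall>x. x \<notin> K \<longrightarrow> nm x (covec c (v x) x) < e)" if "e > 0" for e
      using K(1) zero that by (intro exI[of _ K]) simp
  qed
qed

section \<open>Bump functions and open sets as nonzero sets of continuous functions\<close>

definition bump :: "'m set \<Rightarrow> ('m \<Rightarrow> real) \<Rightarrow> 'm set \<Rightarrow> ('m, 'n) chart \<Rightarrow> bool" where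
  "bump U f K c \<longleftrightarrow> c \<in> A \<and> continuous_on UNIV f \<and> (\<forall>y. 0 \<le> f y \<and> f y \<le> 1) \<and>
    compact K \<and> K \<subseteq> U \<inter> chart_dom c \<and> (\<forall>y. y \<notin> K \<longrightarrow> f y = 0)"

text \<open>A cone over a closed coordinate ball around \<open>x\<close>. The ball is chosen within
  the image of the part of \<open>U\<close> covered by the chart, and its preimage \<open>K\<close>
  is compact.\<close>

lemma ex_bump:
  assumes "open U" "x \<in> U"
  shows "\<exists>f K c. bump U f K c \<and> f x > 0"
proof -
  define c where "c = chart_at A x"
  have c: "c \<in> A" "x \<in> chart_dom c" unfolding c_def by (rule chart_at)+
  define V where "V = U \<inter> chart_dom c"
  have V: "open V" "x \<in> V" "V \<subseteq> chart_dom c"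
    unfolding V_def using assms(2) c open_Int[OF assms(1) chart(1)[OF c(1)]] by auto
  have "open (chart_map c ` V)" by (rule open_chart_image[OF c(1) V(1,3)])
  moreover have "chart_map c x \<in> chart_map c ` V" using V(2) by simp
  ultimately obtain r where r: "r > 0" "cball (chart_map c x) r \<subseteq> chart_map c ` V"
    by (meson open_contains_cball)
  let ?y = "chart_map c x"
  define K where "K = chart_inv c ` cball ?y r"
  have sub: "cball ?y r \<subseteq> chart_img c" using r(2) V(3) by blast
  have KV: "K \<subseteq> V"
  proof
    fix z assume "z \<in> K"
    then obtain w where w: "w \<in> cball ?y r" "z = chart_inv c w" by (auto simp: K_def)
    then obtain u where "u \<in> V" "w = chart_map c u" using r(2) by auto
    then show "z \<in> V" using w chart(5)[OF c(1)] V(3) by auto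
  qed
  have K: "compact K" unfolding K_def
    by (intro compact_continuous_image continuous_on_subset[OF chart(4)[OF c(1)] sub]) simp
  have memK: "z \<in> K \<longleftrightarrow> dist ?y (chart_map c z) \<le> r" if "z \<in> V" for z
  proof
    assume "z \<in> K"
    then obtain w where w: "w \<in> cball ?y r" "z = chart_inv c w" by (auto simp: K_def)
    then show "dist ?y (chart_map c z) \<le> r" using chart(6)[OF c(1), of w] sub by auto
  next
    assume "dist ?y (chart_map c z) \<le> r"
    moreover have "z = chart_inv c (chart_map c z)" using chart(5)[OF c(1), of z] that V(3) by auto
    ultimately show "z \<in> K" unfolding K_def by (metis image_eqI mem_cball)
  qed
  \<comment> \<open>The cone reaches 0 at the boundary of the ball. On \<open>V\<close> the formula
    therefore holds without the case distinction, and on the open complement of \<open>K\<close> the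
    function is 0.\<close>
  define f where "f z = (if z \<in> K then max 0 (1 - dist ?y (chart_map c z) / r) else 0)" for z
  have "continuous_on (V \<union> - K) f"
  proof (rule continuous_on_open_Un)
    show "open (- K)" using compact_imp_closed[OF K] by (rule open_Compl)
    have "continuous_on V (\<lambda>z. max 0 (1 - dist ?y (chart_map c z) / r))"
      using r(1) by (intro continuous_intros continuous_on_subset[OF chart(3)[OF c(1)] V(3)]) auto
    then show "continuous_on V f"
    proof (rule continuous_on_eq)
      fix z assume z: "z \<in> V"
      show "max 0 (1 - dist ?y (chart_map c z) / r) = f z"
        using memK[OF z] r(1) by (auto simp: f_def max_def field_simps)
    qed
    have "continuous_on (- K) (\<lambda>x. 0 :: real)" by simp
    then show "continuous_on (- K) f" by (rule continuous_on_eq) (simp add: f_def)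
  qed (rule V(1))
  moreover have "V \<union> - K = UNIV" using KV by auto
  ultimately have "continuous_on UNIV f" by simp
  moreover have "0 \<le> f y \<and> f y \<le> 1" for y using r(1) by (auto simp: f_def)
  moreover have "f x > 0" using memK[OF V(2)] r(1) by (simp add: f_def)
  moreover have "K \<subseteq> U \<inter> chart_dom c" using KV by (simp add: V_def)
  ultimately show ?thesis using c(1) K by (intro exI[of _ f] exI[of _ K] exI[of _ c]) (auto simp: f_def bump_def)
qed

text \<open>The positivity sets of the bumps at all points of \<open>U\<close> form an open cover,
  and second countability extracts a countable one. With \<open>U\<close> the whole manifold this
  gives the cover by charts; for general \<open>U\<close> it feeds
  \<open>open_cozero\<close>.\<close>

lemma countable_bumps:
  assumes U: "open U"
  shows "\<exists>f K c. (\<forall>n::nat. bump U (f n) (K n) (c n)) \<and> U = (\<Union>n. {y. f n y > 0})"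
\<comment> \<open>An empty \<open>U\<close> has no points to enumerate; zero functions with empty
  support serve instead.\<close>
proof (cases "U = {}")
  case True
  show ?thesis
    by (rule exI[of _ "\<lambda>n y. 0"], rule exI[of _ "\<lambda>n. {}"], rule exI[of _ "\<lambda>n. chart_at A undefined"])
       (simp add: True chart_at bump_def)
next
  case False
  have "\<forall>x\<in>U. \<exists>f K c. bump U f K c \<and> f x > 0" using ex_bump[OF U] by blast
  then obtain f K c where bump: "\<And>x. x \<in> U \<Longrightarrow> bump U (f x) (K x) (c x) \<and> f x x > 0" by metis
  note f = bump[unfolded bump_def]
  define S where "S x = {y. f x y > 0}" for x
  have "open (S x)" if "x \<in> U" for x
    unfolding S_def using f[OF that] by (intro open_Collect_less continuous_intros) auto
  then have "open V" if "V \<in> S ` U" for V using that by auto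
  then obtain F where F: "F \<subseteq> S ` U" "countable F" "\<Union>F = \<Union>(S ` U)"
    by (rule Lindelof)
  obtain X where X: "X \<subseteq> U" "countable X" "F = S ` X" using F(1,2) countable_subset_image by metis
  have "(\<Union>x\<in>U. S x) = U"
  proof (intro equalityI subsetI)
    fix y assume "y \<in> (\<Union>x\<in>U. S x)"
    then obtain x where x: "x \<in> U" "f x y > 0" by (auto simp: S_def)
    then have "y \<in> K x" using f[OF x(1)] by (metis less_irrefl)
    then show "y \<in> U" using f[OF x(1)] by blast
  next
    fix y assume "y \<in> U"
    then show "y \<in> (\<Union>x\<in>U. S x)" using f[of y] by (auto simp: S_def)
  qed
  then have SX: "(\<Union>x\<in>X. S x) = U" using F(3) X(3) by simp
  then have "X \<noteq> {}" using False by auto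
  then have r: "range (from_nat_into X) = X" using X(2) by simp
  then have inU: "from_nat_into X n \<in> U" for n using X(1) by blast
  have "U = (\<Union>n. {y. f (from_nat_into X n) y > 0})"
  proof -
    have "(\<Union>x\<in>X. S x) = (\<Union>n. S (from_nat_into X n))" using r by (metis image_image)
    then show ?thesis using SX by (simp add: S_def)
  qed
  then show ?thesis using bump[OF inU]
    by (intro exI[of _ "\<lambda>n. f (from_nat_into X n)"] exI[of _ "\<lambda>n. K (from_nat_into X n)"]
        exI[of _ "\<lambda>n. c (from_nat_into X n)"]) auto
qed

text \<open>The bumps are summed with weights \<open>(1/2)^n\<close>: convergence is uniform, hence
  the sum is continuous, and a sum of nonnegative terms vanishes only if every term does. This
  supplies the \<open>cozero\<close> hypothesis of the scalar theorems.\<close>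

lemma open_cozero:
  fixes U :: "'m set"
  assumes "open U"
  shows "\<exists>h :: 'm \<Rightarrow> real. continuous_on UNIV h \<and> U = {x. h x \<noteq> 0}"
proof -
  obtain f where f: "\<And>n. continuous_on UNIV (f n)" "\<And>n y. 0 \<le> f n y \<and> f n y \<le> (1::real)"
    "U = (\<Union>n::nat. {y. f n y > 0})"
    using countable_bumps[OF assms] unfolding bump_def by metis
  define h where "h x = (\<Sum>n. (1/2)^n * f n x)" for x
  have summ: "summable (\<lambda>n. (1/2)^n * f n x)" for x
    by (rule summable_comparison_test'[OF summable_geometric[of "1/2"], of 0]) (use f(2) in \<open>auto intro: mult_left_le simp: abs_mult\<close>)
  have "uniform_limit UNIV (\<lambda>n x. \<Sum>i<n. (1/2)^i * f i x) h sequentially"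
    unfolding h_def
    by (rule Weierstrass_m_test[OF _ summable_geometric[of "1/2"]]) (use f(2) in \<open>auto intro: mult_left_le simp: abs_mult\<close>)
  then have "continuous_on UNIV h"
    by (rule uniform_limit_theorem[rotated]) (auto intro!: continuous_intros f(1) always_eventually)
  moreover have "h x \<noteq> 0 \<longleftrightarrow> x \<in> U" for x
  proof -
    have "h x = 0 \<longleftrightarrow> (\<forall>n. (1/2)^n * f n x = 0)"
      unfolding h_def by (rule suminf_eq_zero_iff[OF summ]) (use f(2) in auto)
    also have "\<dots> \<longleftrightarrow> (\<forall>n. \<not> f n x > 0)" using f(2) by (auto simp: not_less intro: antisym)
    finally show ?thesis using f(3) by auto
  qed
  ultimately show ?thesis by auto
qed

end

section \<open>Frames and coframes of a countable cover by charts\<close>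

locale riemannian_cover = riemannian A g
  for A :: "('m::{t2_space, second_countable_topology}, 'n::finite) chart set"
    and g :: "('m, 'n) metric_field" +
  fixes \<phi> :: "nat \<Rightarrow> 'm \<Rightarrow> real" and supp :: "nat \<Rightarrow> 'm set" and c :: "nat \<Rightarrow> ('m, 'n) chart"
  assumes c: "\<And>k. c k \<in> A"
    and \<phi>_cont: "\<And>k. continuous_on UNIV (\<phi> k)"
    and \<phi>_nonneg: "\<And>k x. 0 \<le> \<phi> k x"
    and \<phi>_le1: "\<And>k x. \<phi> k x \<le> 1"
    and supp: "\<And>k. compact (supp k)" "\<And>k. supp k \<subseteq> chart_dom (c k)"
    and \<phi>_supp: "\<And>k x. x \<notin> supp k \<Longrightarrow> \<phi> k x = 0"
    and \<phi>_cover: "\<And>x. \<exists>k. \<phi> k x > 0"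
begin

definition frame :: "nat \<Rightarrow> 'n \<Rightarrow> ('m, 'n) form" where
  "frame k i x = covec (c k) (of_real (\<phi> k x) *s axis i 1) x"

text \<open>By \<open>herm_dual\<close>, pairing a covector with this form yields
  \<open>\<phi> k x\<close> times its \<open>i\<close>-th component in the chart \<open>c k\<close>;
  the factor makes the form globally defined and compactly supported.\<close>

definition coframe :: "nat \<Rightarrow> 'n \<Rightarrow> ('m, 'n) form" where
  "coframe k i x = covec (c k) (of_real (\<phi> k x) *s (\<chi> j. of_real (g x (c k) $ j $ i))) x"

lemma frame_C0: "frame k i \<in> C0" and frame_supp: "x \<notin> supp k \<Longrightarrow> frame k i x = (\<lambda>d. 0)"
proof -
  have v: "continuous_on (chart_dom (c k)) (\<lambda>x. complex_of_real (\<phi> k x) *s axis i 1 :: complex ^ 'n)"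
    by (intro continuous_intros continuous_on_subset[OF \<phi>_cont]) auto
  have z: "complex_of_real (\<phi> k x) *s axis i 1 = (0 :: complex ^ 'n)" if "x \<notin> supp k" for x
    using \<phi>_supp[OF that] by simp
  show "frame k i \<in> C0" "x \<notin> supp k \<Longrightarrow> frame k i x = (\<lambda>d. 0)"
    using covec_C0[OF c v supp z] unfolding frame_def[abs_def] by auto
qed

lemma coframe_C0: "coframe k i \<in> C0"
proof -
  have gc: "continuous_on (chart_dom (c k)) (\<lambda>x. g x (c k) $ j $ i)" for j
    by (intro continuous_intros continuous_on_metric c)
  have v: "continuous_on (chart_dom (c k)) (\<lambda>x. complex_of_real (\<phi> k x) *s (\<chi> j. complex_of_real (g x (c k) $ j $ i)))"
    by (intro continuous_intros continuous_on_subset[OF \<phi>_cont] gc) auto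
  have z: "complex_of_real (\<phi> k x) *s (\<chi> j. complex_of_real (g x (c k) $ j $ i)) = 0" if "x \<notin> supp k" for x
    using \<phi>_supp[OF that] by simp
  show ?thesis using covec_C0(1)[OF c v supp z] unfolding coframe_def[abs_def] by auto
qed

text \<open>One factor of the square comes from the frame and one from the coframe. Outside the
  chart domain both sides vanish; inside, the components in \<open>c k\<close> decide.\<close>

lemma frame_expansion:
  assumes \<omega>: "\<omega> \<in> cotangent_space A x"
  shows "(\<lambda>d. of_real ((\<phi> k x)\<^sup>2) *s \<omega> d) = (\<lambda>d. \<Sum>i\<in>UNIV. ip x (coframe k i x) \<omega> *s frame k i x d)"
proof (cases "x \<in> chart_dom (c k)")
  case False
  then have "\<phi> k x = 0" using \<phi>_supp supp(2) by blast
  moreover have "frame k i x = (\<lambda>d. 0)" for i using False supp(2) frame_supp by blast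
  ultimately show ?thesis by simp
next
  case True
  have fr: "frame k i x \<in> cotangent_space A x" and co: "coframe k i x \<in> cotangent_space A x" for i
    unfolding frame_def coframe_def by (intro covec_cotangent c)+
  have inner: "ip x (coframe k i x) \<omega> = of_real (\<phi> k x) * \<omega> (c k) $ i" for i
    unfolding cov_inner_chart[OF co \<omega> c True] unfolding coframe_def covec_self[OF c True] herm_scale_left
    by (simp add: herm_dual[OF posdef_metric[OF c True]])
  show ?thesis
  proof (rule cotangent_space_eqI[OF _ _ c True])
    show "(\<lambda>d. of_real ((\<phi> k x)\<^sup>2) *s \<omega> d) \<in> cotangent_space A x" by (rule scale_cotangent[OF \<omega>])
    show "(\<lambda>d. \<Sum>i\<in>UNIV. ip x (coframe k i x) \<omega> *s frame k i x d) \<in> cotangent_space A x"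
      by (intro sum_cotangent scale_cotangent fr)
    have "(\<Sum>i\<in>UNIV. (of_real (\<phi> k x) * \<omega> (c k) $ i) *s (of_real (\<phi> k x) *s axis i 1)) $ j =
      of_real ((\<phi> k x)\<^sup>2) * \<omega> (c k) $ j" for j
      by (simp add: axis_def if_distrib if_distribR power2_eq_square cong: if_cong)
    then show "of_real ((\<phi> k x)\<^sup>2) *s \<omega> (c k) = (\<Sum>i\<in>UNIV. ip x (coframe k i x) \<omega> *s frame k i x (c k))"
      unfolding inner frame_def covec_self[OF c True] by (simp add: vec_eq_iff)
  qed
qed

end

lemma (in riemannian) ex_cover: "\<exists>\<phi> supp c. riemannian_cover A g \<phi> supp c"
proof -
  obtain f K c where f: "\<forall>n::nat. bump UNIV (f n) (K n) (c n)" "UNIV = (\<Union>n. {y. f n y > 0})"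
    using countable_bumps[OF open_UNIV] by blast
  have "riemannian_cover A g f K c"
  proof
    show "\<exists>k. f k x > 0" for x using f(2) by blast
  qed (use f(1) in \<open>auto simp: bump_def\<close>)
  then show ?thesis by blast
qed

section \<open>Approximation of Borel forms\<close>

context riemannian
begin

lemma cov_norm_minus: "nm x (\<lambda>c. \<omega> c - \<eta> c) \<le> nm x \<omega> + nm x \<eta>"
  using cov_norm_triangle[of x \<omega> "\<lambda>c. (- 1) *s \<eta> c"] cov_norm_scale[of x "- 1" \<eta>] by simp

lemma cov_norm_diff_triangle:
  "nm x (\<lambda>c. \<omega> c - \<theta> c) \<le> nm x (\<lambda>c. \<omega> c - \<eta> c) + nm x (\<lambda>c. \<eta> c - \<theta> c)"
  using cov_norm_triangle[of x "\<lambda>c. \<omega> c - \<eta> c" "\<lambda>c. \<eta> c - \<theta> c"] by simp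

lemma cov_inner_diff_right:
  "ip x \<omega> (\<lambda>c. \<eta> c - \<theta> c) = ip x \<omega> \<eta> - ip x \<omega> \<theta>"
  using cov_inner_add_right[of x \<omega> \<eta> "\<lambda>c. (- 1) *s \<theta> c"] cov_inner_scale_right[of x \<omega> "- 1" \<theta>] by simp

lemma cov_inner_diff_left:
  "ip x (\<lambda>c. \<omega> c - \<theta> c) \<eta> = ip x \<omega> \<eta> - ip x \<theta> \<eta>"
  using cov_inner_add_left[of x \<omega> "\<lambda>c. (- 1) *s \<theta> c" \<eta>] cov_inner_scale_left[of x "- 1" \<theta> \<eta>] by simp

lemma borel_diff:
  assumes "\<alpha> \<in> borel_forms A" "\<beta> \<in> borel_forms A"
  shows "(\<lambda>x c. \<alpha> x c - \<beta> x c) \<in> borel_forms A"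
  using borel_add[OF assms(1) borel_scale[OF _ assms(2), of "\<lambda>x. - 1"]] by simp

text \<open>Radial retraction of \<open>\<gamma>\<close> onto the unit ball. It moves
  \<open>\<gamma> x\<close> by the excess of its norm over 1, which is at most the distance to
  \<open>\<beta> x\<close> since the latter lies in the ball; the triangle inequality gives the
  factor 2.\<close>

lemma truncate_unit_ball:
  assumes "\<gamma> \<in> C0" "\<And>x. nm x (\<beta> x) \<le> 1"
  obtains \<alpha> where "\<alpha> \<in> C0" "\<And>x. nm x (\<alpha> x) \<le> 1"
    "\<And>x. nm x (\<lambda>c. \<alpha> x c - \<beta> x c) \<le> 2 * nm x (\<lambda>c. \<gamma> x c - \<beta> x c)"
proof -
  define f where "f x = 1 / max 1 (nm x (\<gamma> x))" for x
  define \<alpha> where "\<alpha> = (\<lambda>x c. complex_of_real (f x) *s \<gamma> x c)"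
  have f: "0 < f x" "f x \<le> 1" for x by (auto simp: f_def divide_simps)
  have "continuous_on UNIV (\<lambda>x. complex_of_real (f x))"
    unfolding f_def by (intro continuous_intros continuous_cov_norm C0_cont assms) (metis max.cobounded1 not_one_le_zero)
  then have "\<alpha> \<in> C0"
    unfolding \<alpha>_def using f by (intro C0_scale[OF assms(1), of _ 1]) (auto simp: less_imp_le)
  moreover have "nm x (\<alpha> x) \<le> 1" for x
  proof -
    have "nm x (\<gamma> x) / max 1 (nm x (\<gamma> x)) \<le> 1"
      by (intro divide_le_eq_1_pos[THEN iffD2]) auto
    then show ?thesis unfolding \<alpha>_def cov_norm_scale norm_of_real using f(1)[of x] by (simp add: f_def)
  qed
  moreover have "nm x (\<lambda>c. \<alpha> x c - \<beta> x c) \<le> 2 * nm x (\<lambda>c. \<gamma> x c - \<beta> x c)" for x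
  proof -
    have "(\<lambda>c. \<alpha> x c - \<gamma> x c) = (\<lambda>c. complex_of_real (f x - 1) *s \<gamma> x c)"
      by (simp add: \<alpha>_def vec_eq_iff fun_eq_iff algebra_simps)
    then have "nm x (\<lambda>c. \<alpha> x c - \<gamma> x c) = cmod (complex_of_real (f x - 1)) * nm x (\<gamma> x)"
      by (simp only: cov_norm_scale)
    also have "\<dots> = (1 - f x) * nm x (\<gamma> x)"
      unfolding norm_of_real using f(2)[of x] by simp
    also have "\<dots> \<le> max 0 (nm x (\<gamma> x) - 1)"
    proof (cases "nm x (\<gamma> x) \<le> 1")
      case True then show ?thesis by (simp add: f_def)
    next
      case False then show ?thesis by (simp add: f_def max_def field_simps)
    qed
    also have "\<dots> \<le> nm x (\<lambda>c. \<gamma> x c - \<beta> x c)"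
      using cov_norm_triangle[of x "\<lambda>c. \<gamma> x c - \<beta> x c" "\<beta> x"] assms(2)[of x] by simp
    finally show ?thesis
      using cov_norm_diff_triangle[of x "\<alpha> x" "\<beta> x" "\<gamma> x"] by simp
  qed
  ultimately show thesis by (rule that)
qed

end

section \<open>Cutoffs, approximation in the integral distance, and the norm identity\<close>

context riemannian_cover
begin

definition sqsum :: "nat \<Rightarrow> 'm \<Rightarrow> real" where
  "sqsum N x = (\<Sum>k<N. (\<phi> k x)\<^sup>2)"

text \<open>This replaces a partition of unity. The growing factor \<open>Suc N\<close> lets the
  value reach 1 exactly after finitely many steps, even if the sum of squares stays small.\<close>

definition cutoff :: "nat \<Rightarrow> 'm \<Rightarrow> real" where
  "cutoff N x = min 1 (real (Suc N) * sqsum N x)"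

text \<open>The quotient of \<open>cutoff\<close> by \<open>sqsum\<close> wherever the latter is
  positive. The lower bound in the denominator keeps it continuous and bounded across the zeros of
  \<open>sqsum\<close>.\<close>

definition weight :: "nat \<Rightarrow> 'm \<Rightarrow> real" where
  "weight N x = 1 / max (sqsum N x) (1 / real (Suc N))"

lemma sqsum_nonneg: "0 \<le> sqsum N x"
  by (simp add: sqsum_def sum_nonneg)

lemma continuous_sqsum: "continuous_on UNIV (sqsum N)"
  unfolding sqsum_def by (intro continuous_intros \<phi>_cont)

lemma continuous_cutoff: "continuous_on UNIV (cutoff N)"
  unfolding cutoff_def by (intro continuous_intros continuous_sqsum)

lemma max_sqsum_pos: "0 < max (sqsum N x) (1 / real (Suc N))"
  by (simp add: less_max_iff_disj)

lemma continuous_weight: "continuous_on UNIV (weight N)"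
  unfolding weight_def
  by (intro continuous_intros continuous_sqsum) (metis max_sqsum_pos less_irrefl)

lemma weight_nonneg: "0 \<le> weight N x"
  unfolding weight_def using max_sqsum_pos[of N x] by simp

lemma weight_le: "weight N x \<le> real (Suc N)"
proof -
  have "1 \<le> real (Suc N) * max (sqsum N x) (1 / real (Suc N))"
    using mult_left_mono[OF max.cobounded2[of "1 / real (Suc N)" "sqsum N x"], of "real (Suc N)"] by simp
  then show ?thesis unfolding weight_def using max_sqsum_pos[of N x] by (simp only: pos_divide_le_eq)
qed

lemma cutoff_weight: "cutoff N x = sqsum N x * weight N x"
proof (cases "sqsum N x \<le> 1 / real (Suc N)")
  case True
  then have "real (Suc N) * sqsum N x \<le> 1" by (simp add: field_simps)
  then show ?thesis using True by (simp add: cutoff_def weight_def max_def mult.commute)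
next
  case False
  then have "real (Suc N) * sqsum N x > 1" "sqsum N x > 0"
    using less_trans[of 0 "1 / real (Suc N)" "sqsum N x"] by (auto simp: field_simps)
  then show ?thesis using False by (simp add: cutoff_def weight_def max_def)
qed

lemma cutoff_range: "0 \<le> cutoff N x" "cutoff N x \<le> 1"
  using sqsum_nonneg[of N x] by (auto simp: cutoff_def)

lemma cutoff_mono:
  assumes "N \<le> N'"
  shows "cutoff N x \<le> cutoff N' x"
proof -
  have "sqsum N x \<le> sqsum N' x" unfolding sqsum_def by (rule sum_mono2) (use assms in auto)
  then have "real (Suc N) * sqsum N x \<le> real (Suc N') * sqsum N' x"
    using assms sqsum_nonneg by (intro mult_mono) auto
  then show ?thesis by (auto simp: cutoff_def)
qed

lemma ex_cutoff_gt: "\<exists>N. real (Suc N) * sqsum N x > 1"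
proof -
  obtain k where k: "\<phi> k x > 0" using \<phi>_cover by blast
  obtain n where n: "real n > 1 / (\<phi> k x)\<^sup>2" using reals_Archimedean2 by blast
  \<comment> \<open>\<open>Suc k\<close> is needed because the sum of squares runs over indices
    strictly below \<open>N\<close>.\<close>
  define N where "N = max n (Suc k)"
  have "1 < real n * (\<phi> k x)\<^sup>2" using n k by (simp add: field_simps)
  also have "\<dots> \<le> real (Suc N) * sqsum N x"
  proof (rule mult_mono)
    show "(\<phi> k x)\<^sup>2 \<le> sqsum N x" unfolding sqsum_def
      by (rule member_le_sum) (auto simp: N_def)
  qed (auto simp: N_def)
  finally show ?thesis by blast
qed

text \<open>The strict inequality of \<open>ex_cutoff_gt\<close> defines open sets, so finitely many
  indices suffice on \<open>K\<close>; monotonicity in \<open>N\<close> passes to the largest of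
  them.\<close>

lemma cutoff_compact:
  assumes "compact K"
  shows "\<exists>N. \<forall>n\<ge>N. \<forall>x\<in>K. cutoff n x = 1"
proof -
  define U where "U N = {x. real (Suc N) * sqsum N x > 1}" for N
  have op: "open (U N)" for N unfolding U_def
    by (intro open_Collect_less continuous_intros continuous_sqsum)
  have cov: "K \<subseteq> (\<Union>N\<in>UNIV. U N)" using ex_cutoff_gt by (auto simp: U_def)
  obtain J where J: "finite J" "K \<subseteq> (\<Union>N\<in>J. U N)"
    using compactE_image[OF assms op cov] by metis
  obtain N where N: "\<And>j. j \<in> J \<Longrightarrow> j \<le> N" using J(1) by (meson finite_nat_set_iff_bounded_le)
  have "cutoff n x = 1" if nN: "n \<ge> N" and xK: "x \<in> K" for n x
  proof -
    obtain j where j: "j \<in> J" "x \<in> U j" using J(2) xK by blast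
    then have "cutoff j x = 1" by (simp add: U_def cutoff_def)
    then show ?thesis using cutoff_mono[of j n x] cutoff_range(2)[of n x] N[OF j(1)] nN by simp
  qed
  then show ?thesis by blast
qed

lemma cutoff_tendsto: "(\<lambda>N. cutoff N x) \<longlonglongrightarrow> 1"
proof -
  obtain N where "\<forall>n\<ge>N. \<forall>y\<in>{x}. cutoff n y = 1" using cutoff_compact[of "{x}"] by auto
  then have "\<forall>\<^sub>F n in sequentially. cutoff n x = 1" by (auto simp: eventually_sequentially)
  then show ?thesis by (rule tendsto_eventually)
qed

lemma cutoff_expansion:
  assumes "\<omega> \<in> cotangent_space A x"
  shows "of_real (cutoff N x) *s \<omega> d =
    (\<Sum>(k, i)\<in>{..<N} \<times> UNIV. (of_real (weight N x) * ip x (coframe k i x) \<omega>) *s frame k i x d)"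
proof -
  have "of_real (cutoff N x) *s \<omega> d = (\<Sum>k<N. of_real (weight N x) *s (of_real ((\<phi> k x)\<^sup>2) *s \<omega> d))"
    by (simp add: vec_eq_iff cutoff_weight sqsum_def sum_distrib_left sum_distrib_right algebra_simps)
  also have "\<dots> = (\<Sum>k<N. \<Sum>i\<in>UNIV. (of_real (weight N x) * ip x (coframe k i x) \<omega>) *s frame k i x d)"
    using fun_cong[OF frame_expansion[OF assms]]
    by (simp add: vec_eq_iff sum_distrib_left mult.assoc)
  finally show ?thesis by (simp add: sum.cartesian_product)
qed

text \<open>After a cutoff, \<open>\<beta>\<close> is a finite combination of frames with bounded
  Borel coefficients. These are replaced by continuous functions close in \<open>L1\<close>, and the
  result is retracted to the unit ball.\<close>

lemma C0_dense:
  assumes M: "sets M = sets borel" "finite_measure M"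
    and \<beta>: "\<beta> \<in> borel_forms A" "\<And>x. nm x (\<beta> x) \<le> 1" and e: "e > 0"
  shows "\<exists>\<alpha>\<in>C0. (\<forall>x. nm x (\<alpha> x) \<le> 1) \<and>
    (LINT x|M. nm x (\<lambda>c. \<alpha> x c - \<beta> x c)) < e"
proof -
  interpret M: finite_measure M by fact
  have meas: "f \<in> borel_measurable M" if "f \<in> borel_measurable borel" for f :: "'m \<Rightarrow> 'z::topological_space"
    using that M(1) by (simp cong: measurable_cong_sets)
  have int_cut: "integrable M (cutoff N)" for N
    using integrable_continuous_bounded[OF M continuous_cutoff, of N 1] cutoff_range by simp
  have "(\<lambda>N. LINT x|M. cutoff N x) \<longlonglongrightarrow> (LINT x|M. 1)"
    by (rule integral_dominated_convergence[where w = "\<lambda>x. 1"])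
       (use cutoff_tendsto cutoff_range int_cut in auto)
  \<comment> \<open>The cutoff and the coefficients may each contribute \<open>e / 4\<close>,
    because the final retraction doubles the error; strictness comes from the cutoff.\<close>
  then have "\<forall>\<^sub>F N in sequentially. (LINT x|M. cutoff N x) > (LINT x|M. 1) - e / 4"
    using e by (intro order_tendstoD(1)) auto
  then obtain N where N: "(LINT x|M. cutoff N x) > (LINT x|M. 1) - e / 4"
    by (auto simp: eventually_sequentially)
  define J where "J = {..<N} \<times> (UNIV :: 'n set)"
  have J: "finite J" by (simp add: J_def)
  define fr where "fr = (\<lambda>(k, i). frame k i)"
  have fr: "fr j \<in> C0" for j by (simp add: fr_def frame_C0 split: prod.splits)
  have "\<exists>B. \<forall>x. nm x (fr j x) \<le> B" for j using C0_bounded[OF fr] by metis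
  then obtain F where F: "\<And>j x. nm x (fr j x) \<le> F j" by metis
  have F0: "0 \<le> F j" for j using order_trans[OF cov_norm_nonneg F] .
  define b where "b j x = of_real (weight N x) * ip x (coframe (fst j) (snd j) x) (\<beta> x)" for j x
  have int_b: "integrable M (b j)" for j
  proof -
    obtain B where B: "\<And>x. nm x (coframe (fst j) (snd j) x) \<le> B"
      using C0_bounded[OF coframe_C0] by blast
    have "cmod (b j x) \<le> real (Suc N) * B" for x
    proof -
      have "cmod (ip x (coframe (fst j) (snd j) x) (\<beta> x)) \<le> B * 1"
        by (intro order_trans[OF cov_cauchy_schwarz] mult_mono B \<beta>(2) order_trans[OF cov_norm_nonneg B] cov_norm_nonneg)
      then show ?thesis unfolding b_def norm_mult norm_of_real
        using weight_nonneg[of N x] weight_le[of N x] by (intro mult_mono) auto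
    qed
    moreover have "b j \<in> borel_measurable borel"
      unfolding b_def[abs_def]
      by (intro borel_measurable_times borel_cov_inner cont_borel[OF C0_cont[OF coframe_C0]] \<beta>(1)
          borel_measurable_continuous_onI continuous_on_of_real continuous_weight)
    ultimately show ?thesis
      by (intro M.integrable_const_bound[of _ "real (Suc N) * B"] AE_I2 meas) auto
  qed
  \<comment> \<open>Each coefficient error is multiplied by the bound \<open>F j\<close> of its
    frame form; adding 1 guards against a zero sum.\<close>
  define \<delta> where "\<delta> = e / (4 * (sum F J + 1))"
  have "sum F J \<ge> 0" using F0 by (simp add: sum_nonneg)
  then have \<delta>: "\<delta> > 0" "sum F J * \<delta> \<le> e / 4"
    unfolding \<delta>_def using e by (auto simp: field_simps)
  have "\<exists>h B. continuous_on UNIV h \<and> (\<forall>x. norm (h x) \<le> B) \<and> (LINT x|M. norm (b j x - h x)) < \<delta>" for j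
    using L1_approximable_integrable[OF open_cozero M int_b] \<delta>(1) unfolding L1_approximable_def by blast
  then obtain h B where h: "\<And>j. continuous_on UNIV (h j)" "\<And>j x. norm (h j x) \<le> B j"
    "\<And>j. (LINT x|M. norm (b j x - h j x)) < \<delta>" by metis
  have int_h: "integrable M (h j)" for j
    using integrable_continuous_bounded[OF M h(1,2)] .
  define \<gamma> where "\<gamma> = (\<lambda>x c. \<Sum>j\<in>J. h j x *s fr j x c)"
  have \<gamma>: "\<gamma> \<in> C0" unfolding \<gamma>_def by (intro C0_sum C0_scale[OF fr h(1,2)])
  obtain \<alpha> where \<alpha>: "\<alpha> \<in> C0" "\<And>x. nm x (\<alpha> x) \<le> 1"
    "\<And>x. nm x (\<lambda>c. \<alpha> x c - \<beta> x c) \<le> 2 * nm x (\<lambda>c. \<gamma> x c - \<beta> x c)"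
    using truncate_unit_ball[of \<gamma> \<beta>, OF \<gamma> \<beta>(2)] by blast
  have pt: "nm x (\<lambda>c. \<gamma> x c - \<beta> x c) \<le> (\<Sum>j\<in>J. norm (b j x - h j x) * F j) + (1 - cutoff N x)" for x
  proof -
    have cut: "of_real (cutoff N x) *s \<beta> x c = (\<Sum>j\<in>J. b j x *s fr j x c)" for c
      unfolding cutoff_expansion[OF borel_formsD(1)[OF \<beta>(1)]] J_def b_def fr_def
      by (simp add: split_beta)
    have "nm x (\<lambda>c. \<gamma> x c - of_real (cutoff N x) *s \<beta> x c) =
        nm x (\<lambda>c. \<Sum>j\<in>J. (h j x - b j x) *s fr j x c)"
      unfolding cut \<gamma>_def by (simp add: vec_eq_iff left_diff_distrib sum_subtractf vector_sub_rdistrib)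
    also have "\<dots> \<le> (\<Sum>j\<in>J. nm x (\<lambda>c. (h j x - b j x) *s fr j x c))" by (rule cov_norm_sum)
    also have "\<dots> \<le> (\<Sum>j\<in>J. norm (b j x - h j x) * F j)"
      unfolding cov_norm_scale by (intro sum_mono mult_mono F) (auto simp: norm_minus_commute)
    finally have 1: "nm x (\<lambda>c. \<gamma> x c - of_real (cutoff N x) *s \<beta> x c) \<le> (\<Sum>j\<in>J. norm (b j x - h j x) * F j)" .
    have "(\<lambda>c. of_real (cutoff N x) *s \<beta> x c - \<beta> x c) = (\<lambda>c. of_real (cutoff N x - 1) *s \<beta> x c)"
      by (simp add: fun_eq_iff vec_eq_iff algebra_simps)
    then have "nm x (\<lambda>c. of_real (cutoff N x) *s \<beta> x c - \<beta> x c) = \<bar>cutoff N x - 1\<bar> * nm x (\<beta> x)"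
      by (simp only: cov_norm_scale norm_of_real)
    also have "\<dots> \<le> \<bar>cutoff N x - 1\<bar> * 1" by (intro mult_left_mono \<beta>(2)) simp
    also have "\<dots> = 1 - cutoff N x" using cutoff_range(2)[of N x] by simp
    finally show ?thesis
      using 1 cov_norm_diff_triangle[of x "\<gamma> x" "\<beta> x" "\<lambda>c. of_real (cutoff N x) *s \<beta> x c"] by simp
  qed
  have ab: "(\<lambda>x. nm x (\<lambda>c. \<alpha> x c - \<beta> x c)) \<in> borel_measurable M"
    by (intro meas borel_cov_norm borel_diff cont_borel C0_cont \<alpha> \<beta>)
  have int_rhs: "integrable M (\<lambda>x. 2 * ((\<Sum>j\<in>J. norm (b j x - h j x) * F j) + (1 - cutoff N x)))"
    using int_b int_h int_cut by simp
  have bnd: "nm x (\<lambda>c. \<alpha> x c - \<beta> x c) \<le> 2 * ((\<Sum>j\<in>J. norm (b j x - h j x) * F j) + (1 - cutoff N x))" for x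
    using \<alpha>(3)[of x] pt[of x] by simp
  have "(LINT x|M. nm x (\<lambda>c. \<alpha> x c - \<beta> x c)) \<le>
    (LINT x|M. 2 * ((\<Sum>j\<in>J. norm (b j x - h j x) * F j) + (1 - cutoff N x)))"
  proof (rule integral_mono[OF _ int_rhs bnd])
    show "integrable M (\<lambda>x. nm x (\<lambda>c. \<alpha> x c - \<beta> x c))"
      by (rule Bochner_Integration.integrable_bound[OF int_rhs ab])
         (use bnd in \<open>auto intro!: AE_I2 intro: order_trans[OF bnd]\<close>)
  qed
  also have "\<dots> = 2 * ((\<Sum>j\<in>J. (LINT x|M. norm (b j x - h j x)) * F j) + ((LINT x|M. 1) - (LINT x|M. cutoff N x)))"
    using int_b int_h int_cut by simp
  also have "\<dots> < e"
  proof -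
    have "(\<Sum>j\<in>J. (LINT x|M. norm (b j x - h j x)) * F j) \<le> (\<Sum>j\<in>J. \<delta> * F j)"
      by (intro sum_mono mult_right_mono F0 less_imp_le h(3))
    also have "\<dots> = sum F J * \<delta>" by (simp add: sum_distrib_left mult.commute)
    finally show ?thesis using \<delta>(2) N by simp
  qed
  finally show ?thesis using \<alpha> by blast
qed

text \<open>The ideal test form is \<open>\<omega>\<close> divided by its norm, whose pairing with
  \<open>\<omega>\<close> is the norm itself. It is only Borel, so a \<open>C0\<close> form close to
  it is used instead.\<close>

lemma integral_cov_norm_le:
  assumes M: "sets M = sets borel" "finite_measure M"
    and \<omega>: "\<omega> \<in> borel_forms A" "integrable M (\<lambda>x. nm x (\<omega> x))"
    and C: "\<And>\<alpha>. \<alpha> \<in> C0 \<Longrightarrow> (\<And>x. nm x (\<alpha> x) \<le> 1) \<Longrightarrow>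
      cmod (LINT x|M. ip x (\<omega> x) (\<alpha> x)) \<le> C"
  shows "(LINT x|M. nm x (\<omega> x)) \<le> C"
proof (rule field_le_epsilon)
  fix e :: real assume e: "e > 0"
  interpret M: finite_measure M by fact
  have meas: "f \<in> borel_measurable M" if "f \<in> borel_measurable borel" for f :: "'m \<Rightarrow> 'z::topological_space"
    using that M(1) by (simp cong: measurable_cong_sets)
  define n where "n x = nm x (\<omega> x)" for x
  have n_borel: "n \<in> borel_measurable borel" unfolding n_def[abs_def] by (rule borel_cov_norm[OF \<omega>(1)])
  have n_meas: "n \<in> borel_measurable M" by (rule meas[OF n_borel])
  have n0: "0 \<le> n x" for x by (simp add: n_def)
  have int_n: "integrable M n" using \<omega>(2) by (simp add: n_def[abs_def])
  \<comment> \<open>Replacing the test form costs at most the norm of \<open>\<omega>\<close> times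
    the pointwise distance. The approximation must therefore be good for \<open>M\<close> weighted
    by that norm.\<close>
  define \<rho> where "\<rho> = density M (\<lambda>x. ennreal (n x))"
  have sets_\<rho>: "sets \<rho> = sets borel" by (simp add: \<rho>_def M(1))
  have "finite_measure \<rho>" unfolding \<rho>_def by (rule finite_measure_densityI[OF int_n n0])
  \<comment> \<open>Where \<open>\<omega>\<close> vanishes, \<open>1 / 0 = 0\<close> makes
    \<open>\<beta>\<close> vanish too, and the pairing below is still equal to
    \<open>n x\<close>.\<close>
  define \<beta> where "\<beta> = (\<lambda>x c. complex_of_real (1 / n x) *s \<omega> x c)"
  have \<beta>: "\<beta> \<in> borel_forms A" unfolding \<beta>_def
    using n_borel by (intro borel_scale \<omega>(1)) measurable
  have \<beta>1: "nm x (\<beta> x) \<le> 1" for x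
    unfolding \<beta>_def cov_norm_scale norm_of_real using n0[of x] by (simp add: divide_simps flip: n_def)
  obtain \<alpha> where \<alpha>: "\<alpha> \<in> C0" "\<And>x. nm x (\<alpha> x) \<le> 1"
    "(LINT x|\<rho>. nm x (\<lambda>c. \<alpha> x c - \<beta> x c)) < e"
    using C0_dense[OF sets_\<rho> \<open>finite_measure \<rho>\<close> \<beta> \<beta>1 e] by blast
  have \<alpha>b: "\<alpha> \<in> borel_forms A" by (intro cont_borel C0_cont \<alpha>)
  have int: "integrable M (\<lambda>x. ip x (\<omega> x) (\<eta> x))"
    if "\<eta> \<in> borel_forms A" "\<And>x. nm x (\<eta> x) \<le> 1" for \<eta>
  proof (rule Bochner_Integration.integrable_bound[OF int_n])
    show "(\<lambda>x. ip x (\<omega> x) (\<eta> x)) \<in> borel_measurable M"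
      by (intro meas borel_cov_inner \<omega> that)
    have "cmod (ip x (\<omega> x) (\<eta> x)) \<le> n x * 1" for x
      unfolding n_def by (intro order_trans[OF cov_cauchy_schwarz] mult_left_mono that) simp
    then show "AE x in M. cmod (ip x (\<omega> x) (\<eta> x)) \<le> norm (n x)" using n0 by simp
  qed
  have int_ab: "integrable M (\<lambda>x. n x * nm x (\<lambda>c. \<alpha> x c - \<beta> x c))"
  proof (rule Bochner_Integration.integrable_bound[of _ "\<lambda>x. 2 * n x"])
    show "(\<lambda>x. n x * nm x (\<lambda>c. \<alpha> x c - \<beta> x c)) \<in> borel_measurable M"
      by (intro borel_measurable_times n_meas meas borel_cov_norm borel_diff \<alpha>b \<beta>)
    have "n x * nm x (\<lambda>c. \<alpha> x c - \<beta> x c) \<le> n x * 2" for x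
      using cov_norm_minus[of x "\<alpha> x" "\<beta> x"] \<alpha>(2)[of x] \<beta>1[of x] by (intro mult_left_mono n0) simp
    then show "AE x in M. norm (n x * nm x (\<lambda>c. \<alpha> x c - \<beta> x c)) \<le> norm (2 * n x)"
      using n0 by (simp add: mult.commute)
  qed (use int_n in simp)
  have "ip x (\<omega> x) (\<beta> x) = of_real (n x)" for x
    unfolding \<beta>_def cov_inner_scale_right cov_inner_self
    by (simp add: power2_eq_square flip: n_def)
  then have "of_real (LINT x|M. n x) = (LINT x|M. ip x (\<omega> x) (\<beta> x))" by simp
  also have "\<dots> = (LINT x|M. ip x (\<omega> x) (\<alpha> x)) - (LINT x|M. ip x (\<omega> x) (\<lambda>c. \<alpha> x c - \<beta> x c))"
    using int[OF \<alpha>b \<alpha>(2)] int[OF \<beta> \<beta>1] by (simp add: cov_inner_diff_right)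
  finally have "cmod (of_real (LINT x|M. n x)) \<le> cmod (LINT x|M. ip x (\<omega> x) (\<alpha> x)) +
      cmod (LINT x|M. ip x (\<omega> x) (\<lambda>c. \<alpha> x c - \<beta> x c))"
    by (simp add: norm_triangle_ineq4)
  also have "cmod (LINT x|M. ip x (\<omega> x) (\<alpha> x)) \<le> C" by (rule C[OF \<alpha>(1,2)])
  also have "cmod (LINT x|M. ip x (\<omega> x) (\<lambda>c. \<alpha> x c - \<beta> x c)) \<le>
      (LINT x|M. n x * nm x (\<lambda>c. \<alpha> x c - \<beta> x c))"
  proof (rule order_trans[OF integral_norm_bound integral_mono[OF _ int_ab]])
    show "integrable M (\<lambda>x. cmod (ip x (\<omega> x) (\<lambda>c. \<alpha> x c - \<beta> x c)))"
      using int[OF \<alpha>b \<alpha>(2)] int[OF \<beta> \<beta>1] by (simp add: cov_inner_diff_right)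
    show "cmod (ip x (\<omega> x) (\<lambda>c. \<alpha> x c - \<beta> x c)) \<le> n x * nm x (\<lambda>c. \<alpha> x c - \<beta> x c)" for x
      unfolding n_def by (rule cov_cauchy_schwarz)
  qed
  also have "\<dots> = (LINT x|\<rho>. nm x (\<lambda>c. \<alpha> x c - \<beta> x c))"
    unfolding \<rho>_def using n0 n_meas
    by (subst integral_density) (auto intro!: meas borel_cov_norm borel_diff \<alpha>b \<beta>)
  also have "\<dots> < e" by (rule \<alpha>(3))
  finally show "(LINT x|M. nm x (\<omega> x)) \<le> C + e" by (simp add: n_def)
qed

corollary AE_zero_form:
  assumes M: "sets M = sets borel" "finite_measure M"
    and \<omega>: "\<omega> \<in> borel_forms A" "integrable M (\<lambda>x. nm x (\<omega> x))"
    and zero: "\<And>\<alpha>. \<alpha> \<in> C0 \<Longrightarrow> (LINT x|M. ip x (\<omega> x) (\<alpha> x)) = 0"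
  shows "AE x in M. \<omega> x = (\<lambda>c. 0)"
proof -
  have "(LINT x|M. nm x (\<omega> x)) \<le> 0"
    by (rule integral_cov_norm_le[OF M \<omega>]) (simp add: zero)
  moreover have "0 \<le> (LINT x|M. nm x (\<omega> x))" by (simp add: Bochner_Integration.integral_nonneg)
  ultimately have "(LINT x|M. nm x (\<omega> x)) = 0" by simp
  then have "AE x in M. nm x (\<omega> x) = 0"
    using integral_nonneg_eq_0_iff_AE[OF \<omega>(2)] by simp
  then show ?thesis by (rule eventually_mono) (rule cov_norm_eq_0[OF borel_formsD(1)[OF \<omega>(1)]])
qed

end

section \<open>Representation of vector measures\<close>

context riemannian
begin

lemma vector_measure_add:
  assumes "T \<in> vector_measures A g" "\<alpha> \<in> C0" "\<beta> \<in> C0"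
  shows "T (\<lambda>x c. \<alpha> x c + \<beta> x c) = T \<alpha> + T \<beta>"
  using assms by (auto simp: vector_measures_def)

lemma vector_measure_scale:
  assumes "T \<in> vector_measures A g" "\<alpha> \<in> C0"
  shows "T (\<lambda>x c. a *s \<alpha> x c) = a * T \<alpha>"
  using assms by (auto simp: vector_measures_def)

lemma vector_measure_sum:
  assumes T: "T \<in> vector_measures A g" and \<alpha>: "\<And>i. i \<in> I \<Longrightarrow> \<alpha> i \<in> C0"
  shows "T (\<lambda>x c. \<Sum>i\<in>I. \<alpha> i x c) = (\<Sum>i\<in>I. T (\<alpha> i))"
proof -
  have 0: "T (\<lambda>x c. 0) = 0" using vector_measure_scale[OF T zero_C0, of 0] by simp
  show ?thesis
    using \<alpha>
  proof (induction I rule: infinite_finite_induct)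
    case (insert i I)
    then show ?case using vector_measure_add[OF T, of "\<alpha> i" "\<lambda>x c. \<Sum>i\<in>I. \<alpha> i x c"] by (simp add: C0_sum)
  qed (simp_all add: 0)
qed

lemma vector_measure_bound:
  assumes "T \<in> vector_measures A g"
  obtains C where "0 \<le> C" "\<And>\<alpha> b. \<alpha> \<in> C0 \<Longrightarrow> (\<And>x. nm x (\<alpha> x) \<le> b) \<Longrightarrow> cmod (T \<alpha>) \<le> C * b"
proof -
  obtain C where C: "\<And>\<alpha>. \<alpha> \<in> C0 \<Longrightarrow> cmod (T \<alpha>) \<le> C * sup_norm A g \<alpha>"
    using assms unfolding vector_measures_def by blast
  have "cmod (T \<alpha>) \<le> \<bar>C\<bar> * b" if "\<alpha> \<in> C0" "\<And>x. nm x (\<alpha> x) \<le> b" for \<alpha> b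
  proof -
    have "0 \<le> sup_norm A g \<alpha>"
      using order_trans[OF cov_norm_nonneg cov_norm_le_sup_norm[OF that(1)]] .
    then have "C * sup_norm A g \<alpha> \<le> \<bar>C\<bar> * b"
      using sup_norm_le[of \<alpha> b, OF that(2)] by (intro mult_mono) auto
    then show ?thesis using C[OF that(1)] by simp
  qed
  then show thesis by (intro that[of "\<bar>C\<bar>"]) auto
qed

text \<open>\<open>Riesz_family\<close> evaluates its functionals at unbounded continuous functions
  as well; compact support of the form compensates for the missing bound on
  \<open>f\<close>.\<close>

lemma C0_scale_compact:
  assumes \<alpha>: "\<alpha> \<in> C0" and K: "compact K" "\<And>x. x \<notin> K \<Longrightarrow> \<alpha> x = (\<lambda>c. 0)"
    and f: "continuous_on UNIV f"
  shows "(\<lambda>x c. f x *s \<alpha> x c) \<in> C0"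
proof (rule C0_formsI)
  show "(\<lambda>x c. f x *s \<alpha> x c) \<in> cont_forms"
    using C0_cont[OF \<alpha>] f unfolding cont_forms_def one_forms_def
    by (auto intro!: scale_cotangent continuous_intros continuous_on_subset[OF f])
  show "\<exists>K. compact K \<and> (\<forall>x. x \<notin> K \<longrightarrow> nm x (\<lambda>c. f x *s \<alpha> x c) < e)" if "e > 0" for e
    using K that by (intro exI[of _ K]) simp
qed

end

section \<open>From scalar measures to a locally representing form\<close>

context riemannian_cover
begin

text \<open>The scalar theorem concerns real functions; complex coefficients are recovered by
  splitting \<open>f\<close> and using complex linearity of \<open>T\<close>.\<close>

lemma coefficient_measures:
  assumes T: "T \<in> vector_measures A g"
  shows "\<exists>\<mu> H. sets \<mu> = sets borel \<and> finite_measure \<mu> \<and> (\<forall>j. integrable \<mu> (H j)) \<and>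
    (\<forall>k i f B. continuous_on UNIV f \<longrightarrow> (\<forall>x. cmod (f x) \<le> B) \<longrightarrow>
      T (\<lambda>x c. f x *s frame k i x c) = (LINT x|\<mu>. f x * H (k, i) x))"
proof -
  obtain C where C: "0 \<le> C" "\<And>\<alpha> b. \<alpha> \<in> C0 \<Longrightarrow> (\<And>x. nm x (\<alpha> x) \<le> b) \<Longrightarrow> cmod (T \<alpha>) \<le> C * b"
    using vector_measure_bound[OF T] by blast
  define F where "F j f = T (\<lambda>x c. of_real (f x) *s frame (fst j) (snd j) x c)" for j and f :: "'m \<Rightarrow> real"
  have C0: "(\<lambda>x c. f x *s frame k i x c) \<in> C0" if "continuous_on UNIV f" for f k i
    by (rule C0_scale_compact[OF frame_C0 supp(1) frame_supp that])
  have "\<exists>B. \<forall>x. nm x (frame (fst j) (snd j) x) \<le> B" for j :: "nat \<times> 'n"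
    using C0_bounded[OF frame_C0] by metis
  then obtain B where B: "\<And>j x. nm x (frame (fst j) (snd j) x) \<le> B j" by metis
  have B0: "0 \<le> B j" for j using order_trans[OF cov_norm_nonneg B] .
  have "\<exists>\<mu> H. sets \<mu> = sets borel \<and> finite_measure \<mu> \<and> (\<forall>i. integrable \<mu> (H i)) \<and>
    (\<forall>i f B. continuous_on UNIV f \<longrightarrow> (\<forall>x. \<bar>f x\<bar> \<le> B) \<longrightarrow> F i f = (LINT x|\<mu>. of_real (f x) * H i x))"
  proof (rule Riesz_family[OF open_cozero, where K = "\<lambda>j. supp (fst j)" and C = "\<lambda>j. C * B j"])
    fix j :: "nat \<times> 'n" and f h assume "continuous_on UNIV (f :: 'm \<Rightarrow> real)" "continuous_on UNIV (h :: 'm \<Rightarrow> real)"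
    then show "F j (\<lambda>x. f x + h x) = F j f + F j h"
      using vector_measure_add[OF T C0 C0, of "\<lambda>x. of_real (f x)" "\<lambda>x. of_real (h x)" "fst j" "snd j" "fst j" "snd j"]
      by (simp add: F_def continuous_on_of_real vector_sadd_rdistrib)
  next
    fix j :: "nat \<times> 'n" and f and a :: real assume "continuous_on UNIV (f :: 'm \<Rightarrow> real)"
    then show "F j (\<lambda>x. a * f x) = of_real a * F j f"
      using vector_measure_scale[OF T C0, of "\<lambda>x. of_real (f x)" "of_real a" "fst j" "snd j"]
      by (simp add: F_def continuous_on_of_real vector_smult_assoc)
  next
    fix j :: "nat \<times> 'n" and f b assume f: "continuous_on UNIV (f :: 'm \<Rightarrow> real)" "0 \<le> b" "\<And>x. x \<in> supp (fst j) \<Longrightarrow> \<bar>f x\<bar> \<le> b"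
    have "nm x (\<lambda>c. of_real (f x) *s frame (fst j) (snd j) x c) \<le> B j * b" for x
    \<comment> \<open>Off the support the frame vanishes, so only the values of \<open>f\<close> on
      a compact set enter, as \<open>Riesz_family\<close> requires.\<close>
    proof (cases "x \<in> supp (fst j)")
      case True
      have "\<bar>f x\<bar> * nm x (frame (fst j) (snd j) x) \<le> b * B j"
        by (intro mult_mono f True B) (use f in auto)
      then show ?thesis unfolding cov_norm_scale norm_of_real by (simp add: mult.commute)
    next
      case False
      then show ?thesis using f B0 by (simp add: frame_supp)
    qed
    then show "cmod (F j f) \<le> C * B j * b"
      using C(2)[OF C0, of "\<lambda>x. of_real (f x)"] f(1) by (simp add: F_def continuous_on_of_real mult.assoc)
  qed (assumption, rule supp(1))
  then obtain \<mu> H where \<mu>: "sets \<mu> = sets borel" "finite_measure \<mu>" "\<And>i. integrable \<mu> (H i)"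
    and H: "\<And>i f B. continuous_on UNIV f \<Longrightarrow> (\<And>x. \<bar>f x\<bar> \<le> B) \<Longrightarrow> F i f = (LINT x|\<mu>. of_real (f x) * H i x)"
    by blast
  have "T (\<lambda>x c. f x *s frame k i x c) = (LINT x|\<mu>. f x * H (k, i) x)"
    if f: "continuous_on UNIV f" "\<And>x. cmod (f x) \<le> b" for k i f b
  proof -
    have re: "continuous_on UNIV (\<lambda>x. Re (f x))" "\<bar>Re (f x)\<bar> \<le> b" for x
      using f abs_Re_le_cmod[of "f x"] order_trans by (auto intro!: continuous_intros)
    have im: "continuous_on UNIV (\<lambda>x. Im (f x))" "\<bar>Im (f x)\<bar> \<le> b" for x
      using f abs_Im_le_cmod[of "f x"] order_trans by (auto intro!: continuous_intros)
    have int: "integrable \<mu> (\<lambda>x. complex_of_real (h x) * H (k, i) x)"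
      if "continuous_on UNIV h" "\<And>x. \<bar>h x\<bar> \<le> b" for h :: "'m \<Rightarrow> real"
    proof (rule integrable_bounded_mult[OF \<mu>(3), of _ b])
      have "(\<lambda>x. complex_of_real (h x)) \<in> borel_measurable borel"
        using that(1) by (intro borel_measurable_continuous_onI continuous_on_of_real)
      then show "(\<lambda>x. complex_of_real (h x)) \<in> borel_measurable \<mu>"
        using \<mu>(1) by (simp cong: measurable_cong_sets)
    qed (use that(2) in simp)
    have split: "f x = of_real (Re (f x)) + \<i> * of_real (Im (f x))" for x by (simp add: complex_eq)
    let ?R = "\<lambda>x c. complex_of_real (Re (f x)) *s frame k i x c" and ?I = "\<lambda>x c. complex_of_real (Im (f x)) *s frame k i x c"
    have C0R: "?R \<in> C0" and C0I: "?I \<in> C0"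
      using re(1) im(1) by (auto intro!: C0 continuous_on_of_real)
    have C0I': "(\<lambda>x c. \<i> *s ?I x c) \<in> C0" by (rule C0_scale[OF C0I, of _ 1]) auto
    have "T (\<lambda>x c. f x *s frame k i x c) = T (\<lambda>x c. ?R x c + \<i> *s ?I x c)"
      by (subst split) (simp add: vector_sadd_rdistrib vector_smult_assoc)
    also have "\<dots> = F (k, i) (\<lambda>x. Re (f x)) + \<i> * F (k, i) (\<lambda>x. Im (f x))"
      unfolding vector_measure_add[OF T C0R C0I'] vector_measure_scale[OF T C0I] by (simp add: F_def)
    also have "\<dots> = (LINT x|\<mu>. of_real (Re (f x)) * H (k, i) x) + (LINT x|\<mu>. \<i> * (of_real (Im (f x)) * H (k, i) x))"
      unfolding H[OF re] H[OF im] by simp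
    also have "\<dots> = (LINT x|\<mu>. of_real (Re (f x)) * H (k, i) x + \<i> * (of_real (Im (f x)) * H (k, i) x))"
      using int[OF re] int[OF im] by (intro Bochner_Integration.integral_add[symmetric]) auto
    also have "\<dots> = (LINT x|\<mu>. f x * H (k, i) x)"
      by (intro Bochner_Integration.integral_cong refl) (subst (3) split, simp add: algebra_simps)
    finally show ?thesis .
  qed
  then show ?thesis using \<mu> by blast
qed

text \<open>In the frame expansion of \<open>\<alpha>\<close> the coefficients are pairings with
  coframes. Applying \<open>T\<close> termwise and moving the densities into the first slot
  assembles the form \<open>\<sigma> k\<close>.\<close>

lemma local_representation:
  assumes T: "T \<in> vector_measures A g"
  shows "\<exists>\<mu> \<sigma>. sets \<mu> = sets borel \<and> finite_measure \<mu> \<and>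
    (\<forall>k. \<sigma> k \<in> borel_forms A \<and> integrable \<mu> (\<lambda>x. nm x (\<sigma> k x)) \<and>
      (\<forall>\<alpha>\<in>C0. T (\<lambda>x c. of_real ((\<phi> k x)\<^sup>2) *s \<alpha> x c) = (LINT x|\<mu>. ip x (\<sigma> k x) (\<alpha> x))))"
proof -
  obtain \<mu> H where \<mu>: "sets \<mu> = sets borel" "finite_measure \<mu>" and intH: "\<And>j. integrable \<mu> (H j)"
    and H: "\<And>k i f B. continuous_on UNIV f \<Longrightarrow> (\<And>x. cmod (f x) \<le> B) \<Longrightarrow>
      T (\<lambda>x c. f x *s frame k i x c) = (LINT x|\<mu>. f x * H (k, i) x)"
    using coefficient_measures[OF T] by blast
  have meas: "f \<in> borel_measurable \<mu> \<longleftrightarrow> f \<in> borel_measurable borel" for f :: "'m \<Rightarrow> 'z::topological_space"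
    using \<mu>(1) by (simp cong: measurable_cong_sets)
  have Hb: "H j \<in> borel_measurable borel" for j using borel_measurable_integrable[OF intH] by (simp add: meas)
  \<comment> \<open>The conjugate cancels against the conjugate-linear first argument of the inner
    product.\<close>
  define \<sigma> where "\<sigma> k = (\<lambda>x c. \<Sum>i\<in>UNIV. cnj (H (k, i) x) *s coframe k i x c)" for k
  have cnjH: "(\<lambda>x. cnj (H j x)) \<in> borel_measurable borel" for j
    by (rule borel_measurable_continuous_on[OF _ Hb]) (intro continuous_intros)
  have \<sigma>: "\<sigma> k \<in> borel_forms A" for k
    unfolding \<sigma>_def by (intro borel_sum borel_scale cnjH cont_borel C0_cont coframe_C0)
  have "\<exists>B. \<forall>x. nm x (coframe k i x) \<le> B" for k i
    using C0_bounded[OF coframe_C0] by metis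
  then obtain B where B: "\<And>k i x. nm x (coframe k i x) \<le> B k i" by metis
  have int\<sigma>: "integrable \<mu> (\<lambda>x. nm x (\<sigma> k x))" for k
  proof (rule Bochner_Integration.integrable_bound)
    show "integrable \<mu> (\<lambda>x. \<Sum>i\<in>UNIV. B k i * norm (H (k, i) x))" using intH by simp
    show "(\<lambda>x. nm x (\<sigma> k x)) \<in> borel_measurable \<mu>" unfolding meas by (rule borel_cov_norm[OF \<sigma>])
    have "nm x (\<sigma> k x) \<le> (\<Sum>i\<in>UNIV. B k i * norm (H (k, i) x))" for x
    proof -
      have "nm x (\<sigma> k x) \<le> (\<Sum>i\<in>UNIV. nm x (\<lambda>c. cnj (H (k, i) x) *s coframe k i x c))"
        unfolding \<sigma>_def by (rule cov_norm_sum)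
      also have "\<dots> \<le> (\<Sum>i\<in>UNIV. B k i * norm (H (k, i) x))"
        unfolding cov_norm_scale by (intro sum_mono) (simp add: mult.commute[of "B k _"] mult_left_mono B)
      finally show ?thesis .
    qed
    then show "AE x in \<mu>. norm (nm x (\<sigma> k x)) \<le> norm (\<Sum>i\<in>UNIV. B k i * norm (H (k, i) x))"
      by (intro AE_I2) (auto intro: order_trans[OF _ abs_ge_self])
  qed
  have "T (\<lambda>x c. of_real ((\<phi> k x)\<^sup>2) *s \<alpha> x c) = (LINT x|\<mu>. ip x (\<sigma> k x) (\<alpha> x))"
    if \<alpha>: "\<alpha> \<in> C0" for k \<alpha>
  proof -
    define f where "f i x = ip x (coframe k i x) (\<alpha> x)" for i x
    have fc: "continuous_on UNIV (f i)" for i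
      unfolding f_def by (intro continuous_cov_inner C0_cont coframe_C0 \<alpha>)
    obtain b where b: "\<And>x. nm x (\<alpha> x) \<le> b" using C0_bounded[OF \<alpha>] by blast
    have fb: "cmod (f i x) \<le> B k i * b" for i x
      unfolding f_def by (intro order_trans[OF cov_cauchy_schwarz] mult_mono B b cov_norm_nonneg order_trans[OF cov_norm_nonneg B])
    have "(\<lambda>x c. of_real ((\<phi> k x)\<^sup>2) *s \<alpha> x c) = (\<lambda>x c. \<Sum>i\<in>UNIV. f i x *s frame k i x c)"
      unfolding f_def using frame_expansion[OF cont_formsD(1)[OF C0_cont[OF \<alpha>]]] by (intro ext) (rule fun_cong)
    then have "T (\<lambda>x c. of_real ((\<phi> k x)\<^sup>2) *s \<alpha> x c) = (\<Sum>i\<in>UNIV. T (\<lambda>x c. f i x *s frame k i x c))"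
      by (simp only:) (intro vector_measure_sum[OF T] C0_scale[OF frame_C0 fc fb])
    also have "\<dots> = (\<Sum>i\<in>UNIV. (LINT x|\<mu>. f i x * H (k, i) x))"
      by (intro sum.cong refl H[OF fc fb])
    also have "\<dots> = (LINT x|\<mu>. (\<Sum>i\<in>UNIV. f i x * H (k, i) x))"
      by (intro Bochner_Integration.integral_sum[symmetric] integrable_bounded_mult[OF intH _ fb])
         (auto simp: meas intro: borel_measurable_continuous_onI fc)
    also have "\<dots> = (LINT x|\<mu>. ip x (\<sigma> k x) (\<alpha> x))"
      unfolding \<sigma>_def cov_inner_sum_left cov_inner_scale_left f_def by (simp add: mult.commute)
    finally show ?thesis .
  qed
  then show ?thesis using \<mu> \<sigma> int\<sigma> by blast
qed

lemma integrable_cov_inner: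
  assumes \<mu>: "sets \<mu> = sets borel" and \<omega>: "\<omega> \<in> borel_forms A" "integrable \<mu> (\<lambda>x. nm x (\<omega> x))"
    and \<alpha>: "\<alpha> \<in> C0"
  shows "integrable \<mu> (\<lambda>x. ip x (\<omega> x) (\<alpha> x))"
proof -
  obtain b where b: "\<And>x. nm x (\<alpha> x) \<le> b" using C0_bounded[OF \<alpha>] by blast
  show ?thesis
  proof (rule Bochner_Integration.integrable_bound)
    show "integrable \<mu> (\<lambda>x. nm x (\<omega> x) * b)" using \<omega>(2) by simp
    have "(\<lambda>x. ip x (\<omega> x) (\<alpha> x)) \<in> borel_measurable borel"
      by (intro borel_cov_inner \<omega> cont_borel C0_cont \<alpha>)
    then show "(\<lambda>x. ip x (\<omega> x) (\<alpha> x)) \<in> borel_measurable \<mu>"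
      using \<mu> by (simp cong: measurable_cong_sets)
    have "cmod (ip x (\<omega> x) (\<alpha> x)) \<le> nm x (\<omega> x) * b" for x
      by (intro order_trans[OF cov_cauchy_schwarz] mult_left_mono b cov_norm_nonneg)
    then show "AE x in \<mu>. cmod (ip x (\<omega> x) (\<alpha> x)) \<le> norm (nm x (\<omega> x) * b)"
      by (intro AE_I2) (auto intro: order_trans[OF _ abs_ge_self])
  qed
qed

lemma C0_bounded_real_scale:
  assumes "\<alpha> \<in> C0" "continuous_on UNIV f" "\<And>x. \<bar>f x\<bar> \<le> B"
  shows "(\<lambda>x c. complex_of_real (f x) *s \<alpha> x c) \<in> C0"
  by (rule C0_scale[OF assms(1), of _ B]) (use assms in \<open>auto intro: continuous_on_of_real\<close>)

text \<open>Dividing by \<open>(\<phi> k x)\<^sup>2\<close> can destroy integrability near the zeros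
  of \<open>\<phi> k\<close>. Hence integrability of \<open>\<tau>\<close> is claimed only after
  multiplication by such a square.\<close>

lemma glued_representation:
  assumes T: "T \<in> vector_measures A g"
  shows "\<exists>\<mu> \<tau>. sets \<mu> = sets borel \<and> finite_measure \<mu> \<and> \<tau> \<in> borel_forms A \<and>
    (\<forall>k. integrable \<mu> (\<lambda>x. (\<phi> k x)\<^sup>2 * nm x (\<tau> x)) \<and>
      (\<forall>\<alpha>\<in>C0. T (\<lambda>x c. of_real ((\<phi> k x)\<^sup>2) *s \<alpha> x c) =
         (LINT x|\<mu>. of_real ((\<phi> k x)\<^sup>2) * ip x (\<tau> x) (\<alpha> x))))"
proof -
  obtain \<mu> \<sigma> where \<mu>: "sets \<mu> = sets borel" "finite_measure \<mu>" and \<sigma>: "\<And>k. \<sigma> k \<in> borel_forms A"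
    and int: "\<And>k. integrable \<mu> (\<lambda>x. nm x (\<sigma> k x))"
    and rep: "\<And>k \<alpha>. \<alpha> \<in> C0 \<Longrightarrow>
      T (\<lambda>x c. of_real ((\<phi> k x)\<^sup>2) *s \<alpha> x c) = (LINT x|\<mu>. ip x (\<sigma> k x) (\<alpha> x))"
    using local_representation[OF T] by blast
  have \<phi>2: "continuous_on UNIV (\<lambda>x. (\<phi> k x)\<^sup>2)" "\<bar>(\<phi> k x)\<^sup>2\<bar> \<le> 1" for k x
    using \<phi>_le1[of k x] \<phi>_nonneg[of k x] by (auto intro!: continuous_intros \<phi>_cont power_le_one)
  have \<phi>2b: "(\<lambda>x. complex_of_real ((\<phi> k x)\<^sup>2)) \<in> borel_measurable borel" for k
    by (intro borel_measurable_continuous_onI continuous_on_of_real \<phi>2)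
  have compat: "AE x in \<mu>. (\<lambda>c. of_real ((\<phi> j x)\<^sup>2) *s \<sigma> k x c) = (\<lambda>c. of_real ((\<phi> k x)\<^sup>2) *s \<sigma> j x c)" for j k
  proof -
    \<comment> \<open>Compatibility is tested in cross-multiplied form, which avoids division and
      stays integrable. Both terms represent \<open>T\<close> on \<open>\<alpha>\<close> multiplied
      by the two squares, so the difference represents 0.\<close>
    define \<omega> where "\<omega> = (\<lambda>x c. of_real ((\<phi> j x)\<^sup>2) *s \<sigma> k x c - of_real ((\<phi> k x)\<^sup>2) *s \<sigma> j x c)"
    have \<omega>: "\<omega> \<in> borel_forms A" unfolding \<omega>_def by (intro borel_diff borel_scale \<sigma> \<phi>2b)
    have le: "nm x (\<omega> x) \<le> nm x (\<sigma> k x) + nm x (\<sigma> j x)" for x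
    proof -
      have "nm x (\<omega> x) \<le> \<bar>(\<phi> j x)\<^sup>2\<bar> * nm x (\<sigma> k x) + \<bar>(\<phi> k x)\<^sup>2\<bar> * nm x (\<sigma> j x)"
        unfolding \<omega>_def using cov_norm_minus[of x "\<lambda>c. of_real ((\<phi> j x)\<^sup>2) *s \<sigma> k x c" "\<lambda>c. of_real ((\<phi> k x)\<^sup>2) *s \<sigma> j x c"]
        by (simp only: cov_norm_scale norm_of_real)
      also have "\<dots> \<le> 1 * nm x (\<sigma> k x) + 1 * nm x (\<sigma> j x)"
        by (intro add_mono mult_right_mono \<phi>2 cov_norm_nonneg)
      finally show ?thesis by simp
    qed
    have int\<omega>: "integrable \<mu> (\<lambda>x. nm x (\<omega> x))"
    proof (rule Bochner_Integration.integrable_bound)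
      show "integrable \<mu> (\<lambda>x. nm x (\<sigma> k x) + nm x (\<sigma> j x))" using int by simp
      show "(\<lambda>x. nm x (\<omega> x)) \<in> borel_measurable \<mu>"
        using borel_cov_norm[OF \<omega>] \<mu>(1) by (simp cong: measurable_cong_sets)
    qed (use le in \<open>auto intro!: AE_I2\<close>)
    have "AE x in \<mu>. \<omega> x = (\<lambda>c. 0)"
    proof (rule AE_zero_form[OF \<mu> \<omega> int\<omega>])
      fix \<alpha> assume \<alpha>: "\<alpha> \<in> C0"
      have C0: "(\<lambda>x c. complex_of_real ((\<phi> l x)\<^sup>2) *s \<alpha> x c) \<in> C0" for l
        by (rule C0_bounded_real_scale[OF \<alpha> \<phi>2])
      have "ip x (\<omega> x) (\<alpha> x) =
          ip x (\<sigma> k x) (\<lambda>c. of_real ((\<phi> j x)\<^sup>2) *s \<alpha> x c) -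
          ip x (\<sigma> j x) (\<lambda>c. of_real ((\<phi> k x)\<^sup>2) *s \<alpha> x c)" for x
        by (simp add: \<omega>_def cov_inner_diff_left cov_inner_scale_left cov_inner_scale_right)
      then have "(LINT x|\<mu>. ip x (\<omega> x) (\<alpha> x)) =
          (LINT x|\<mu>. ip x (\<sigma> k x) (\<lambda>c. of_real ((\<phi> j x)\<^sup>2) *s \<alpha> x c)) -
          (LINT x|\<mu>. ip x (\<sigma> j x) (\<lambda>c. of_real ((\<phi> k x)\<^sup>2) *s \<alpha> x c))"
        using integrable_cov_inner[OF \<mu>(1) \<sigma> int C0] by simp
      also have "\<dots> = 0" unfolding rep[OF C0, symmetric]
        by (simp add: vector_smult_assoc mult.commute)
      finally show "(LINT x|\<mu>. ip x (\<omega> x) (\<alpha> x)) = 0" .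
    qed
    then show ?thesis by (rule eventually_mono) (auto simp: \<omega>_def fun_eq_iff)
  qed
  \<comment> \<open>The least index with a positive value selects one quotient per point in a
    measurable way.\<close>
  define first where "first x = (LEAST k. \<phi> k x > 0)" for x
  have first: "\<phi> (first x) x > 0" for x unfolding first_def by (rule LeastI_ex[OF \<phi>_cover])
  define \<tau> where "\<tau> = (\<lambda>x c. complex_of_real (1 / (\<phi> (first x) x)\<^sup>2) *s \<sigma> (first x) x c)"
  have first_meas: "first \<in> measurable borel (count_space UNIV)"
    unfolding first_def
  proof (rule measurable_Least)
    fix k
    have [measurable]: "\<phi> k \<in> borel_measurable borel" by (rule borel_measurable_continuous_onI[OF \<phi>_cont])
    show "Measurable.pred borel (\<lambda>x. \<phi> k x > 0)" by measurable
  qed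
  have \<tau>: "\<tau> \<in> borel_forms A"
  proof (rule borel_formsI)
    show "\<tau> x \<in> cotangent_space A x" for x
      unfolding \<tau>_def by (intro scale_cotangent borel_formsD(1)[OF \<sigma>])
    fix d assume d: "d \<in> A"
    show "(\<lambda>x. \<tau> x d) \<in> borel_measurable (restrict_space borel (chart_dom d))"
      unfolding \<tau>_def
    proof (rule measurable_compose_countable[where f = "\<lambda>k x. complex_of_real (1 / (\<phi> k x)\<^sup>2) *s \<sigma> k x d"])
      show "first \<in> measurable (restrict_space borel (chart_dom d)) (count_space UNIV)"
        by (rule measurable_restrict_space1[OF first_meas])
      fix k
      have [measurable]: "\<phi> k \<in> borel_measurable (restrict_space borel (chart_dom d))"
        by (rule measurable_restrict_space1[OF borel_measurable_continuous_onI[OF \<phi>_cont]])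
      show "(\<lambda>x. complex_of_real (1 / (\<phi> k x)\<^sup>2) *s \<sigma> k x d) \<in> borel_measurable (restrict_space borel (chart_dom d))"
        by (intro borel_measurable_vector_scalar_mult borel_formsD(2)[OF \<sigma> d]) measurable
    qed
  qed
  have glue: "AE x in \<mu>. \<forall>k. (\<lambda>c. of_real ((\<phi> k x)\<^sup>2) *s \<tau> x c) = \<sigma> k x"
  proof -
    \<comment> \<open>There are countably many pairs of indices, so one null set serves for all of
      them.\<close>
    have "AE x in \<mu>. \<forall>k j. (\<lambda>c. of_real ((\<phi> j x)\<^sup>2) *s \<sigma> k x c) = (\<lambda>c. of_real ((\<phi> k x)\<^sup>2) *s \<sigma> j x c)"
      unfolding AE_all_countable using compat by blast
    then show ?thesis
    proof (rule eventually_mono, intro allI ext)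
      fix x k d
      assume "\<forall>k j. (\<lambda>c. of_real ((\<phi> j x)\<^sup>2) *s \<sigma> k x c) = (\<lambda>c. of_real ((\<phi> k x)\<^sup>2) *s \<sigma> j x c)"
      then have eq: "of_real ((\<phi> (first x) x)\<^sup>2) *s \<sigma> k x d = of_real ((\<phi> k x)\<^sup>2) *s \<sigma> (first x) x d"
        by metis
      have "of_real ((\<phi> k x)\<^sup>2) *s \<tau> x d =
        complex_of_real (1 / (\<phi> (first x) x)\<^sup>2) *s (of_real ((\<phi> k x)\<^sup>2) *s \<sigma> (first x) x d)"
        by (simp add: \<tau>_def vector_smult_assoc mult.commute)
      also have "\<dots> = complex_of_real (1 / (\<phi> (first x) x)\<^sup>2 * (\<phi> (first x) x)\<^sup>2) *s \<sigma> k x d"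
        unfolding eq[symmetric] by (simp add: vector_smult_assoc)
      also have "1 / (\<phi> (first x) x)\<^sup>2 * (\<phi> (first x) x)\<^sup>2 = 1" using first[of x] by simp
      finally show "of_real ((\<phi> k x)\<^sup>2) *s \<tau> x d = \<sigma> k x d" by simp
    qed
  qed
  have "integrable \<mu> (\<lambda>x. (\<phi> k x)\<^sup>2 * nm x (\<tau> x))" for k
  proof -
    have ae: "AE x in \<mu>. nm x (\<sigma> k x) = (\<phi> k x)\<^sup>2 * nm x (\<tau> x)"
      using glue
    proof (rule eventually_mono)
      fix x assume "\<forall>k. (\<lambda>c. of_real ((\<phi> k x)\<^sup>2) *s \<tau> x c) = \<sigma> k x"
      then have "\<sigma> k x = (\<lambda>c. of_real ((\<phi> k x)\<^sup>2) *s \<tau> x c)" by simp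
      then show "nm x (\<sigma> k x) = (\<phi> k x)\<^sup>2 * nm x (\<tau> x)"
        by (simp only: cov_norm_scale norm_of_real) simp
    qed
    have "(\<lambda>x. (\<phi> k x)\<^sup>2 * nm x (\<tau> x)) \<in> borel_measurable borel"
      by (intro borel_measurable_times borel_cov_norm \<tau> borel_measurable_continuous_onI \<phi>2)
    then have "(\<lambda>x. (\<phi> k x)\<^sup>2 * nm x (\<tau> x)) \<in> borel_measurable \<mu>"
      using \<mu>(1) by (simp cong: measurable_cong_sets)
    from integrable_cong_AE_imp[OF int[of k] this ae] show ?thesis .
  qed
  moreover have "T (\<lambda>x c. of_real ((\<phi> k x)\<^sup>2) *s \<alpha> x c) =
      (LINT x|\<mu>. of_real ((\<phi> k x)\<^sup>2) * ip x (\<tau> x) (\<alpha> x))"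
    if \<alpha>: "\<alpha> \<in> C0" for k \<alpha>
    unfolding rep[OF \<alpha>]
  proof (rule integral_cong_AE)
    have \<alpha>b: "\<alpha> \<in> borel_forms A" by (intro cont_borel C0_cont \<alpha>)
    show "(\<lambda>x. ip x (\<sigma> k x) (\<alpha> x)) \<in> borel_measurable \<mu>"
      using borel_cov_inner[OF \<sigma> \<alpha>b] \<mu>(1) by (simp cong: measurable_cong_sets)
    have "(\<lambda>x. of_real ((\<phi> k x)\<^sup>2) * ip x (\<tau> x) (\<alpha> x)) \<in> borel_measurable borel"
      by (intro borel_measurable_times \<phi>2b borel_cov_inner \<tau> \<alpha>b)
    then show "(\<lambda>x. of_real ((\<phi> k x)\<^sup>2) * ip x (\<tau> x) (\<alpha> x)) \<in> borel_measurable \<mu>"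
      using \<mu>(1) by (simp cong: measurable_cong_sets)
    show "AE x in \<mu>. ip x (\<sigma> k x) (\<alpha> x) = of_real ((\<phi> k x)\<^sup>2) * ip x (\<tau> x) (\<alpha> x)"
      using glue
    proof (rule eventually_mono)
      fix x assume "\<forall>k. (\<lambda>c. of_real ((\<phi> k x)\<^sup>2) *s \<tau> x c) = \<sigma> k x"
      then have "\<sigma> k x = (\<lambda>c. of_real ((\<phi> k x)\<^sup>2) *s \<tau> x c)" by simp
      then show "ip x (\<sigma> k x) (\<alpha> x) = of_real ((\<phi> k x)\<^sup>2) * ip x (\<tau> x) (\<alpha> x)"
        by (simp only: cov_inner_scale_left complex_cnj_complex_of_real)
    qed
  qed
  ultimately show ?thesis using \<mu> \<tau> by blast
qed

end

section \<open>Integrability of the glued form and its polar decomposition\<close>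

context riemannian_cover
begin

text \<open>For the truncated form, integrability and representation are finite sums of the local
  statements. The truncation is removed by dominated convergence under the integral, and by the
  decay of \<open>\<alpha>\<close> at infinity inside \<open>T\<close>.\<close>

lemma global_representation:
  assumes T: "T \<in> vector_measures A g"
  shows "\<exists>\<mu> \<tau>. sets \<mu> = sets borel \<and> finite_measure \<mu> \<and> \<tau> \<in> borel_forms A \<and>
    integrable \<mu> (\<lambda>x. nm x (\<tau> x)) \<and>
    (\<forall>\<alpha>\<in>C0. T \<alpha> = (LINT x|\<mu>. ip x (\<tau> x) (\<alpha> x)))"
proof -
  obtain \<mu> \<tau> where \<mu>: "sets \<mu> = sets borel" "finite_measure \<mu>" and \<tau>: "\<tau> \<in> borel_forms A"
    and int: "\<And>k. integrable \<mu> (\<lambda>x. (\<phi> k x)\<^sup>2 * nm x (\<tau> x))"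
    and rep: "\<And>k \<alpha>. \<alpha> \<in> C0 \<Longrightarrow> T (\<lambda>x c. of_real ((\<phi> k x)\<^sup>2) *s \<alpha> x c) =
         (LINT x|\<mu>. of_real ((\<phi> k x)\<^sup>2) * ip x (\<tau> x) (\<alpha> x))"
    using glued_representation[OF T] by blast
  obtain C where C: "0 \<le> C" "\<And>\<alpha> b. \<alpha> \<in> C0 \<Longrightarrow> (\<And>x. nm x (\<alpha> x) \<le> b) \<Longrightarrow> cmod (T \<alpha>) \<le> C * b"
    using vector_measure_bound[OF T] by blast
  have meas: "f \<in> borel_measurable \<mu> \<longleftrightarrow> f \<in> borel_measurable borel" for f :: "'m \<Rightarrow> 'z::topological_space"
    using \<mu>(1) by (simp cong: measurable_cong_sets)
  define n where "n x = nm x (\<tau> x)" for x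
  have nb: "n \<in> borel_measurable borel" unfolding n_def[abs_def] by (rule borel_cov_norm[OF \<tau>])
  have n0: "0 \<le> n x" for x by (simp add: n_def)
  have cutb: "(\<lambda>x. complex_of_real (cutoff N x)) \<in> borel_measurable borel" "cutoff N \<in> borel_measurable borel" for N
    by (intro borel_measurable_continuous_onI continuous_on_of_real continuous_cutoff)+
  have int_sq: "integrable \<mu> (\<lambda>x. sqsum N x * n x)" for N
    unfolding sqsum_def sum_distrib_right n_def by (intro Bochner_Integration.integrable_sum int)
  have int_cut: "integrable \<mu> (\<lambda>x. cutoff N x * n x)" for N
  proof (rule Bochner_Integration.integrable_bound)
    show "integrable \<mu> (\<lambda>x. real (Suc N) * (sqsum N x * n x))" using int_sq by (rule integrable_mult_right)
    show "(\<lambda>x. cutoff N x * n x) \<in> borel_measurable \<mu>" unfolding meas by (intro borel_measurable_times cutb nb)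
    have "cutoff N x * n x \<le> real (Suc N) * sqsum N x * n x" for x
      by (intro mult_right_mono n0) (simp add: cutoff_def)
    then show "AE x in \<mu>. norm (cutoff N x * n x) \<le> norm (real (Suc N) * (sqsum N x * n x))"
      using n0 cutoff_range sqsum_nonneg by (intro AE_I2) (simp add: abs_mult mult.assoc)
  qed
  define \<tau>N where "\<tau>N N = (\<lambda>x c. complex_of_real (cutoff N x) *s \<tau> x c)" for N
  have \<tau>N: "\<tau>N N \<in> borel_forms A" for N unfolding \<tau>N_def by (intro borel_scale cutb \<tau>)
  have norm_\<tau>N: "nm x (\<tau>N N x) = cutoff N x * n x" for N x
    unfolding \<tau>N_def cov_norm_scale norm_of_real n_def using cutoff_range(1)[of N x] by simp
  have int_\<tau>N: "integrable \<mu> (\<lambda>x. nm x (\<tau>N N x))" for N unfolding norm_\<tau>N by (rule int_cut)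
  have cutC0: "(\<lambda>x c. complex_of_real (cutoff N x) *s \<alpha> x c) \<in> C0" if "\<alpha> \<in> C0" for N \<alpha>
    by (rule C0_bounded_real_scale[OF that continuous_cutoff, of _ 1]) (use cutoff_range in auto)
  have repN: "T (\<lambda>x c. of_real (cutoff N x) *s \<alpha> x c) = (LINT x|\<mu>. ip x (\<tau>N N x) (\<alpha> x))"
    if \<alpha>: "\<alpha> \<in> C0" for N \<alpha>
  proof -
    \<comment> \<open>Since the cutoff is \<open>sqsum\<close> times the weight, absorbing the
      weight into the form leaves a finite sum of the squares already treated.\<close>
    define \<beta> where "\<beta> = (\<lambda>x c. complex_of_real (weight N x) *s \<alpha> x c)"
    have \<beta>: "\<beta> \<in> C0" unfolding \<beta>_def
      by (rule C0_bounded_real_scale[OF \<alpha> continuous_weight, of _ "real (Suc N)"])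
         (use weight_nonneg[of N] weight_le[of N] in simp)
    obtain b where b: "\<And>x. nm x (\<beta> x) \<le> b" using C0_bounded[OF \<beta>] by blast
    have \<phi>2: "continuous_on UNIV (\<lambda>x. (\<phi> k x)\<^sup>2)" "\<bar>(\<phi> k x)\<^sup>2\<bar> \<le> 1" for k x
      using \<phi>_le1[of k x] \<phi>_nonneg[of k x] by (auto intro!: continuous_intros \<phi>_cont power_le_one)
    have \<phi>2C0: "(\<lambda>x c. complex_of_real ((\<phi> k x)\<^sup>2) *s \<beta> x c) \<in> C0" for k
      by (rule C0_bounded_real_scale[OF \<beta> \<phi>2])
    have ik: "integrable \<mu> (\<lambda>x. of_real ((\<phi> k x)\<^sup>2) * ip x (\<tau> x) (\<beta> x))" for k
    proof (rule Bochner_Integration.integrable_bound)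
      show "integrable \<mu> (\<lambda>x. (\<phi> k x)\<^sup>2 * n x * b)" using int[of k] by (simp add: n_def)
      show "(\<lambda>x. of_real ((\<phi> k x)\<^sup>2) * ip x (\<tau> x) (\<beta> x)) \<in> borel_measurable \<mu>" unfolding meas
        by (intro borel_measurable_times borel_cov_inner \<tau> cont_borel[OF C0_cont[OF \<beta>]]
            borel_measurable_continuous_onI continuous_on_of_real \<phi>2)
      have "cmod (of_real ((\<phi> k x)\<^sup>2) * ip x (\<tau> x) (\<beta> x)) \<le> (\<phi> k x)\<^sup>2 * n x * b" for x
      proof -
        have "cmod (ip x (\<tau> x) (\<beta> x)) \<le> n x * b"
          unfolding n_def by (intro order_trans[OF cov_cauchy_schwarz] mult_left_mono b cov_norm_nonneg)
        then show ?thesis unfolding norm_mult norm_of_real by (simp add: mult.assoc mult_left_mono)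
      qed
      then show "AE x in \<mu>. cmod (of_real ((\<phi> k x)\<^sup>2) * ip x (\<tau> x) (\<beta> x)) \<le> norm ((\<phi> k x)\<^sup>2 * n x * b)"
        by (intro AE_I2) (auto intro: order_trans[OF _ abs_ge_self])
    qed
    have "(\<lambda>x c. of_real (cutoff N x) *s \<alpha> x c) = (\<lambda>x c. \<Sum>k<N. complex_of_real ((\<phi> k x)\<^sup>2) *s \<beta> x c)"
      by (simp add: \<beta>_def fun_eq_iff vec_eq_iff cutoff_weight sqsum_def sum_distrib_right mult.assoc)
    then have "T (\<lambda>x c. of_real (cutoff N x) *s \<alpha> x c) = (\<Sum>k<N. T (\<lambda>x c. complex_of_real ((\<phi> k x)\<^sup>2) *s \<beta> x c))"
      by (simp only:) (intro vector_measure_sum[OF T] \<phi>2C0)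
    also have "\<dots> = (\<Sum>k<N. (LINT x|\<mu>. of_real ((\<phi> k x)\<^sup>2) * ip x (\<tau> x) (\<beta> x)))"
      by (intro sum.cong refl rep \<beta>)
    also have "\<dots> = (LINT x|\<mu>. (\<Sum>k<N. of_real ((\<phi> k x)\<^sup>2) * ip x (\<tau> x) (\<beta> x)))"
      by (intro Bochner_Integration.integral_sum[symmetric] ik)
    also have "\<dots> = (LINT x|\<mu>. ip x (\<tau>N N x) (\<alpha> x))"
    proof (intro Bochner_Integration.integral_cong refl)
      fix x
      show "(\<Sum>k<N. of_real ((\<phi> k x)\<^sup>2) * ip x (\<tau> x) (\<beta> x)) = ip x (\<tau>N N x) (\<alpha> x)"
        unfolding \<beta>_def \<tau>N_def cov_inner_scale_right cov_inner_scale_left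
        by (simp add: cutoff_weight sqsum_def sum_distrib_right mult.assoc)
    qed
    finally show ?thesis .
  qed
  \<comment> \<open>Multiplication by the cutoff keeps a form in the unit ball, so the bound of
    \<open>T\<close> applies with the same \<open>C\<close> for every \<open>N\<close>; the norm
    identity turns it into a bound on the integral.\<close>
  have bound: "(LINT x|\<mu>. cutoff N x * n x) \<le> C" for N
    unfolding norm_\<tau>N[symmetric]
  proof (rule integral_cov_norm_le[OF \<mu> \<tau>N int_\<tau>N])
    fix \<alpha> assume \<alpha>: "\<alpha> \<in> C0" "\<And>x. nm x (\<alpha> x) \<le> 1"
    have "nm x (\<lambda>c. of_real (cutoff N x) *s \<alpha> x c) \<le> 1" for x
      unfolding cov_norm_scale norm_of_real using cutoff_range[of N x] \<alpha>(2)[of x]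
      by (simp add: mult_le_one)
    then show "cmod (LINT x|\<mu>. ip x (\<tau>N N x) (\<alpha> x)) \<le> C"
      using C(2)[OF cutC0[OF \<alpha>(1)], of N 1] unfolding repN[OF \<alpha>(1)] by simp
  qed
  have inc: "incseq (\<lambda>N. LINT x|\<mu>. cutoff N x * n x)"
    by (intro incseq_SucI integral_mono int_cut mult_right_mono cutoff_mono n0) simp
  obtain L where L: "(\<lambda>N. LINT x|\<mu>. cutoff N x * n x) \<longlonglongrightarrow> L"
    using incseq_convergent[OF inc, of C] bound by blast
  have int_n: "integrable \<mu> n"
  proof (rule integrable_monotone_convergence[OF int_cut _ _ L])
    show "AE x in \<mu>. mono (\<lambda>N. cutoff N x * n x)"
      by (intro AE_I2 monoI mult_right_mono cutoff_mono n0)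
    have "(\<lambda>N. cutoff N x * n x) \<longlonglongrightarrow> 1 * n x" for x by (intro tendsto_intros cutoff_tendsto)
    then show "AE x in \<mu>. (\<lambda>N. cutoff N x * n x) \<longlonglongrightarrow> n x" by simp
    show "n \<in> borel_measurable \<mu>" unfolding meas by (rule nb)
  qed
  have "T \<alpha> = (LINT x|\<mu>. ip x (\<tau> x) (\<alpha> x))" if \<alpha>: "\<alpha> \<in> C0" for \<alpha>
  proof -
    obtain b where b: "\<And>x. nm x (\<alpha> x) \<le> b" using C0_bounded[OF \<alpha>] by blast
    have \<alpha>b: "\<alpha> \<in> borel_forms A" by (intro cont_borel C0_cont \<alpha>)
    have "(\<lambda>N. LINT x|\<mu>. ip x (\<tau>N N x) (\<alpha> x)) \<longlonglongrightarrow> (LINT x|\<mu>. ip x (\<tau> x) (\<alpha> x))"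
    proof (rule integral_dominated_convergence[where w = "\<lambda>x. n x * b"])
      show "integrable \<mu> (\<lambda>x. n x * b)" using int_n by simp
      show "(\<lambda>x. ip x (\<tau> x) (\<alpha> x)) \<in> borel_measurable \<mu>"
        unfolding meas by (intro borel_cov_inner \<tau> \<alpha>b)
      show "(\<lambda>x. ip x (\<tau>N N x) (\<alpha> x)) \<in> borel_measurable \<mu>" for N
        unfolding meas by (intro borel_cov_inner \<tau>N \<alpha>b)
      show "AE x in \<mu>. cmod (ip x (\<tau>N N x) (\<alpha> x)) \<le> n x * b" for N
      proof (rule AE_I2)
        fix x
        have "cmod (ip x (\<tau>N N x) (\<alpha> x)) \<le> (cutoff N x * n x) * b"
          unfolding norm_\<tau>N[symmetric] by (intro order_trans[OF cov_cauchy_schwarz] mult_left_mono b cov_norm_nonneg)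
        also have "\<dots> \<le> (1 * n x) * b"
          by (intro mult_right_mono cutoff_range n0 order_trans[OF cov_norm_nonneg b])
        finally show "cmod (ip x (\<tau>N N x) (\<alpha> x)) \<le> n x * b" by simp
      qed
      have "(\<lambda>N. of_real (cutoff N x) * ip x (\<tau> x) (\<alpha> x)) \<longlonglongrightarrow> of_real 1 * ip x (\<tau> x) (\<alpha> x)" for x
        by (intro tendsto_intros cutoff_tendsto)
      then show "AE x in \<mu>. (\<lambda>N. ip x (\<tau>N N x) (\<alpha> x)) \<longlonglongrightarrow> ip x (\<tau> x) (\<alpha> x)"
        by (simp add: \<tau>N_def cov_inner_scale_left)
    qed
    moreover have "(\<lambda>N. T (\<lambda>x c. of_real (cutoff N x) *s \<alpha> x c)) \<longlonglongrightarrow> T \<alpha>"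
    proof (rule LIMSEQ_I)
      fix e :: real assume e: "e > 0"
      \<comment> \<open>\<open>d\<close> bounds \<open>\<alpha>\<close> outside a compact set on
        which the cutoff will be 1, so the discarded part of \<open>\<alpha>\<close> has norm at
        most \<open>d\<close> everywhere. Using \<open>C + 1\<close> allows
        \<open>C = 0\<close>.\<close>
      define d where "d = e / (2 * (C + 1))"
      have C1: "0 < C + 1" using C(1) by simp
      then have d0: "d > 0" unfolding d_def using e by (intro divide_pos_pos) auto
      have "C * d \<le> (C + 1) * d" using d0 by simp
      also have "\<dots> = e / 2" unfolding d_def using C1 by (simp add: divide_simps)
      finally have d: "d > 0" "C * d < e" using d0 e by simp_all
      obtain K where K: "compact K" "\<And>x. x \<notin> K \<Longrightarrow> nm x (\<alpha> x) < d"
        using C0_formsD[OF \<alpha> d(1)] by blast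
      obtain N0 where N0: "\<And>N x. N \<ge> N0 \<Longrightarrow> x \<in> K \<Longrightarrow> cutoff N x = 1" using cutoff_compact[OF K(1)] by blast
      have "norm (T (\<lambda>x c. of_real (cutoff N x) *s \<alpha> x c) - T \<alpha>) < e" if N: "N \<ge> N0" for N
      proof -
        let ?\<beta> = "\<lambda>x c. complex_of_real (cutoff N x) *s \<alpha> x c"
        let ?\<delta> = "\<lambda>x c. complex_of_real (1 - cutoff N x) *s \<alpha> x c"
        have \<delta>: "?\<delta> \<in> C0"
          by (rule C0_bounded_real_scale[OF \<alpha>, of _ 1]) (use cutoff_range in \<open>auto intro!: continuous_intros continuous_cutoff\<close>)
        have "(\<lambda>x c. ?\<beta> x c + ?\<delta> x c) = \<alpha>"
          by (simp add: fun_eq_iff vec_eq_iff algebra_simps)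
        then have "T \<alpha> = T (\<lambda>x c. ?\<beta> x c + ?\<delta> x c)" by (simp only:)
        also have "\<dots> = T ?\<beta> + T ?\<delta>" by (rule vector_measure_add[OF T cutC0[OF \<alpha>] \<delta>])
        finally have "T \<alpha> = T ?\<beta> + T ?\<delta>" .
        then have "norm (T ?\<beta> - T \<alpha>) = norm (T ?\<delta>)" by simp
        also have "\<dots> \<le> C * d"
        proof (rule C(2)[OF \<delta>])
          fix x
          show "nm x (?\<delta> x) \<le> d"
          proof (cases "x \<in> K")
            case True then show ?thesis using N0[OF N True] d(1) by simp
          next
            case False
            have "\<bar>1 - cutoff N x\<bar> * nm x (\<alpha> x) \<le> 1 * d"
              using cutoff_range[of N x] K(2)[OF False] d(1) by (intro mult_mono) auto
            then show ?thesis unfolding cov_norm_scale norm_of_real by simp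
          qed
        qed
        also have "\<dots> < e" by (rule d(2))
        finally show ?thesis .
      qed
      then show "\<exists>N0. \<forall>N\<ge>N0. norm (T (\<lambda>x c. of_real (cutoff N x) *s \<alpha> x c) - T \<alpha>) < e" by blast
    qed
    ultimately show ?thesis unfolding repN[OF \<alpha>] using LIMSEQ_unique by blast
  qed
  then show ?thesis using \<mu> \<tau> int_n by (auto simp: n_def[abs_def])
qed

lemma polar_pairsD:
  assumes "(\<mu>, \<sigma>) \<in> polar_pairs A g"
  shows "sets \<mu> = sets borel" "finite_measure \<mu>" "\<sigma> \<in> borel_forms A"
    "AE x in \<mu>. nm x (\<sigma> x) = 1" "integrable \<mu> (\<lambda>x. nm x (\<sigma> x))"
    "(LINT x|\<mu>. nm x (\<sigma> x)) = measure \<mu> UNIV"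
proof -
  show \<mu>: "sets \<mu> = sets borel" "finite_measure \<mu>" "\<sigma> \<in> borel_forms A" and ae: "AE x in \<mu>. nm x (\<sigma> x) = 1"
    using assms by (auto simp: polar_pairs_def)
  interpret finite_measure \<mu> by fact
  have m: "(\<lambda>x. nm x (\<sigma> x)) \<in> borel_measurable \<mu>"
    using borel_cov_norm[OF \<mu>(3)] \<mu>(1) by (simp cong: measurable_cong_sets)
  show "integrable \<mu> (\<lambda>x. nm x (\<sigma> x))"
    by (rule integrable_const_bound[of _ 1]) (use ae m in \<open>auto elim: eventually_mono\<close>)
  have "(LINT x|\<mu>. nm x (\<sigma> x)) = (LINT x|\<mu>. 1)" by (rule integral_cong_AE) (use m ae in auto)
  then show "(LINT x|\<mu>. nm x (\<sigma> x)) = measure \<mu> UNIV"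
    using sets_eq_imp_space_eq[OF \<mu>(1)] by simp
qed

text \<open>The norm of \<open>\<tau>\<close> moves into the measure and its direction remains in
  \<open>\<sigma>\<close>.\<close>

lemma polar_decomposition:
  assumes T: "T \<in> vector_measures A g"
  shows "\<exists>\<mu> \<sigma>. (\<mu>, \<sigma>) \<in> polar_pairs A g \<and>
    (\<forall>\<alpha>\<in>C0. T \<alpha> = (LINT x|\<mu>. ip x (\<sigma> x) (\<alpha> x)))"
proof -
  obtain \<nu> \<tau> where \<nu>: "sets \<nu> = sets borel" "finite_measure \<nu>" and \<tau>: "\<tau> \<in> borel_forms A"
    and int: "integrable \<nu> (\<lambda>x. nm x (\<tau> x))"
    and rep: "\<And>\<alpha>. \<alpha> \<in> C0 \<Longrightarrow> T \<alpha> = (LINT x|\<nu>. ip x (\<tau> x) (\<alpha> x))"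
    using global_representation[OF T] by blast
  define n where "n x = nm x (\<tau> x)" for x
  have nb: "n \<in> borel_measurable borel" unfolding n_def[abs_def] by (rule borel_cov_norm[OF \<tau>])
  then have nm: "n \<in> borel_measurable \<nu>" using \<nu>(1) by (simp cong: measurable_cong_sets)
  have n0: "0 \<le> n x" for x by (simp add: n_def)
  define \<mu> where "\<mu> = density \<nu> (\<lambda>x. ennreal (n x))"
  \<comment> \<open>Where \<open>\<tau>\<close> vanishes, \<open>\<sigma>\<close> is 0 and not a
    unit covector, but that set is null for the weighted measure.\<close>
  define \<sigma> where "\<sigma> = (\<lambda>x c. complex_of_real (1 / n x) *s \<tau> x c)"
  have \<sigma>: "\<sigma> \<in> borel_forms A" unfolding \<sigma>_def using nb by (intro borel_scale \<tau>) measurable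
  have "finite_measure \<mu>"
    unfolding \<mu>_def by (rule finite_measure_densityI[OF _ n0]) (use int in \<open>simp add: n_def[abs_def]\<close>)
  moreover have "AE x in \<mu>. nm x (\<sigma> x) = 1"
  proof -
    have "nm x (\<sigma> x) = 1" if "0 < n x" for x
      unfolding \<sigma>_def cov_norm_scale norm_of_real using that by (simp flip: n_def)
    then show ?thesis unfolding \<mu>_def using nm by (simp add: AE_density)
  qed
  moreover have "sets \<mu> = sets borel" using \<nu>(1) by (simp add: \<mu>_def)
  ultimately have "(\<mu>, \<sigma>) \<in> polar_pairs A g" using \<sigma> by (simp add: polar_pairs_def)
  moreover have "T \<alpha> = (LINT x|\<mu>. ip x (\<sigma> x) (\<alpha> x))" if \<alpha>: "\<alpha> \<in> C0" for \<alpha>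
  proof -
    have m: "(\<lambda>x. ip x (\<sigma> x) (\<alpha> x)) \<in> borel_measurable \<nu>"
      using borel_cov_inner[OF \<sigma> cont_borel[OF C0_cont[OF \<alpha>]]] \<nu>(1) by (simp cong: measurable_cong_sets)
    \<comment> \<open>At zeros of \<open>n\<close> the pairing with \<open>\<tau>\<close> vanishes
      by Cauchy-Schwarz.\<close>
    have eq: "ip x (\<tau> x) (\<alpha> x) = n x *\<^sub>R ip x (\<sigma> x) (\<alpha> x)" for x
    proof (cases "n x = 0")
      case True
      then show ?thesis using cov_cauchy_schwarz[of x "\<tau> x" "\<alpha> x"] by (simp flip: n_def)
    next
      case False
      then show ?thesis by (simp add: \<sigma>_def cov_inner_scale_left scaleR_conv_of_real)
    qed
    have "T \<alpha> = (LINT x|\<nu>. n x *\<^sub>R ip x (\<sigma> x) (\<alpha> x))" unfolding rep[OF \<alpha>] eq ..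
    also have "\<dots> = (LINT x|\<mu>. ip x (\<sigma> x) (\<alpha> x))"
      unfolding \<mu>_def using n0 nm m by (subst integral_density) auto
    finally show ?thesis .
  qed
  ultimately show ?thesis by blast
qed

text \<open>This rewrites a pair over a reference measure without losing information:
  \<open>\<sigma>\<close> has norm 1 wherever \<open>D\<close> is positive, so the norm of
  \<open>\<tau>\<close> recovers the density.\<close>

lemma polar_density:
  assumes p: "(\<mu>, \<sigma>) \<in> polar_pairs A g" and \<nu>: "sets \<nu> = sets borel"
    and D: "D \<in> borel_measurable \<nu>" "\<And>x. 0 \<le> D x" "\<mu> = density \<nu> (\<lambda>x. ennreal (D x))" "integrable \<nu> D"
    and \<tau>_def: "\<tau> = (\<lambda>x c. complex_of_real (D x) *s \<sigma> x c)"
  shows "\<tau> \<in> borel_forms A" "AE x in \<nu>. nm x (\<tau> x) = D x" "integrable \<nu> (\<lambda>x. nm x (\<tau> x))"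
    "\<alpha> \<in> C0 \<Longrightarrow> (LINT x|\<mu>. ip x (\<sigma> x) (\<alpha> x)) = (LINT x|\<nu>. ip x (\<tau> x) (\<alpha> x))"
proof -
  note P = polar_pairsD[OF p]
  have meas: "f \<in> borel_measurable \<nu> \<longleftrightarrow> f \<in> borel_measurable borel" for f :: "'m \<Rightarrow> 'z::topological_space"
    using \<nu> by (simp cong: measurable_cong_sets)
  show \<tau>: "\<tau> \<in> borel_forms A" unfolding \<tau>_def using D(1) by (intro borel_scale P(3)) (simp add: meas)
  have "AE x in \<nu>. 0 < ennreal (D x) \<longrightarrow> nm x (\<sigma> x) = 1"
    using P(4) unfolding D(3) by (subst (asm) AE_density) (use D(1) in auto)
  then show n: "AE x in \<nu>. nm x (\<tau> x) = D x"
  proof (rule eventually_mono)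
    fix x assume "0 < ennreal (D x) \<longrightarrow> nm x (\<sigma> x) = 1"
    then show "nm x (\<tau> x) = D x"
      unfolding \<tau>_def cov_norm_scale norm_of_real using D(2)[of x] by (cases "D x = 0") auto
  qed
  show "integrable \<nu> (\<lambda>x. nm x (\<tau> x))"
    by (rule integrable_cong_AE_imp[OF D(4)]) (use n borel_cov_norm[OF \<tau>] in \<open>auto simp: meas elim: eventually_mono\<close>)
  assume \<alpha>: "\<alpha> \<in> C0"
  show "(LINT x|\<mu>. ip x (\<sigma> x) (\<alpha> x)) = (LINT x|\<nu>. ip x (\<tau> x) (\<alpha> x))"
    unfolding D(3) \<tau>_def cov_inner_scale_left
    using D(1,2) borel_cov_inner[OF P(3) cont_borel[OF C0_cont[OF \<alpha>]]]
    by (subst integral_density) (auto simp: meas scaleR_conv_of_real)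
qed

text \<open>Over a common reference measure the difference of the two weighted forms represents 0,
  so they agree almost everywhere. Taking norms identifies the densities, hence the measures;
  dividing where the density is positive identifies the sections.\<close>

lemma polar_unique:
  assumes p: "(\<mu>, \<sigma>) \<in> polar_pairs A g" and q: "(\<mu>', \<sigma>') \<in> polar_pairs A g"
    and eq: "\<And>\<alpha>. \<alpha> \<in> C0 \<Longrightarrow>
      (LINT x|\<mu>. ip x (\<sigma> x) (\<alpha> x)) = (LINT x|\<mu>'. ip x (\<sigma>' x) (\<alpha> x))"
  shows "\<mu> = \<mu>'" "AE x in \<mu>. \<sigma> x = \<sigma>' x"
proof -
  note P = polar_pairsD[OF p] and Q = polar_pairsD[OF q]
  \<comment> \<open>A family indexed by booleans presents two measures to
    \<open>dominating_measure\<close>.\<close>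
  define m where "m b = (if b then \<mu> else \<mu>')" for b
  have "sets (m b) = sets borel" "finite_measure (m b)" for b using P Q by (auto simp: m_def)
  then obtain \<nu> where \<nu>: "sets \<nu> = sets borel" "finite_measure \<nu>" "\<And>b. absolutely_continuous \<nu> (m b)"
    using dominating_measure[of m borel] by blast
  have ac: "absolutely_continuous \<nu> \<mu>" "absolutely_continuous \<nu> \<mu>'" using \<nu>(3)[of True] \<nu>(3)[of False] by (auto simp: m_def)
  have s: "sets \<mu> = sets \<nu>" "sets \<mu>' = sets \<nu>" using P(1) Q(1) \<nu>(1) by simp_all
  obtain D where D: "D \<in> borel_measurable \<nu>" "\<And>x. 0 \<le> D x" "\<mu> = density \<nu> (\<lambda>x. ennreal (D x))" "integrable \<nu> D"
    by (rule finite_measure_density[OF \<nu>(2) P(2) s(1) ac(1)]) (rule that)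
  obtain D' where D': "D' \<in> borel_measurable \<nu>" "\<And>x. 0 \<le> D' x" "\<mu>' = density \<nu> (\<lambda>x. ennreal (D' x))" "integrable \<nu> D'"
    by (rule finite_measure_density[OF \<nu>(2) Q(2) s(2) ac(2)]) (rule that)
  define s1 where "s1 = (\<lambda>x c. complex_of_real (D x) *s \<sigma> x c)"
  define s2 where "s2 = (\<lambda>x c. complex_of_real (D' x) *s \<sigma>' x c)"
  note S1 = polar_density[OF p \<nu>(1) D s1_def] and S2 = polar_density[OF q \<nu>(1) D' s2_def]
  define \<omega> where "\<omega> = (\<lambda>x c. s1 x c - s2 x c)"
  have \<omega>: "\<omega> \<in> borel_forms A" unfolding \<omega>_def by (intro borel_diff S1(1) S2(1))
  have i\<omega>: "integrable \<nu> (\<lambda>x. nm x (\<omega> x))"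
  proof (rule Bochner_Integration.integrable_bound)
    show "integrable \<nu> (\<lambda>x. nm x (s1 x) + nm x (s2 x))" using S1(3) S2(3) by simp
    show "(\<lambda>x. nm x (\<omega> x)) \<in> borel_measurable \<nu>"
      using borel_cov_norm[OF \<omega>] \<nu>(1) by (simp cong: measurable_cong_sets)
    show "AE x in \<nu>. norm (nm x (\<omega> x)) \<le> norm (nm x (s1 x) + nm x (s2 x))"
      unfolding \<omega>_def using cov_norm_minus by (intro AE_I2) simp
  qed
  have "AE x in \<nu>. \<omega> x = (\<lambda>c. 0)"
  proof (rule AE_zero_form[OF \<nu>(1,2) \<omega> i\<omega>])
    fix \<alpha> assume \<alpha>: "\<alpha> \<in> C0"
    show "(LINT x|\<nu>. ip x (\<omega> x) (\<alpha> x)) = 0"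
      unfolding \<omega>_def cov_inner_diff_left using eq[OF \<alpha>] S1(4)[OF \<alpha>] S2(4)[OF \<alpha>]
        integrable_cov_inner[OF \<nu>(1) S1(1,3) \<alpha>] integrable_cov_inner[OF \<nu>(1) S2(1,3) \<alpha>] by simp
  qed
  then have "AE x in \<nu>. s1 x = s2 x" by (rule eventually_mono) (auto simp: \<omega>_def fun_eq_iff)
  with S1(2) S2(2) have both: "AE x in \<nu>. s1 x = s2 x \<and> D x = D' x" by eventually_elim auto
  then have "AE x in \<nu>. ennreal (D x) = ennreal (D' x)" by eventually_elim simp
  then show "\<mu> = \<mu>'" unfolding D(3) D'(3) using D(1) D'(1) by (intro density_cong) auto
  have "AE x in \<nu>. 0 < ennreal (D x) \<longrightarrow> \<sigma> x = \<sigma>' x"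
    using both
  proof (rule eventually_mono)
    fix x assume a: "s1 x = s2 x \<and> D x = D' x"
    show "0 < ennreal (D x) \<longrightarrow> \<sigma> x = \<sigma>' x"
    proof (intro impI ext)
      fix c assume "0 < ennreal (D x)"
      then have "D x \<noteq> 0" by auto
      moreover have "complex_of_real (D x) *s \<sigma> x c = complex_of_real (D x) *s \<sigma>' x c"
        using a by (metis s1_def s2_def)
      ultimately show "\<sigma> x c = \<sigma>' x c" by (simp add: vec_eq_iff)
    qed
  qed
  then show "AE x in \<mu>. \<sigma> x = \<sigma>' x" unfolding D(3) using D(1) by (subst AE_density) auto
qed

section \<open>The induced map on equivalence classes, its norm and its bijectivity\<close>

lemma psi_apply: "\<alpha> \<in> C0 \<Longrightarrow> psi A g (\<mu>, \<sigma>) \<alpha> = (LINT x|\<mu>. ip x (\<sigma> x) (\<alpha> x))"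
  by (simp add: psi_def)

lemma psi_bound:
  assumes p: "(\<mu>, \<sigma>) \<in> polar_pairs A g" and \<alpha>: "\<alpha> \<in> C0"
  shows "cmod (psi A g (\<mu>, \<sigma>) \<alpha>) \<le> measure \<mu> UNIV * sup_norm A g \<alpha>"
proof -
  note P = polar_pairsD[OF p]
  have "cmod (psi A g (\<mu>, \<sigma>) \<alpha>) \<le> (LINT x|\<mu>. cmod (ip x (\<sigma> x) (\<alpha> x)))"
    unfolding psi_apply[OF \<alpha>] by (rule integral_norm_bound)
  also have "\<dots> \<le> (LINT x|\<mu>. nm x (\<sigma> x) * sup_norm A g \<alpha>)"
  proof (rule integral_mono)
    show "integrable \<mu> (\<lambda>x. cmod (ip x (\<sigma> x) (\<alpha> x)))"
      using integrable_cov_inner[OF P(1,3,5) \<alpha>] by simp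
    show "integrable \<mu> (\<lambda>x. nm x (\<sigma> x) * sup_norm A g \<alpha>)" using P(5) by simp
    show "cmod (ip x (\<sigma> x) (\<alpha> x)) \<le> nm x (\<sigma> x) * sup_norm A g \<alpha>" for x
      by (intro order_trans[OF cov_cauchy_schwarz] mult_left_mono cov_norm_le_sup_norm \<alpha> cov_norm_nonneg)
  qed
  also have "\<dots> = measure \<mu> UNIV * sup_norm A g \<alpha>" using P(6) by simp
  finally show ?thesis .
qed

lemma psi_vector_measure:
  assumes p: "(\<mu>, \<sigma>) \<in> polar_pairs A g"
  shows "psi A g (\<mu>, \<sigma>) \<in> vector_measures A g"
proof -
  note P = polar_pairsD[OF p]
  note int = integrable_cov_inner[OF P(1,3,5)]
  have "psi A g (\<mu>, \<sigma>) \<in> extensional (C0)" by (simp add: psi_def)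
  moreover have "psi A g (\<mu>, \<sigma>) (\<lambda>x c. \<alpha> x c + \<beta> x c) = psi A g (\<mu>, \<sigma>) \<alpha> + psi A g (\<mu>, \<sigma>) \<beta>"
    if "\<alpha> \<in> C0" "\<beta> \<in> C0" for \<alpha> \<beta>
    using that int by (simp add: psi_apply C0_add cov_inner_add_right)
  moreover have "psi A g (\<mu>, \<sigma>) (\<lambda>x c. a *s \<alpha> x c) = a * psi A g (\<mu>, \<sigma>) \<alpha>" if "\<alpha> \<in> C0" for \<alpha> a
    using that by (subst (1 2) psi_apply) (auto simp: cov_inner_scale_right intro: C0_scale[of \<alpha> "\<lambda>x. a" "cmod a"])
  ultimately show ?thesis unfolding vector_measures_def using psi_bound[OF p] by blast
qed

text \<open>The upper bound is Cauchy-Schwarz with a unit section. For the lower bound the supremum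
  itself, once finite, is the constant in \<open>integral_cov_norm_le\<close>, and the integral of
  the norm of a unit section is the total mass.\<close>

lemma dual_norm_psi:
  assumes p: "(\<mu>, \<sigma>) \<in> polar_pairs A g"
  shows "dual_norm A g (C0) (psi A g (\<mu>, \<sigma>)) = emeasure \<mu> UNIV"
proof (rule antisym)
  note P = polar_pairsD[OF p]
  interpret finite_measure \<mu> by (rule P(2))
  let ?S = "dual_norm A g (C0) (psi A g (\<mu>, \<sigma>))"
  show "?S \<le> emeasure \<mu> UNIV"
    unfolding dual_norm_def emeasure_eq_measure
  proof (intro SUP_least ennreal_leI)
    fix \<alpha> assume "\<alpha> \<in> {\<alpha> \<in> C0. sup_norm A g \<alpha> \<le> 1}"
    then have "cmod (psi A g (\<mu>, \<sigma>) \<alpha>) \<le> measure \<mu> UNIV * sup_norm A g \<alpha>" "sup_norm A g \<alpha> \<le> 1"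
      using psi_bound[OF p] by auto
    then show "cmod (psi A g (\<mu>, \<sigma>) \<alpha>) \<le> measure \<mu> UNIV"
      using mult_left_mono[of "sup_norm A g \<alpha>" 1 "measure \<mu> UNIV"] by simp
  qed
  show "emeasure \<mu> UNIV \<le> ?S"
  proof (cases "?S = \<infinity>")
    case False
    then have S: "?S = ennreal (enn2real ?S)" by (simp add: less_top)
    have "measure \<mu> UNIV \<le> enn2real ?S"
      unfolding P(6)[symmetric]
    proof (rule integral_cov_norm_le[OF P(1,2,3,5)])
      fix \<alpha> assume \<alpha>: "\<alpha> \<in> C0" "\<And>x. nm x (\<alpha> x) \<le> 1"
      have "ennreal (cmod (psi A g (\<mu>, \<sigma>) \<alpha>)) \<le> ?S"
        unfolding dual_norm_def using \<alpha> sup_norm_le[of \<alpha> 1] by (intro SUP_upper) auto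
      then have "ennreal (cmod (psi A g (\<mu>, \<sigma>) \<alpha>)) \<le> ennreal (enn2real ?S)" using S by simp
      then show "cmod (LINT x|\<mu>. ip x (\<sigma> x) (\<alpha> x)) \<le> enn2real ?S"
        by (simp add: psi_apply[OF \<alpha>(1)] ennreal_le_iff)
    qed
    then have "emeasure \<mu> UNIV \<le> ennreal (enn2real ?S)" unfolding emeasure_eq_measure by (rule ennreal_leI)
    then show ?thesis using S by simp
  qed simp
qed

lemma psi_respects: "psi A g respects polar_rel A g"
proof (rule congruentI)
  fix p q assume pq: "(p, q) \<in> polar_rel A g"
  obtain \<mu> \<sigma> where p: "p = (\<mu>, \<sigma>)" by (cases p)
  obtain \<mu>' \<sigma>' where q: "q = (\<mu>', \<sigma>')" by (cases q)
  have *: "(\<mu>, \<sigma>) \<in> polar_pairs A g" "(\<mu>', \<sigma>') \<in> polar_pairs A g" "\<mu> = \<mu>'" "AE x in \<mu>. \<sigma> x = \<sigma>' x"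
    using pq by (auto simp: p q polar_rel_def)
  note P = polar_pairsD[OF *(1)] and Q = polar_pairsD[OF *(2)]
  show "psi A g p = psi A g q"
  proof
    fix \<alpha>
    show "psi A g p \<alpha> = psi A g q \<alpha>"
    proof (cases "\<alpha> \<in> C0")
      case True
      have "(LINT x|\<mu>. ip x (\<sigma> x) (\<alpha> x)) = (LINT x|\<mu>. ip x (\<sigma>' x) (\<alpha> x))"
      proof (rule integral_cong_AE)
        show "(\<lambda>x. ip x (\<sigma> x) (\<alpha> x)) \<in> borel_measurable \<mu>"
          using integrable_cov_inner[OF P(1,3,5) True] by simp
        show "(\<lambda>x. ip x (\<sigma>' x) (\<alpha> x)) \<in> borel_measurable \<mu>"
          using integrable_cov_inner[OF Q(1,3,5) True] *(3) by simp
        show "AE x in \<mu>. ip x (\<sigma> x) (\<alpha> x) = ip x (\<sigma>' x) (\<alpha> x)"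
          using *(4) by eventually_elim simp
      qed
      then show ?thesis using *(3) by (simp add: p q psi_apply[OF True])
    next
      case False then show ?thesis by (simp add: p q psi_def)
    qed
  qed
qed

text \<open>The image of a class under \<open>psi\<close> is a singleton by
  \<open>psi_respects\<close>, so \<open>the_elem\<close> returns its only value.\<close>

lemma Psi_class:
  assumes "p \<in> polar_pairs A g"
  shows "Psi A g (polar_rel A g `` {p}) = psi A g p"
proof -
  have "psi A g ` (polar_rel A g `` {p}) = {psi A g p}"
  proof
    show "psi A g ` (polar_rel A g `` {p}) \<subseteq> {psi A g p}"
      using congruentD[OF psi_respects] by fastforce
    have "p \<in> polar_rel A g `` {p}" by (rule equiv_class_self[OF equiv_polar_rel assms])
    then show "{psi A g p} \<subseteq> psi A g ` (polar_rel A g `` {p})" by blast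
  qed
  then show ?thesis by (simp add: Psi_def)
qed

lemma psi_inject:
  assumes "p \<in> polar_pairs A g" "q \<in> polar_pairs A g" "psi A g p = psi A g q"
  shows "(p, q) \<in> polar_rel A g"
proof -
  obtain \<mu> \<sigma> where p: "p = (\<mu>, \<sigma>)" by (cases p)
  obtain \<mu>' \<sigma>' where q: "q = (\<mu>', \<sigma>')" by (cases q)
  have "(LINT x|\<mu>. ip x (\<sigma> x) (\<alpha> x)) = (LINT x|\<mu>'. ip x (\<sigma>' x) (\<alpha> x))"
    if "\<alpha> \<in> C0" for \<alpha>
    using fun_cong[OF assms(3), of \<alpha>] by (simp add: p q psi_apply[OF that])
  from polar_unique[OF assms(1,2)[unfolded p q] this] show ?thesis
    using assms(1,2) unfolding p q polar_rel_def by blast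
qed

lemma bij_betw_Psi: "bij_betw (Psi A g) (polar_classes A g) (vector_measures A g)"
  unfolding bij_betw_def
proof
  show "inj_on (Psi A g) (polar_classes A g)"
  proof (rule inj_onI)
    fix X Y assume "X \<in> polar_classes A g" "Y \<in> polar_classes A g" and eq: "Psi A g X = Psi A g Y"
    then obtain p q where p: "p \<in> polar_pairs A g" "X = polar_rel A g `` {p}"
      and q: "q \<in> polar_pairs A g" "Y = polar_rel A g `` {q}"
      unfolding polar_classes_def by (auto elim!: quotientE)
    then have "(p, q) \<in> polar_rel A g" using eq by (intro psi_inject) (simp_all add: Psi_class)
    then show "X = Y" unfolding p q by (rule equiv_class_eq[OF equiv_polar_rel])
  qed
  show "Psi A g ` polar_classes A g = vector_measures A g"
  proof (intro equalityI subsetI)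
    fix T assume "T \<in> Psi A g ` polar_classes A g"
    then obtain p where "p \<in> polar_pairs A g" "T = psi A g p"
      unfolding polar_classes_def by (auto elim!: quotientE simp: Psi_class)
    then show "T \<in> vector_measures A g" using psi_vector_measure by (cases p) auto
  next
    fix T assume T: "T \<in> vector_measures A g"
    obtain \<mu> \<sigma> where p: "(\<mu>, \<sigma>) \<in> polar_pairs A g"
      and rep: "\<And>\<alpha>. \<alpha> \<in> C0 \<Longrightarrow> T \<alpha> = (LINT x|\<mu>. ip x (\<sigma> x) (\<alpha> x))"
      using polar_decomposition[OF T] by blast
    have "T = psi A g (\<mu>, \<sigma>)"
    proof (rule extensionalityI[of _ "C0"])
      show "T \<in> extensional (C0)" using T by (simp add: vector_measures_def)
      show "psi A g (\<mu>, \<sigma>) \<in> extensional (C0)" by (simp add: psi_def)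
    qed (simp add: psi_apply rep)
    then have "T = Psi A g (polar_rel A g `` {(\<mu>, \<sigma>)})" by (simp add: Psi_class[OF p])
    moreover have "polar_rel A g `` {(\<mu>, \<sigma>)} \<in> polar_classes A g"
      unfolding polar_classes_def by (rule quotientI[OF p])
    ultimately show "T \<in> Psi A g ` polar_classes A g" by blast
  qed
qed

end

text \<open>The restriction of \<open>dist_diff\<close> to test forms is invisible here, because
  both suprema range over test forms in the unit ball.\<close>

lemma Var_eq_dual_norm: "Var A g f = dual_norm A g (test_forms A) (dist_diff A g f)"
  unfolding Var_def dual_norm_def dist_diff_def by (intro SUP_cong) auto

theorem theorem2p5:
  fixes A :: "('m::{t2_space, second_countable_topology}, 'n::finite) chart set"
    and g :: "('m, 'n) metric_field"
  assumes "riemannian_manifold A g"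
    and "connected (UNIV :: 'm set)"
  shows
    "((\<forall>(\<mu>, \<sigma>) \<in> polar_pairs A g. \<forall>\<alpha> \<in> C0_forms A g.
         integrable \<mu> (\<lambda>x. cov_inner A g x (\<sigma> x) (\<alpha> x))) \<and>
      psi A g respects polar_rel A g \<and>
      bij_betw (Psi A g) (polar_classes A g) (vector_measures A g) \<and>
      (\<forall>(\<mu>, \<sigma>) \<in> polar_pairs A g.
         dual_norm A g (C0_forms A g) (Psi A g (polar_rel A g `` {(\<mu>, \<sigma>)})) = emeasure \<mu> UNIV))
     \<and>
     (\<forall>f \<in> L1_loc A g.
        (Var A g f < \<infinity> \<longleftrightarrow> dual_norm A g (test_forms A) (dist_diff A g f) < \<infinity>) \<and>
        (Var A g f < \<infinity> \<longrightarrow> Var A g f = dual_norm A g (test_forms A) (dist_diff A g f)))"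
proof -
  interpret riemannian A g by standard (rule assms(1))
  obtain \<phi> supp c where "riemannian_cover A g \<phi> supp c" using ex_cover by blast
  then interpret riemannian_cover A g \<phi> supp c .
  have "integrable \<mu> (\<lambda>x. cov_inner A g x (\<sigma> x) (\<alpha> x))"
    if "(\<mu>, \<sigma>) \<in> polar_pairs A g" "\<alpha> \<in> C0_forms A g" for \<mu> \<sigma> \<alpha>
    by (rule integrable_cov_inner[OF polar_pairsD(1,3,5)[OF that(1)] that(2)])
  moreover have "dual_norm A g (C0_forms A g) (Psi A g (polar_rel A g `` {(\<mu>, \<sigma>)})) = emeasure \<mu> UNIV"
    if "(\<mu>, \<sigma>) \<in> polar_pairs A g" for \<mu> \<sigma>
    unfolding Psi_class[OF that] by (rule dual_norm_psi[OF that])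
  ultimately show ?thesis
    using psi_respects bij_betw_Psi by (auto simp: Var_eq_dual_norm)
qed

end
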